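(* Let $K$ be any graph which is not a forest, and fix $t>1$. Let $n\to\infty$, let $d=d(n)$ be positive integers with $dn$ even, and suppose $p:=\frac{d}{n}$ satisfies $(n^{-1}\log n)^{\frac{1}{2\Delta_{*}(K)}}\ll p\ll 1$. Then \[-\log\left(\Pr\left[\mathrm{Hom}(K,G_n^d)\geq (t+o(1))p^{e(K)}n^{v(K)}\right]\right)\geq (1-o(1))\Phi_n^d(K,t)\] as $n\to\infty$.
   Context: Graphs have no isolated vertices; $v(K)$, $e(K)$ count vertices and edges. $G_n^d$ is a uniformly random $d$-regular graph on $[n]$; $\mathrm{Hom}(K,G)$ is the number of maps $V(K)\to V(G)$ sending edges to edges. $\Delta_*(K)=\frac12\max_{vw\in E(K)}(\deg_K(v)+\deg_K(w))$. A graphon is a symmetric measurable $W:[0,1]^2\to[0,1]$; it is $p$-regular if $\int_0^1W(x,y)\,dy=p$ for all $x$. $\mathrm{Hom}(K,W)=\int_{[0,1]^{V(K)}}\prod_{uv\in E(K)}W(x_u,x_v)\prod_v dx_v$. For $x\in[0,1]$, $I_p(x)=x\log\frac xp+(1-x)\log\frac{1-x}{1-p}$ (with $0\log0=0$), and $I_p(W)=\int_{[0,1]^2}I_p(W(x,y))\,dx\,dy$. With $p=d/n$, $\Phi_n^d(K,t)=\frac{n^2}{2}\inf\{I_p(W): W\text{ a }p\text{-regular graphon},\ \mathrm{Hom}(K,W)\ge tp^{e(K)}\}$. $f\ll g$ means $f=o(g)$ as $n\to\infty$. *)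

theory Defs
  imports "HOL-Probability.Probability" "HOL-Library.Landau_Symbols"
begin

record 'a ugraph =
  verts :: "'a set"
  edges :: "'a set set"

definition simple_graph :: "'a ugraph \<Rightarrow> bool" where
  "simple_graph G \<longleftrightarrow>
     finite (verts G) \<and> (\<forall>e\<in>edges G. e \<subseteq> verts G \<and> card e = 2)"

definition deg :: "'a ugraph \<Rightarrow> 'a \<Rightarrow> nat" where
  "deg G v = card {e \<in> edges G. v \<in> e}"

definition no_isolated_verts :: "'a ugraph \<Rightarrow> bool" where
  "no_isolated_verts G \<longleftrightarrow> (\<forall>v\<in>verts G. \<exists>e\<in>edges G. v \<in> e)"

definition is_cycle :: "'a ugraph \<Rightarrow> 'a list \<Rightarrow> bool" where
  "is_cycle G vs \<longleftrightarrow> 3 \<le> length vs \<and> distinct vs \<and>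
     (\<forall>i<length vs. {vs ! i, vs ! (Suc i mod length vs)} \<in> edges G)"

definition forest :: "'a ugraph \<Rightarrow> bool" where
  "forest G \<longleftrightarrow> \<not> (\<exists>vs. is_cycle G vs)"

definition Delta_star :: "'a ugraph \<Rightarrow> real" where
  "Delta_star K = 1/2 * real (Max {deg K v + deg K w | v w. {v, w} \<in> edges K})"

text \<open>Since every edge of \<open>G\<close> has exactly two elements, \<open>f ` e \<in> edges G\<close> forces the
  endpoints of \<open>e\<close> to have distinct, adjacent images.\<close>

definition hom_count :: "'a ugraph \<Rightarrow> 'b ugraph \<Rightarrow> nat" where
  "hom_count K G = card {f \<in> verts K \<rightarrow>\<^sub>E verts G. \<forall>e\<in>edges K. f ` e \<in> edges G}"

definition regular_graphs :: "nat \<Rightarrow> nat \<Rightarrow> nat ugraph set" where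
  "regular_graphs n d =
     {G. simple_graph G \<and> verts G = {1..n} \<and> (\<forall>v\<in>verts G. deg G v = d)}"

text \<open>Meaningful only when a \<open>d\<close>-regular graph on \<open>{1..n}\<close> exists, i.e. for
  \<open>d < n\<close> and \<open>d * n\<close> even.\<close>

definition random_regular_graph :: "nat \<Rightarrow> nat \<Rightarrow> nat ugraph pmf" where
  "random_regular_graph n d = pmf_of_set (regular_graphs n d)"

definition unit_interval :: "real measure" where
  "unit_interval = restrict_space lborel {0..1}"

text \<open>Only the restriction of \<open>W\<close> to the unit square matters. Measurability is Borel
  measurability, so that all sections are measurable.\<close>

definition graphon :: "(real \<Rightarrow> real \<Rightarrow> real) \<Rightarrow> bool" where
  "graphon W \<longleftrightarrow>
     (\<lambda>(x, y). W x y) \<in> borel_measurable (unit_interval \<Otimes>\<^sub>M unit_interval) \<and>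
     (\<forall>x\<in>{0..1}. \<forall>y\<in>{0..1}. W x y = W y x \<and> 0 \<le> W x y \<and> W x y \<le> 1)"

definition regular_graphon :: "real \<Rightarrow> (real \<Rightarrow> real \<Rightarrow> real) \<Rightarrow> bool" where
  "regular_graphon p W \<longleftrightarrow> graphon W \<and> (\<forall>x\<in>{0..1}. (LINT y|unit_interval. W x y) = p)"

text \<open>\<open>W (x u) (x v)\<close> for the unordered pair \<open>{u, v}\<close>. By symmetry of a graphon this does
  not depend on which endpoint comes first.\<close>

definition edge_weight :: "(real \<Rightarrow> real \<Rightarrow> real) \<Rightarrow> ('a \<Rightarrow> real) \<Rightarrow> 'a set \<Rightarrow> real" where
  "edge_weight W x e = (let (u, v) = (SOME (u, v). e = {u, v}) in W (x u) (x v))"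

definition hom_density :: "'a ugraph \<Rightarrow> (real \<Rightarrow> real \<Rightarrow> real) \<Rightarrow> real" where
  "hom_density K W =
     (LINT x|(PiM (verts K) (\<lambda>_. unit_interval)). (\<Prod>e\<in>edges K. edge_weight W x e))"

text \<open>The convention \<open>0 * log 0 = 0\<close> is automatic here, as \<open>0 * ln 0 = 0\<close>.\<close>

definition rel_entropy :: "real \<Rightarrow> real \<Rightarrow> real" where
  "rel_entropy p x = x * ln (x / p) + (1 - x) * ln ((1 - x) / (1 - p))"

definition graphon_entropy :: "real \<Rightarrow> (real \<Rightarrow> real \<Rightarrow> real) \<Rightarrow> real" where
  "graphon_entropy p W =
     (LINT z|(unit_interval \<Otimes>\<^sub>M unit_interval). rel_entropy p (W (fst z) (snd z)))"

text \<open>The infimum is taken in the extended reals, so it is \<open>\<infinity>\<close> if no graphon is admissible.\<close>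

definition Phi :: "nat \<Rightarrow> nat \<Rightarrow> 'a ugraph \<Rightarrow> real \<Rightarrow> ereal" where
  "Phi n d K t = (let p = real d / real n in
     ereal (real n ^ 2 / 2) *
     (INF W\<in>{W. regular_graphon p W \<and> hom_density K W \<ge> t * p ^ card (edges K)}.
        ereal (graphon_entropy p W)))"

text \<open>An impossible event has \<open>- log Pr = \<infinity>\<close>, whereas \<open>ln 0 = 0\<close> for \<open>ln\<close> on the reals.\<close>

definition neg_log :: "real \<Rightarrow> ereal" where
  "neg_log q = (if q = 0 then \<infinity> else ereal (- ln q))"

end

theory Submission
  imports Defs
begin

text \<open>The \<open>d\<close>-regular graphs on \<open>n\<close> vertices are covered by classes on which the adjacency matrix is
  almost constant in operator norm, by greedily subtracting discretised rank one matrices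
  from \<open>A - p\<close> for at most \<open>k\<close> steps. If \<open>S\<close> is a set of \<open>d\<close>-regular graphs and \<open>w\<close> is the average of
  their adjacency matrices, subadditivity of entropy gives
  \<open>ln |S| \<le> n\<^sup>2/2 (h(p) - I\<^sub>p(w))\<close>, while the number of all \<open>d\<close>-regular graphs is at least
  \<open>exp (n\<^sup>2/2 h(p) - O(n log n))\<close>. So it is enough that \<open>n\<^sup>2/2 I\<^sub>p(w) \<ge> \<Phi>\<close> for the part of each class in
  the upper tail event. If the greedy procedure stopped early, the class has small diameter, and a
  counting lemma shows that \<open>w\<close> (or \<open>(w + p)/2\<close>) is admissible for \<open>\<Phi>\<close>. If it ran for \<open>k\<close> steps, then \<open>w\<close> is
  far from \<open>p\<close> in \<open>L\<^sup>2\<close>, and its entropy is large by Pinsker's inequality. The counting lemma, compared with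
  the constant graphon, also gives \<open>\<Phi> \<ge> c n\<^sup>2 p\<^bsup>2\<Delta>\<^esup>\<close>, which dominates \<open>n log n\<close> in the given range of \<open>p\<close>; this
  makes the cost of the union bound over the codes negligible.\<close>

section \<open>Entropy\<close>

text \<open>The exponent \<open>Delta_star\<close> comes from the counting lemma. Changing the
  kernel on an edge \<open>uv\<close> costs at most the norm of the change times the geometric mean
  of the densities of the two graphs left after deleting all edges at \<open>u\<close>, or all edges
  at \<open>v\<close>. If these have the expected orders \<open>p^(e - deg u)\<close> and
  \<open>p^(e - deg v)\<close>, a norm \<open>\<delta> * p powr \<Delta>\<close> with
  \<open>2 * \<Delta> \<ge> deg u + deg v\<close> makes the error small relative to
  \<open>p^e\<close>. The obstacle is that a graph in the upper tail may contain some subgraph far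
  too often, so that these densities are out of control; hence the detour through
  \<open>(w + p)/2\<close>. Averages suit the variational problem for two reasons: the average of
  \<open>d\<close>-regular matrices has row sums \<open>d\<close>, so its graphon is exactly
  \<open>p\<close>-regular, and for a fixed code all conditions are convex, so the average has the
  code of its members. A code letter costs \<open>O(n ln n)\<close> and gains order
  \<open>\<tau>\<^sup>2\<close>. With \<open>\<tau>\<close> of order
  \<open>\<delta> * n * p powr \<Delta>\<close>, the total cost for a gain of \<open>\<Phi>\<close>
  is \<open>\<Phi>\<close> times \<open>\<rho> / \<delta>\<^sup>2\<close>, where
  \<open>\<rho> = ln n / (n * p powr (2 * \<Delta>))\<close>; the choice
  \<open>\<delta> = \<rho> powr (1/4)\<close> sends both \<open>\<delta>\<close> and this factor to
  0.\<close>

definition binary_entropy :: "real \<Rightarrow> real" where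
  "binary_entropy x = - (x * ln x) - (1 - x) * ln (1 - x)"

text \<open>Beyond \<open>binary_entropy\<close> only a term affine in \<open>x\<close> remains.
  Over matrices with a fixed total sum, relative and binary entropy therefore add up to a
  constant.\<close>

lemma rel_entropy_eq:
  assumes "0 < p" "p < 1" "0 \<le> x" "x \<le> 1"
  shows "rel_entropy p x = - binary_entropy x - x * ln p - (1 - x) * ln (1 - p)"
proof -
  have "x * ln (x / p) = x * ln x - x * ln p"
    using assms by (cases "x = 0") (auto simp: ln_div algebra_simps)
  moreover have "(1 - x) * ln ((1 - x) / (1 - p)) = (1 - x) * ln (1 - x) - (1 - x) * ln (1 - p)"
    using assms by (cases "x = 1") (auto simp: ln_div algebra_simps)
  ultimately show ?thesis
    unfolding rel_entropy_def binary_entropy_def by simp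
qed

lemma xlnx_midpoint:
  fixes x y :: real
  assumes "0 \<le> x" "0 < y"
  shows "(x + y) / 2 * ln ((x + y) / 2) \<le> (x * ln x + y * ln y) / 2"
proof -
  define m where "m = (x + y) / 2"
  have m: "m > 0" using assms by (simp add: m_def)
  \<comment> \<open>The tangent to \<open>z * ln z\<close> at \<open>m\<close>. Added at
    \<open>x\<close> and \<open>y\<close>, the terms \<open>z - m\<close> cancel because
    \<open>m\<close> is the mean.\<close>
  have *: "z * ln z \<ge> z * ln m + z - m" if "z \<ge> 0" for z
  proof (cases "z = 0")
    case False
    then have z: "z > 0" using that by simp
    have "ln (m / z) \<le> m / z - 1" using m z by (intro ln_le_minus_one) simp
    then have "z * ln (m / z) \<le> z * (m / z - 1)" using z by (intro mult_left_mono) auto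
    then show ?thesis using z m by (simp add: ln_div algebra_simps)
  qed (use m in simp)
  have "x * ln x + y * ln y \<ge> (x + y) * ln m + (x + y) - 2 * m"
    using *[of x] *[of y] assms by (simp add: algebra_simps)
  moreover have "2 * m = x + y" by (simp add: m_def)
  ultimately have "(x + y) * ln m \<le> x * ln x + y * ln y" by linarith
  then show ?thesis by (simp add: m_def)
qed

text \<open>Convexity together with \<open>rel_entropy p p = 0\<close>. This is what pays for mixing
  a graphon with the constant \<open>p\<close>.\<close>

lemma rel_entropy_midpoint:
  assumes "0 < p" "p < 1" "0 \<le> x" "x \<le> 1"
  shows "rel_entropy p ((x + p) / 2) \<le> rel_entropy p x / 2"
proof -
  have 1: "(x + p) / 2 * ln ((x + p) / 2) \<le> (x * ln x + p * ln p) / 2"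
    using assms by (intro xlnx_midpoint) auto
  have 2: "((1 - x) + (1 - p)) / 2 * ln (((1 - x) + (1 - p)) / 2)
      \<le> ((1 - x) * ln (1 - x) + (1 - p) * ln (1 - p)) / 2"
    using assms by (intro xlnx_midpoint) auto
  have e: "((1 - x) + (1 - p)) / 2 = 1 - (x + p) / 2" by (simp add: field_simps)
  have "rel_entropy p ((x + p) / 2) = (x + p) / 2 * ln ((x + p) / 2)
      + (1 - (x + p) / 2) * ln (1 - (x + p) / 2)
      - (x + p) / 2 * ln p - (1 - (x + p) / 2) * ln (1 - p)"
    using assms by (subst rel_entropy_eq) (auto simp: binary_entropy_def)
  also have "\<dots> \<le> (x * ln x + p * ln p) / 2 + ((1 - x) * ln (1 - x) + (1 - p) * ln (1 - p)) / 2
      - (x + p) / 2 * ln p - (1 - (x + p) / 2) * ln (1 - p)"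
    using 1 2 unfolding e by linarith
  also have "\<dots> = rel_entropy p x / 2"
    using assms by (subst rel_entropy_eq) (auto simp: binary_entropy_def field_simps)
  finally show ?thesis .
qed

text \<open>The entropy bounds the Hellinger distance \<open>(sqrt x - sqrt p)\<^sup>2\<close>.\<close>

lemma rel_entropy_ge_square:
  assumes "0 < p" "p < 1" "0 \<le> x" "x \<le> 1"
  shows "rel_entropy p x \<ge> (x - p)\<^sup>2 / 4"
proof -
  \<comment> \<open>Using \<open>ln y \<le> y - 1\<close> at \<open>sqrt (b / a)\<close> instead of
    \<open>b / a\<close> produces square roots. The bounds for the two outcomes then add up to
    \<open>(sqrt x - sqrt p)\<^sup>2\<close> plus the same square for the complements, which is
    dropped.\<close>
  have *: "a * ln (a / b) \<ge> 2 * a - 2 * sqrt a * sqrt b" if "0 \<le> a" "0 < b" for a b :: real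
  proof (cases "a = 0")
    case False
    then have a: "a > 0" using that by simp
    have "ln (sqrt (b / a)) \<le> sqrt (b / a) - 1"
      using a that by (intro ln_le_minus_one) auto
    moreover have "ln (sqrt (b / a)) = - ln (a / b) / 2"
      using a that by (simp add: ln_sqrt ln_div)
    ultimately have "ln (a / b) \<ge> 2 - 2 * sqrt (b / a)" by simp
    then have "a * ln (a / b) \<ge> a * (2 - 2 * sqrt (b / a))"
      using a by (intro mult_left_mono) auto
    also have "a * (2 - 2 * sqrt (b / a)) = 2 * a - 2 * (a * sqrt (b / a))"
      by (simp add: algebra_simps)
    also have "a * sqrt (b / a) = sqrt a * sqrt b"
      using a by (simp add: real_sqrt_divide field_simps)
    finally show ?thesis by simp
  qed simp
  have 1: "rel_entropy p x \<ge> 2 - 2 * sqrt x * sqrt p - 2 * sqrt (1 - x) * sqrt (1 - p)"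
    using *[of x p] *[of "1 - x" "1 - p"] assms unfolding rel_entropy_def by simp
  have "0 \<le> (sqrt (1 - x) - sqrt (1 - p))\<^sup>2" by simp
  then have 2: "2 * sqrt (1 - x) * sqrt (1 - p) \<le> 2 - x - p"
    using assms by (simp add: power2_diff)
  have 3: "(sqrt x - sqrt p)\<^sup>2 = x + p - 2 * sqrt x * sqrt p"
    using assms by (simp add: power2_diff)
  have "x - p = (sqrt x - sqrt p) * (sqrt x + sqrt p)"
    using assms by (simp add: algebra_simps)
  then have "(x - p)\<^sup>2 = (sqrt x - sqrt p)\<^sup>2 * (sqrt x + sqrt p)\<^sup>2"
    by (simp add: power_mult_distrib)
  also have "\<dots> \<le> (sqrt x - sqrt p)\<^sup>2 * 2\<^sup>2"
  proof (intro mult_left_mono power_mono)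
    have "sqrt x \<le> 1" "sqrt p \<le> 1" using assms by auto
    then show "sqrt x + sqrt p \<le> 2" by linarith
  qed (use assms in auto)
  finally show ?thesis using 1 2 3 by simp
qed

text \<open>Gibbs' inequality for the uniform distribution on \<open>S\<close> and the product measure with the same
  marginals.\<close>

lemma ln_card_le_sum_binary_entropy:
  fixes S :: "'b set set"
  assumes "finite U" "S \<subseteq> Pow U" "S \<noteq> {}"
  shows "ln (real (card S))
    \<le> (\<Sum>e\<in>U. binary_entropy (real (card {A \<in> S. e \<in> A}) / real (card S)))"
proof -
  define w where "w e = real (card {A \<in> S. e \<in> A}) / real (card S)" for e
  define Q where "Q A = (\<Prod>e\<in>U. if e \<in> A then w e else 1 - w e)" for A
  have fS: "finite S" using assms finite_subset by blast
  have cS: "real (card S) > 0" using fS assms by (simp add: card_gt_0_iff)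
  have w01: "0 \<le> w e" "w e \<le> 1" for e
    using cS fS by (auto simp: w_def divide_le_eq intro!: card_mono)
  have w1: "real (card {A \<in> S. e \<notin> A}) = real (card S) * (1 - w e)" for e
  proof -
    have "card S = card {A \<in> S. e \<in> A} + card {A \<in> S. e \<notin> A}"
      using fS by (subst card_Un_disjoint[symmetric]) (auto intro!: arg_cong[where f=card])
    then show ?thesis using cS by (simp add: w_def field_simps)
  qed
  have w0: "real (card {A \<in> S. e \<in> A}) = real (card S) * w e" for e
    using cS by (simp add: w_def)
  \<comment> \<open>The set \<open>A\<close> itself is counted in the numerator of each of its
    factors, so no logarithm of 0 occurs below.\<close>
  have pos: "(if e \<in> A then w e else 1 - w e) > 0" if "A \<in> S" for A e
  proof (cases "e \<in> A")
    case True
    then have "{A \<in> S. e \<in> A} \<noteq> {}" using that by auto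
    then have "card {A \<in> S. e \<in> A} > 0" using fS by (simp add: card_gt_0_iff)
    then show ?thesis using True cS by (simp add: w_def)
  next
    case False
    then have "{A \<in> S. e \<notin> A} \<noteq> {}" using that by auto
    then have "real (card {A \<in> S. e \<notin> A}) > 0" using fS by (simp add: card_gt_0_iff)
    then show ?thesis using False cS w1[of e] by (simp add: zero_less_mult_iff)
  qed
  have Qpos: "Q A > 0" if "A \<in> S" for A
    unfolding Q_def using pos[OF that] by (intro prod_pos) auto
  have Qnn: "Q A \<ge> 0" for A
    unfolding Q_def using w01 by (intro prod_nonneg) auto
  have "(\<Sum>A\<in>Pow U. Q A) = (\<Prod>e\<in>U. w e + (1 - w e))"
  proof -
    have "(\<Prod>e\<in>U. w e + (1 - w e)) = (\<Sum>A\<in>Pow U. (\<Prod>e\<in>A. w e) * (\<Prod>e\<in>U - A. 1 - w e))"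
      using assms(1) by (rule prod_add)
    also have "\<dots> = (\<Sum>A\<in>Pow U. Q A)"
    proof (rule sum.cong[OF refl])
      fix A assume "A \<in> Pow U"
      then have "Q A = (\<Prod>e\<in>A. if e \<in> A then w e else 1 - w e)
          * (\<Prod>e\<in>U - A. if e \<in> A then w e else 1 - w e)"
        unfolding Q_def using assms(1) by (subst prod.subset_diff[of A U]) (auto simp: mult.commute)
      then show "(\<Prod>e\<in>A. w e) * (\<Prod>e\<in>U - A. 1 - w e) = Q A" by simp
    qed
    finally show ?thesis by simp
  qed
  then have sumQ: "(\<Sum>A\<in>Pow U. Q A) = 1" by simp
  have Qs: "(\<Sum>A\<in>S. Q A) \<le> 1"
    using sum_mono2[of "Pow U" S Q] assms Qnn sumQ by simp
  \<comment> \<open>Here \<open>ln y \<le> y - 1\<close> is applied to the ratio of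
    \<open>Q A\<close> to the uniform mass \<open>1 / card S\<close>.\<close>
  have "(\<Sum>A\<in>S. ln (real (card S) * Q A)) \<le> (\<Sum>A\<in>S. real (card S) * Q A - 1)"
    using cS Qpos by (intro sum_mono ln_le_minus_one) auto
  also have "\<dots> = real (card S) * (\<Sum>A\<in>S. Q A) - real (card S)"
    by (simp add: sum_subtractf sum_distrib_left)
  also have "\<dots> \<le> 0" using Qs cS by (simp add: mult_le_cancel_left1)
  finally have 1: "(\<Sum>A\<in>S. ln (real (card S) * Q A)) \<le> 0" .
  have "(\<Sum>A\<in>S. ln (real (card S) * Q A)) = real (card S) * ln (real (card S)) + (\<Sum>A\<in>S. ln (Q A))"
  proof -
    have "(\<Sum>A\<in>S. ln (real (card S) * Q A)) = (\<Sum>A\<in>S. ln (real (card S)) + ln (Q A))"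
      using cS Qpos by (intro sum.cong refl ln_mult_pos)
    then show ?thesis by (simp add: sum.distrib)
  qed
  moreover have "(\<Sum>A\<in>S. ln (Q A)) = - real (card S) * (\<Sum>e\<in>U. binary_entropy (w e))"
  proof -
    have "(\<Sum>A\<in>S. ln (Q A)) = (\<Sum>A\<in>S. \<Sum>e\<in>U. ln (if e \<in> A then w e else 1 - w e))"
      unfolding Q_def
    proof (intro sum.cong[OF refl] ln_prod)
      fix A e assume "A \<in> S"
      then show "(if e \<in> A then w e else 1 - w e) \<noteq> 0" using pos[of A e] by simp
    qed (use assms in auto)
    also have "\<dots> = (\<Sum>e\<in>U. \<Sum>A\<in>S. ln (if e \<in> A then w e else 1 - w e))"
      by (rule sum.swap)
    also have "\<dots> = (\<Sum>e\<in>U. - real (card S) * binary_entropy (w e))"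
    proof (rule sum.cong[OF refl])
      fix e assume "e \<in> U"
      have "(\<Sum>A\<in>S. ln (if e \<in> A then w e else 1 - w e))
          = (\<Sum>A\<in>{A \<in> S. e \<in> A}. ln (w e)) + (\<Sum>A\<in>{A \<in> S. e \<notin> A}. ln (1 - w e))"
      proof -
        have "(\<Sum>A\<in>S. ln (if e \<in> A then w e else 1 - w e))
            = (\<Sum>A\<in>S. if e \<in> A then ln (w e) else ln (1 - w e))"
          by (intro sum.cong) auto
        also have "\<dots> = (\<Sum>A\<in>S \<inter> {A. e \<in> A}. ln (w e)) + (\<Sum>A\<in>S \<inter> - {A. e \<in> A}. ln (1 - w e))"
          using fS by (rule sum.If_cases)
        also have "S \<inter> {A. e \<in> A} = {A \<in> S. e \<in> A}" by auto
        also have "S \<inter> - {A. e \<in> A} = {A \<in> S. e \<notin> A}" by auto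
        finally show ?thesis .
      qed
      also have "\<dots> = - real (card S) * binary_entropy (w e)"
        by (simp add: w0 w1 binary_entropy_def algebra_simps)
      finally show "(\<Sum>A\<in>S. ln (if e \<in> A then w e else 1 - w e)) = - real (card S) * binary_entropy (w e)" .
    qed
    finally show ?thesis by (simp add: sum_distrib_left)
  qed
  ultimately have "real (card S) * (ln (real (card S)) - (\<Sum>e\<in>U. binary_entropy (w e))) \<le> 0"
    using 1 by (simp add: algebra_simps)
  then have "ln (real (card S)) - (\<Sum>e\<in>U. binary_entropy (w e)) \<le> 0"
    using cS by (simp add: mult_le_0_iff)
  then show ?thesis by (simp add: w_def)
qed

section \<open>Counting regular graphs\<close>

text \<open>Each \<open>x\<close> spreads weight 1 evenly over its neighbours. Along an edge the
  degree of \<open>y\<close> is at most that of \<open>x\<close>, so a share is at most the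
  reciprocal of the degree of \<open>y\<close>, and \<open>y\<close> receives at most 1 in
  total.\<close>

lemma card_le_by_degrees:
  assumes "finite X" "finite Y"
    and ex: "\<And>x. x \<in> X \<Longrightarrow> \<exists>y\<in>Y. r x y"
    and le: "\<And>x y. x \<in> X \<Longrightarrow> y \<in> Y \<Longrightarrow> r x y \<Longrightarrow> card {x' \<in> X. r x' y} \<le> card {y' \<in> Y. r x y'}"
  shows "card X \<le> card Y"
proof -
  define a where "a x = real (card {y' \<in> Y. r x y'})" for x
  define b where "b y = real (card {x' \<in> X. r x' y})" for y
  have a: "a x > 0" if "x \<in> X" for x
    using ex[OF that] assms by (auto simp: a_def card_gt_0_iff)
  have "real (card X) = (\<Sum>x\<in>X. \<Sum>y\<in>{y \<in> Y. r x y}. 1 / a x)"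
  proof -
    have "(\<Sum>y\<in>{y \<in> Y. r x y}. 1 / a x) = 1" if "x \<in> X" for x
      using a[OF that] by (simp add: a_def)
    then have "(\<Sum>x\<in>X. \<Sum>y\<in>{y \<in> Y. r x y}. 1 / a x) = (\<Sum>x\<in>X. 1)" by (rule sum.cong[OF refl])
    then show ?thesis by simp
  qed
  also have "\<dots> \<le> (\<Sum>x\<in>X. \<Sum>y\<in>{y \<in> Y. r x y}. 1 / b y)"
  proof (intro sum_mono)
    fix x y assume x: "x \<in> X" and "y \<in> {y \<in> Y. r x y}"
    then have y: "y \<in> Y" "r x y" by auto
    have "x \<in> {x' \<in> X. r x' y}" using x y by simp
    then have "b y > 0" using assms(1) unfolding b_def by (simp add: card_gt_0_iff) blast
    moreover have "b y \<le> a x" using le[OF x y] by (simp add: a_def b_def)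
    ultimately show "1 / a x \<le> 1 / b y" by (simp add: frac_le)
  qed
  also have "\<dots> = (\<Sum>x\<in>X. \<Sum>y\<in>Y. if r x y then 1 / b y else 0)"
    using assms by (simp add: sum.inter_filter)
  also have "\<dots> = (\<Sum>y\<in>Y. \<Sum>x\<in>X. if r x y then 1 / b y else 0)"
    by (rule sum.swap)
  also have "\<dots> = (\<Sum>y\<in>Y. b y * (1 / b y))"
    using assms by (simp add: sum.inter_filter[symmetric] b_def)
  also have "\<dots> \<le> (\<Sum>y\<in>Y. 1)" by (intro sum_mono) auto
  finally show ?thesis by simp
qed

section \<open>Graphs with prescribed degrees\<close>

definition pairs :: "'v set \<Rightarrow> 'v set set" where
  "pairs V = {e. e \<subseteq> V \<and> card e = 2}"

definition edeg :: "'v set set \<Rightarrow> 'v \<Rightarrow> nat" where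
  "edeg E v = card {e \<in> E. v \<in> e}"

definition degree_class :: "'v set \<Rightarrow> ('v \<Rightarrow> nat) \<Rightarrow> 'v set set set" where
  "degree_class V f = {E. E \<subseteq> pairs V \<and> (\<forall>v\<in>V. edeg E v = f v)}"

lemma finite_pairs: "finite V \<Longrightarrow> finite (pairs V)"
  unfolding pairs_def by (rule finite_subset[of _ "Pow V"]) auto

lemma card_pairs: "finite V \<Longrightarrow> card (pairs V) = card V choose 2"
  unfolding pairs_def by (rule n_subsets)

lemma finite_degree_class: "finite V \<Longrightarrow> finite (degree_class V f)"
  unfolding degree_class_def
  by (rule finite_subset[of _ "Pow (pairs V)"]) (auto simp: finite_pairs)

lemma doubleton_in_pairs: "{a, b} \<in> pairs V \<longleftrightarrow> a \<in> V \<and> b \<in> V \<and> a \<noteq> b"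
  by (auto simp: pairs_def card_insert_if)

lemma pairsE:
  assumes "e \<in> pairs V" "v \<in> e"
  obtains x where "e = {v, x}" "x \<in> V" "x \<noteq> v"
proof -
  from assms obtain a b where "e = {a, b}" "a \<noteq> b"
    by (auto simp: pairs_def card_2_iff)
  then show ?thesis using assms that[of a] that[of b]
    by (auto simp: pairs_def insert_commute)
qed

lemma edeg_eq_card_neighbours:
  assumes "E \<subseteq> pairs V"
  shows "edeg E v = card {x \<in> V - {v}. {v, x} \<in> E}"
proof -
  have "{e \<in> E. v \<in> e} = (\<lambda>x. {v, x}) ` {x \<in> V - {v}. {v, x} \<in> E}"
  proof (intro equalityI subsetI)
    fix e assume "e \<in> {e \<in> E. v \<in> e}"
    then have e: "e \<in> E" "e \<in> pairs V" "v \<in> e" using assms by auto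
    from e(2,3) obtain x where "e = {v, x}" "x \<in> V" "x \<noteq> v" by (rule pairsE)
    then show "e \<in> (\<lambda>x. {v, x}) ` {x \<in> V - {v}. {v, x} \<in> E}" using e by auto
  qed auto
  moreover have "inj_on (\<lambda>x. {v, x}) {x \<in> V - {v}. {v, x} \<in> E}"
    by (auto simp: inj_on_def doubleton_eq_iff)
  ultimately show ?thesis unfolding edeg_def by (simp add: card_image)
qed

lemma edeg_insert:
  assumes "finite E" "a \<notin> E"
  shows "edeg (insert a E) v = edeg E v + of_bool (v \<in> a)"
proof -
  have "{e \<in> insert a E. v \<in> e} = (if v \<in> a then insert a {e \<in> E. v \<in> e} else {e \<in> E. v \<in> e})"
    by auto
  then show ?thesis using assms by (simp add: edeg_def)
qed

lemma edeg_remove: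
  assumes "finite E" "a \<in> E"
  shows "edeg E v = edeg (E - {a}) v + of_bool (v \<in> a)"
  using edeg_insert[of "E - {a}" a v] assms by (simp add: insert_absorb)

lemma sum_edeg:
  assumes "finite V" "E \<subseteq> pairs V"
  shows "(\<Sum>v\<in>V. edeg E v) = 2 * card E"
proof -
  have fE: "finite E" using assms finite_pairs finite_subset by blast
  have "(\<Sum>v\<in>V. edeg E v) = (\<Sum>v\<in>V. \<Sum>e\<in>E. of_bool (v \<in> e))"
    using fE by (simp add: edeg_def of_bool_def sum.inter_filter[symmetric])
  also have "\<dots> = (\<Sum>e\<in>E. \<Sum>v\<in>V. of_bool (v \<in> e))" by (rule sum.swap)
  also have "\<dots> = (\<Sum>e\<in>E. 2)"
  proof (rule sum.cong[OF refl])
    fix e assume "e \<in> E"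
    then have "e \<subseteq> V" "card e = 2" using assms by (auto simp: pairs_def)
    then have "{v \<in> V. v \<in> e} = e" by auto
    then show "(\<Sum>v\<in>V. of_bool (v \<in> e)) = (2::nat)"
      using assms \<open>card e = 2\<close> by (simp add: of_bool_def sum.inter_filter[symmetric])
  qed
  finally show ?thesis by simp
qed

text \<open>Moving the end of an edge from \<open>i\<close> to \<open>j\<close> relates the two classes. A graph of the first
  class has at least as many images as each of its images has preimages, since
  \<open>deg i > deg j\<close>.\<close>

lemma card_degree_class_move:
  assumes V: "finite V" "i \<in> V" "j \<in> V" and ij: "f j < f i"
  shows "card (degree_class V f) \<le> card (degree_class V (f(i := f i - 1, j := f j + 1)))"
proof -
  have "i \<noteq> j" using ij by auto
  \<comment> \<open>The vertices \<open>x\<close> for which the edge \<open>{a, x}\<close> can be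
    moved to \<open>{b, x}\<close> without hitting an existing edge.\<close>
  define A where "A a b E = {x \<in> V - {i, j}. {a, x} \<in> E \<and> {b, x} \<notin> E}" for a b and E :: "'a set set"
  define mv where "mv a b E x = insert {b, x} (E - {{a, x}})" for a b x and E :: "'a set set"
  define r where "r E E' \<longleftrightarrow> (\<exists>x\<in>A i j E. E' = mv i j E x)" for E E'
  let ?g = "f(i := f i - 1, j := f j + 1)"
  have finA: "finite (A a b E)" for a b E using V by (simp add: A_def)
  \<comment> \<open>Common neighbours and a possible edge \<open>{i, j}\<close> count equally in
    both degrees, so the two sets differ in size by \<open>f i - f j\<close>.\<close>
  have cardA: "card (A i j E) \<ge> Suc (card (A j i E))" if "E \<in> degree_class V f" for E
  proof -
    have E: "E \<subseteq> pairs V" "edeg E i = f i" "edeg E j = f j"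
      using that V by (auto simp: degree_class_def)
    define C where "C = {x \<in> V - {i, j}. {i, x} \<in> E \<and> {j, x} \<in> E}"
    have C: "finite C" using V by (simp add: C_def)
    define Z where "Z a = (if {i, j} \<in> E then {a} else {})" for a :: 'a
    have 1: "{x \<in> V - {i}. {i, x} \<in> E} = (A i j E \<union> C) \<union> Z j"
      using V \<open>i \<noteq> j\<close> by (auto simp: A_def C_def Z_def)
    have 2: "{x \<in> V - {j}. {j, x} \<in> E} = (A j i E \<union> C) \<union> Z i"
      using V \<open>i \<noteq> j\<close> by (auto simp: A_def C_def Z_def insert_commute)
    have "f i = card (A i j E) + card C + card (Z j)"
      unfolding E(2)[symmetric] edeg_eq_card_neighbours[OF E(1)] 1 using C finA
      by (subst card_Un_disjoint, simp, simp add: Z_def, force simp: Z_def A_def C_def)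
         (subst card_Un_disjoint, auto simp: A_def C_def)
    moreover have "f j = card (A j i E) + card C + card (Z i)"
      unfolding E(3)[symmetric] edeg_eq_card_neighbours[OF E(1)] 2 using C finA
      by (subst card_Un_disjoint, simp, simp add: Z_def, force simp: Z_def A_def C_def)
         (subst card_Un_disjoint, auto simp: A_def C_def)
    moreover have "card (Z i) = card (Z j)" by (simp add: Z_def)
    ultimately show ?thesis using ij by linarith
  qed
  have mv_in: "mv i j E x \<in> degree_class V ?g" if E: "E \<in> degree_class V f" and x: "x \<in> A i j E" for E x
  proof -
    have fE: "finite E" using E V finite_pairs finite_subset by (auto simp: degree_class_def)
    have x': "x \<in> V" "x \<noteq> i" "x \<noteq> j" "{i, x} \<in> E" "{j, x} \<notin> E" using x by (auto simp: A_def)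
    have "edeg (mv i j E x) v = ?g v" if "v \<in> V" for v
    proof -
      have "edeg (mv i j E x) v = edeg (E - {{i, x}}) v + of_bool (v \<in> {j, x})"
        unfolding mv_def using fE x' by (subst edeg_insert) auto
      moreover have "f v = edeg (E - {{i, x}}) v + of_bool (v \<in> {i, x})"
        using edeg_remove[OF fE x'(4), of v] E that by (auto simp: degree_class_def)
      ultimately show ?thesis using x' \<open>i \<noteq> j\<close> by (auto split: if_splits)
    qed
    then show ?thesis using E x' V
      by (auto simp: degree_class_def mv_def doubleton_in_pairs)
  qed
  have card_out: "card {E' \<in> degree_class V ?g. r E E'} = card (A i j E)" if E: "E \<in> degree_class V f" for E
  proof -
    have "{E' \<in> degree_class V ?g. r E E'} = mv i j E ` A i j E"
      using mv_in[OF E] by (auto simp: r_def)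
    moreover have "inj_on (mv i j E) (A i j E)"
    proof (rule inj_onI)
      fix x y assume x: "x \<in> A i j E" and y: "y \<in> A i j E" and eq: "mv i j E x = mv i j E y"
      have "{j, x} \<in> mv i j E y" unfolding eq[symmetric] by (simp add: mv_def)
      moreover have "{j, x} \<notin> E" using x by (simp add: A_def)
      ultimately have "{j, x} = {j, y}" by (auto simp: mv_def)
      then show "x = y" using x y by (auto simp: A_def doubleton_eq_iff)
    qed
    ultimately show ?thesis by (simp add: card_image)
  qed
  show ?thesis
  proof (rule card_le_by_degrees[where r = r])
    fix E assume E: "E \<in> degree_class V f"
    then have "A i j E \<noteq> {}" using cardA by fastforce
    then show "\<exists>E'\<in>degree_class V ?g. r E E'" using mv_in[OF E] by (auto simp: r_def)
  next
    fix E E' assume E: "E \<in> degree_class V f" and E': "E' \<in> degree_class V ?g" and "r E E'"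
    then obtain x where x: "x \<in> A i j E" "E' = mv i j E x" by (auto simp: r_def)
    \<comment> \<open>A preimage is recovered by the reverse move along an element of
      \<open>A j i E'\<close>. Compared with \<open>A j i E\<close> this set gains at most the
      vertex \<open>x\<close>, and the strict inequality in \<open>cardA\<close> leaves room for
      it.\<close>
    have "{F \<in> degree_class V f. r F E'} \<subseteq> mv j i E' ` A j i E'"
    proof clarify
      fix F assume "F \<in> degree_class V f" "r F E'"
      then obtain y where y: "y \<in> A i j F" "E' = mv i j F y" by (auto simp: r_def)
      have "F = mv j i E' y" using y by (auto simp: mv_def A_def)
      moreover have "y \<in> A j i E'" using y \<open>i \<noteq> j\<close> by (auto simp: A_def mv_def doubleton_eq_iff)
      ultimately show "F \<in> mv j i E' ` A j i E'" by auto
    qed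
    then have "card {F \<in> degree_class V f. r F E'} \<le> card (A j i E')"
      using finA by (meson card_image_le card_mono finite_imageI le_trans)
    also have "A j i E' \<subseteq> insert x (A j i E)"
      using x \<open>i \<noteq> j\<close> by (auto simp: A_def mv_def doubleton_eq_iff)
    then have "card (A j i E') \<le> card (insert x (A j i E))" using finA by (intro card_mono) auto
    also have "\<dots> \<le> Suc (card (A j i E))" using finA by (simp add: card_insert_if)
    also have "\<dots> \<le> card (A i j E)" by (rule cardA[OF E])
    finally show "card {F \<in> degree_class V f. r F E'} \<le> card {E' \<in> degree_class V ?g. r E E'}"
      using card_out[OF E] by simp
  qed (use V in \<open>auto intro: finite_degree_class\<close>)
qed

text \<open>Induction on the total excess over \<open>d\<close>; truncated subtraction makes
  vertices below \<open>d\<close> count 0. Unless \<open>f\<close> is constant, the fixed sum yields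
  a vertex above \<open>d\<close> and one below, and moving an edge end from the first to the second
  lowers the excess by one.\<close>

lemma card_degree_class_le_regular:
  assumes V: "finite V"
  shows "(\<Sum>v\<in>V. f v) = card V * d \<Longrightarrow> card (degree_class V f) \<le> card (degree_class V (\<lambda>_. d))"
proof (induction "\<Sum>v\<in>V. f v - d" arbitrary: f rule: less_induct)
  case less
  show ?case
  proof (cases "\<forall>v\<in>V. f v = d")
    case True
    then have "degree_class V f = degree_class V (\<lambda>_. d)" by (auto simp: degree_class_def)
    then show ?thesis by simp
  next
    case False
    have "\<exists>i\<in>V. f i > d"
    proof (rule ccontr)
      assume "\<not> ?thesis"
      then have le: "\<And>v. v \<in> V \<Longrightarrow> f v \<le> d" by force
      moreover obtain v where "v \<in> V" "f v < d" using False le by force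
      ultimately have "(\<Sum>v\<in>V. f v) < (\<Sum>v\<in>V. d)" using V by (intro sum_strict_mono_ex1) auto
      then show False using less.prems by simp
    qed
    then obtain i where i: "i \<in> V" "f i > d" by auto
    have "\<exists>j\<in>V. f j < d"
    proof (rule ccontr)
      assume "\<not> ?thesis"
      then have "(\<Sum>v\<in>V. d) < (\<Sum>v\<in>V. f v)" using V i by (intro sum_strict_mono_ex1) force+
      then show False using less.prems by simp
    qed
    then obtain j where j: "j \<in> V" "f j < d" by auto
    have ij: "i \<noteq> j" using i j by auto
    let ?g = "f(i := f i - 1, j := f j + 1)"
    have split: "(\<Sum>v\<in>V. h v) = h i + (h j + (\<Sum>v\<in>V - {i} - {j}. h v))" for h :: "'a \<Rightarrow> nat"
      using V i j ij by (subst sum.remove[of V i], simp, simp) (subst sum.remove[of "V - {i}" j], auto)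
    have rest: "(\<Sum>v\<in>V - {i} - {j}. ?g v) = (\<Sum>v\<in>V - {i} - {j}. f v)"
      "(\<Sum>v\<in>V - {i} - {j}. ?g v - d) = (\<Sum>v\<in>V - {i} - {j}. f v - d)"
      by (auto intro!: sum.cong)
    have "card (degree_class V f) \<le> card (degree_class V ?g)"
      using V i j by (intro card_degree_class_move) auto
    also have "\<dots> \<le> card (degree_class V (\<lambda>_. d))"
    proof (rule less.hyps)
      show "(\<Sum>v\<in>V. ?g v - d) < (\<Sum>v\<in>V. f v - d)"
        unfolding split[of "\<lambda>v. f v - d"] split[of "\<lambda>v. ?g v - d"] rest using i j ij by simp
      have "(\<Sum>v\<in>V. ?g v) = (\<Sum>v\<in>V. f v)"
        unfolding split[of f] split[of ?g] rest using i j ij by simp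
      then show "(\<Sum>v\<in>V. ?g v) = card V * d" using less.prems by simp
    qed
    finally show ?thesis .
  qed
qed

text \<open>Graphs with \<open>m\<close> edges are sorted by degree sequence. All degrees are below
  \<open>card V\<close>, which bounds the number of sequences, and the regular class is the largest.
  The lost factor costs only \<open>n ln n\<close> in the logarithm.\<close>

lemma binomial_le_card_degree_class:
  assumes V: "finite V" and m: "2 * m = card V * d"
  shows "card (pairs V) choose m \<le> card V ^ card V * card (degree_class V (\<lambda>_. d))"
proof -
  define F where "F = (V \<rightarrow>\<^sub>E {..<card V})"
  have fF: "finite F" using V by (simp add: F_def finite_PiE)
  have cF: "card F = card V ^ card V" using V by (simp add: F_def card_PiE)
  have sub: "{E. E \<subseteq> pairs V \<and> card E = m} \<subseteq> (\<Union>f\<in>F. {E \<in> degree_class V f. card E = m})"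
  proof
    fix E assume "E \<in> {E. E \<subseteq> pairs V \<and> card E = m}"
    then have E: "E \<subseteq> pairs V" "card E = m" by auto
    have "edeg E v < card V" if "v \<in> V" for v
    proof -
      have "edeg E v \<le> card (V - {v})" unfolding edeg_eq_card_neighbours[OF E(1)]
        using V by (intro card_mono) auto
      also have "\<dots> < card V" using V that by (intro psubset_card_mono) auto
      finally show ?thesis .
    qed
    then have "restrict (edeg E) V \<in> F" by (auto simp: F_def)
    moreover have "E \<in> degree_class V (restrict (edeg E) V)" using E by (auto simp: degree_class_def)
    ultimately show "E \<in> (\<Union>f\<in>F. {E \<in> degree_class V f. card E = m})" using E by blast
  qed
  have "card (pairs V) choose m = card {E. E \<subseteq> pairs V \<and> card E = m}"
    using V by (simp add: n_subsets finite_pairs)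
  also have "\<dots> \<le> card (\<Union>f\<in>F. {E \<in> degree_class V f. card E = m})"
    using sub fF V by (intro card_mono) (auto simp: finite_degree_class)
  also have "\<dots> \<le> (\<Sum>f\<in>F. card {E \<in> degree_class V f. card E = m})"
    using fF by (rule card_UN_le)
  also have "\<dots> \<le> (\<Sum>f\<in>F. card (degree_class V (\<lambda>_. d)))"
  proof (rule sum_mono)
    fix f
    show "card {E \<in> degree_class V f. card E = m} \<le> card (degree_class V (\<lambda>_. d))"
    \<comment> \<open>An empty class says nothing about the sum of \<open>f\<close>. A member forces
      the sum to be \<open>2 * m\<close>, as the comparison with the regular class requires.\<close>
    proof (cases "{E \<in> degree_class V f. card E = m} = {}")
      case False
      then obtain E where E: "E \<subseteq> pairs V" "card E = m" "\<And>v. v \<in> V \<Longrightarrow> edeg E v = f v"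
        by (auto simp: degree_class_def)
      have "(\<Sum>v\<in>V. f v) = (\<Sum>v\<in>V. edeg E v)" using E by simp
      also have "\<dots> = card V * d" using sum_edeg[OF V E(1)] E m by simp
      finally have "card (degree_class V f) \<le> card (degree_class V (\<lambda>_. d))"
        by (rule card_degree_class_le_regular[OF V])
      moreover have "card {E \<in> degree_class V f. card E = m} \<le> card (degree_class V f)"
        using V by (intro card_mono) (auto intro: finite_degree_class)
      ultimately show ?thesis by linarith
    next
      case True
      then show ?thesis unfolding True by simp
    qed
  qed
  also have "\<dots> = card V ^ card V * card (degree_class V (\<lambda>_. d))" by (simp add: cF)
  finally show ?thesis .
qed

text \<open>The term with index \<open>m\<close> is the largest of the \<open>N + 1\<close> terms of the binomial expansion of
  \<open>(m + (N - m))\<^sup>N\<close>.\<close>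

lemma binomial_lower_bound:
  fixes N m :: nat
  assumes "m \<le> N"
  shows "real N ^ N \<le> real (N + 1) * real (N choose m) * real m ^ m * real (N - m) ^ (N - m)"
proof -
  define b where "b k = (N choose k) * m ^ k * (N - m) ^ (N - k)" for k
  have absorb: "Suc k * (N choose Suc k) = (N - k) * (N choose k)" for k
    by (simp only: binomial_absorb_comp binomial_absorption)
  \<comment> \<open>The ratio of consecutive terms, cleared of denominators. It is at least 1 for
    \<open>k < m\<close> and at most 1 from \<open>k = m\<close> on.\<close>
  have step: "Suc k * (N - m) * b (Suc k) = (N - k) * m * b k" if "k < N" for k
  proof -
    have "Suc k * (N - m) * b (Suc k)
        = (Suc k * (N choose Suc k)) * m * m ^ k * ((N - m) * (N - m) ^ (N - Suc k))"
      by (simp only: b_def power_Suc ac_simps)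
    also have "(N - m) * (N - m) ^ (N - Suc k) = (N - m) ^ (N - k)"
      using that by (metis Suc_diff_Suc power_Suc)
    also have "Suc k * (N choose Suc k) = (N - k) * (N choose k)" by (rule absorb)
    finally show ?thesis by (simp only: b_def power_Suc ac_simps)
  qed
  have up: "b k \<le> b (Suc k)" if "k < m" for k
  \<comment> \<open>Here the factor \<open>N - m = 0\<close> cannot be cancelled, but all terms with
    \<open>k < m\<close> vanish.\<close>
  proof (cases "m = N")
    case True
    then show ?thesis using that by (simp add: b_def power_0_left)
  next
    case False
    have "Suc k * (N - m) \<le> (N - k) * m"
    proof -
      have "Suc k * (N - m) \<le> m * (N - m)" using that by (intro mult_right_mono) auto
      also have "\<dots> \<le> m * (N - k)" using that by (intro mult_left_mono) auto
      finally show ?thesis by (simp add: mult.commute)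
    qed
    then have "Suc k * (N - m) * b k \<le> (N - k) * m * b k" by (rule mult_right_mono) simp
    also have "\<dots> = Suc k * (N - m) * b (Suc k)" using step that assms by simp
    finally show ?thesis using False assms by simp
  qed
  have down: "b (Suc k) \<le> b k" if "m \<le> k" "k < N" for k
  proof -
    have "(N - k) * m \<le> Suc k * (N - m)"
    proof -
      have "(N - k) * m \<le> (N - m) * Suc k" using that by (intro mult_mono) auto
      then show ?thesis by (simp add: mult.commute)
    qed
    then have "(N - k) * m * b k \<le> Suc k * (N - m) * b k" by (rule mult_right_mono) simp
    then have "Suc k * (N - m) * b (Suc k) \<le> Suc k * (N - m) * b k" using step that by simp
    then show ?thesis using that by simp
  qed
  have "b k \<le> b m" if "k \<le> N" for k
  proof (cases "k \<le> m")
    case True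
    then show ?thesis by (induction rule: inc_induct) (use up in \<open>auto intro: order_trans\<close>)
  next
    case False
    then have "m \<le> k" by simp
    then show ?thesis using that
    proof (induction rule: dec_induct)
      case (step j)
      then show ?case using down[of j] by simp
    qed simp
  qed
  then have "(\<Sum>k\<le>N. b k) \<le> (\<Sum>k\<le>N. b m)" by (intro sum_mono) auto
  moreover have "(\<Sum>k\<le>N. b k) = N ^ N"
    using binomial[of m "N - m" N] assms by (simp add: b_def)
  ultimately have "N ^ N \<le> (N + 1) * b m" by simp
  then have "real (N ^ N) \<le> real ((N + 1) * b m)" by (rule of_nat_mono)
  then show ?thesis by (simp add: b_def algebra_simps)
qed

text \<open>The right-hand side is \<open>N * binary_entropy (m / N)\<close> minus the logarithm of
  the number of terms in the expansion.\<close>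

lemma ln_binomial_lower_bound:
  fixes N m :: nat
  assumes "0 < m" "m < N"
  shows "ln (real (N choose m)) \<ge> - ln (real (N + 1)) - real m * ln (real m / real N)
    - real (N - m) * ln (1 - real m / real N)"
proof -
  have pos: "real (N choose m) > 0" using assms by simp
  have "ln (real N ^ N) \<le> ln (real (N + 1) * real (N choose m) * real m ^ m * real (N - m) ^ (N - m))"
    using binomial_lower_bound[of m N] assms by (subst ln_le_cancel_iff) auto
  also have "\<dots> = ln (real (N + 1)) + ln (real (N choose m)) + real m * ln (real m)
      + real (N - m) * ln (real (N - m))"
    using assms pos by (simp add: ln_mult_pos ln_realpow)
  finally have 1: "real N * ln (real N) \<le> ln (real (N + 1)) + ln (real (N choose m)) + real m * ln (real m)
      + real (N - m) * ln (real (N - m))"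
    using assms by (simp add: ln_realpow)
  have "1 - real m / real N = real (N - m) / real N" using assms by (simp add: field_simps of_nat_diff)
  then have 2: "ln (1 - real m / real N) = ln (real (N - m)) - ln (real N)"
    using assms by (simp add: ln_div)
  have 3: "ln (real m / real N) = ln (real m) - ln (real N)" using assms by (simp add: ln_div)
  have "real N * ln (real N) = real m * ln (real N) + real (N - m) * ln (real N)"
    using assms by (simp add: of_nat_diff algebra_simps)
  then show ?thesis using 1 unfolding 2 3 by (simp add: algebra_simps)
qed

section \<open>The number of regular graphs\<close>

lemma regular_graphs_eq:
  "regular_graphs n d = (\<lambda>E. \<lparr>verts = {1..n}, edges = E\<rparr>) ` degree_class {1..n} (\<lambda>_. d)"
proof (intro equalityI subsetI)
  fix G assume "G \<in> regular_graphs n d"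
  then have "G = \<lparr>verts = {1..n}, edges = edges G\<rparr>" "edges G \<in> degree_class {1..n} (\<lambda>_. d)"
    by (auto simp: regular_graphs_def simple_graph_def degree_class_def pairs_def edeg_def deg_def)
  then show "G \<in> (\<lambda>E. \<lparr>verts = {1..n}, edges = E\<rparr>) ` degree_class {1..n} (\<lambda>_. d)" by blast
qed (fastforce simp: regular_graphs_def simple_graph_def degree_class_def pairs_def edeg_def deg_def)

lemma finite_regular_graphs: "finite (regular_graphs n d)"
  by (simp add: regular_graphs_eq finite_degree_class)

lemma card_regular_graphs: "card (regular_graphs n d) = card (degree_class {1..n} (\<lambda>_. d))"
  unfolding regular_graphs_eq by (rule card_image) (auto simp: inj_on_def)

text \<open>In units of \<open>n ln n\<close>, the degree sequences cost 1, the factor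
  \<open>N + 1\<close> costs 2, and passing from \<open>q\<close> to \<open>p\<close> and from pairs
  to \<open>n\<^sup>2 / 2\<close> cost at most 1 each. The constant 6 leaves some room.\<close>

lemma ln_card_regular_graphs_ge:
  assumes n: "n \<ge> 4" and d: "0 < d" "2 * d \<le> n" and ev: "even (d * n)" and p: "p = real d / real n"
  shows "regular_graphs n d \<noteq> {}"
    "ln (real (card (regular_graphs n d)))
      \<ge> real n ^ 2 / 2 * binary_entropy p - 6 * (real n * ln (real n))"
proof -
  define V where "V = {1..n}"
  define m where "m = n * d div 2"
  define N where "N = n choose 2"
  have V: "finite V" "card V = n" by (auto simp: V_def)
  have m: "2 * m = n * d" using ev by (simp add: m_def mult.commute)
  have N: "real N = real n * (real n - 1) / 2"
  proof -
    have "2 * N = n * (n - 1)" unfolding N_def choose_two by (intro dvd_mult_div_cancel) (cases "even n"; simp)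
    then have "2 * real N = real n * real (n - 1)" by (metis of_nat_mult of_nat_numeral)
    then show ?thesis using n by (simp add: of_nat_diff)
  qed
  have rm: "real m = real n * real d / 2" using m by (metis of_nat_mult of_nat_numeral nonzero_mult_div_cancel_left zero_neq_numeral)
  have p01: "0 < p" "p \<le> 1 / 2" using n d by (auto simp: p field_simps)
  \<comment> \<open>The edge density among the pairs is \<open>d / (n - 1)\<close>, slightly above
    \<open>p = d / n\<close>, because there are no loops.\<close>
  define q where "q = real m / real N"
  have q: "q = real d / (real n - 1)" using n by (simp add: q_def rm N)
  have "2 * real d \<le> real n" using d by (metis of_nat_le_iff of_nat_mult of_nat_numeral)
  then have q1: "q < 1" using n d by (simp add: q field_simps)
  have Npos: "real N > 0" using n by (simp add: N)
  have mN: "0 < m" "m < N"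
  proof -
    have "real m > 0" using n d by (simp add: rm)
    then show "0 < m" by simp
    have "real m < real N" using q1 Npos by (simp add: q_def field_simps)
    then show "m < N" by simp
  qed
  define R where "R = real (card (regular_graphs n d))"
  have "N choose m \<le> n ^ n * card (degree_class V (\<lambda>_. d))"
    using binomial_le_card_degree_class[of V m d] V m by (simp add: card_pairs N_def)
  then have "real (N choose m) \<le> real (n ^ n * card (degree_class V (\<lambda>_. d)))" by (rule of_nat_mono)
  then have le: "real (N choose m) \<le> real n ^ n * R"
    by (simp add: R_def card_regular_graphs V_def)
  have cpos: "real (N choose m) > 0" using mN by simp
  then have Rpos: "R > 0" using le n by (smt (verit) mult_nonneg_nonpos zero_le_power of_nat_0_le_iff)
  then show "regular_graphs n d \<noteq> {}" by (auto simp: R_def)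
  have "ln (real (N choose m)) \<le> ln (real n ^ n * R)"
    using le cpos by (subst ln_le_cancel_iff) (use Rpos n in auto)
  then have 1: "ln (real (N choose m)) \<le> real n * ln (real n) + ln R"
    using n Rpos by (simp add: ln_mult_pos ln_realpow)
  have 2: "ln (real (N choose m)) \<ge> - ln (real (N + 1)) - real m * ln q - (real N - real m) * ln (1 - q)"
    using ln_binomial_lower_bound[OF mN] mN by (simp add: q_def of_nat_diff)
  have ln1: "ln (real n) \<ge> 1"
  proof -
    have "exp 1 \<le> (4::real)" using exp_le by simp
    also have "\<dots> \<le> real n" using n by simp
    finally show ?thesis using n by (subst ln_ge_iff) auto
  qed
  have nln: "real n * ln (real n) \<ge> real n" using ln1 n by simp
  have b1: "ln (real (N + 1)) \<le> 2 * (real n * ln (real n))"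
  proof -
    have "real (N + 1) \<le> real n ^ 2"
    proof -
      have "1 + (x - y) / 2 \<le> x" if "0 \<le> x" "4 \<le> y" for x y :: real
        using that by (simp add: field_simps)
      from this[of "real n * real n" "real n"]
      have "1 + (real n * real n - real n) / 2 \<le> real n * real n" using n by simp
      then show ?thesis by (simp add: N power2_eq_square algebra_simps)
    qed
    then have "ln (real (N + 1)) \<le> ln (real n ^ 2)" using n by (subst ln_le_cancel_iff) auto
    also have "\<dots> = 2 * ln (real n)" using n by (simp add: ln_realpow)
    also have "\<dots> \<le> 2 * (real n * ln (real n))" using n ln1 by simp
    finally show ?thesis .
  qed
  \<comment> \<open>Since \<open>- ln (1 - 1 / n) \<le> 2 / n\<close>, replacing \<open>q\<close> by
    \<open>p\<close> costs at most \<open>m * 2 / n = d\<close>.\<close>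
  have b2: "real m * ln q \<le> real m * ln p + real n"
  proof -
    have "q = p / (1 - 1 / real n)" using n by (simp add: q p field_simps)
    moreover have "1 - 1 / real n > 0" using n by simp
    ultimately have lq: "ln q = ln p - ln (1 - 1 / real n)" using p01 n by (simp add: ln_div)
    have "- (1 / real n) - 2 * (1 / real n)\<^sup>2 \<le> ln (1 - 1 / real n)"
      using n by (intro ln_one_minus_pos_lower_bound) auto
    moreover have "2 * (1 / real n)\<^sup>2 \<le> 1 / real n"
      using n by (simp add: power2_eq_square field_simps)
    ultimately have "- ln (1 - 1 / real n) \<le> 2 / real n" by simp
    then have "real m * (- ln (1 - 1 / real n)) \<le> real m * (2 / real n)"
      by (intro mult_left_mono) auto
    also have "\<dots> = real d" using n by (simp add: rm)
    also have "\<dots> \<le> real n" using d by simp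
    finally show ?thesis by (simp add: lq algebra_simps)
  qed
  have b3: "(real N - real m) * ln (1 - q) \<le> (real N - real m) * ln (1 - p)"
  proof (intro mult_left_mono)
    have "p \<le> q" using n d by (simp add: p q field_simps)
    then show "ln (1 - q) \<le> ln (1 - p)" using q1 p01 by (subst ln_le_cancel_iff) auto
  qed (use mN in auto)
  have b4: "- ln (1 - p) \<le> 1"
  proof -
    have "ln (1 - p) \<ge> ln (1 / 2)" using p01 by (subst ln_le_cancel_iff) auto
    then show ?thesis using ln_2_less_1 by (simp add: ln_div)
  qed
  \<comment> \<open>\<open>n\<^sup>2 / 2\<close> exceeds the number of pairs by
    \<open>n / 2\<close>; this diagonal part shows up as additional non-edges.\<close>
  have "real n ^ 2 / 2 * binary_entropy p
      = - (real m * ln p) - (real N - real m) * ln (1 - p) - real n / 2 * ln (1 - p)"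
  proof -
    have eq1: "real n ^ 2 / 2 * p = real m" using n by (simp add: p rm power2_eq_square)
    have eq2: "real n ^ 2 / 2 * (1 - p) = real N - real m + real n / 2"
      using n by (simp add: p rm N power2_eq_square field_simps)
    have eq3: "real n ^ 2 / 2 * binary_entropy p
        = - ((real n ^ 2 / 2 * p) * ln p) - (real n ^ 2 / 2 * (1 - p)) * ln (1 - p)"
    proof -
      have "A * (- (p * a) - (1 - p) * b) = - ((A * p) * a) - (A * (1 - p)) * b" for A a b :: real
        by (simp add: algebra_simps)
      then show ?thesis unfolding binary_entropy_def by blast
    qed
    show ?thesis unfolding eq3 eq1 eq2 by (simp add: algebra_simps)
  qed
  moreover have "- real n / 2 * ln (1 - p) \<le> real n"
  proof -
    have "real n / 2 * (- ln (1 - p)) \<le> real n / 2 * 1" using b4 by (intro mult_left_mono) auto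
    then show ?thesis by simp
  qed
  ultimately show "ln (real (card (regular_graphs n d)))
      \<ge> real n ^ 2 / 2 * binary_entropy p - 6 * (real n * ln (real n))"
    using 1 2 b1 b2 b3 nln unfolding R_def[symmetric] by linarith
qed

section \<open>Greedy codes of matrices\<close>

definition bilin :: "nat \<Rightarrow> (nat \<Rightarrow> nat \<Rightarrow> real) \<Rightarrow> (nat \<Rightarrow> real) \<Rightarrow> (nat \<Rightarrow> real) \<Rightarrow> real" where
  "bilin n D x y = (\<Sum>i\<in>{1..n}. \<Sum>j\<in>{1..n}. D i j * x i * y j)"

definition sqnorm :: "nat \<Rightarrow> (nat \<Rightarrow> real) \<Rightarrow> real" where
  "sqnorm n x = (\<Sum>i\<in>{1..n}. (x i)\<^sup>2)"

definition frob :: "nat \<Rightarrow> (nat \<Rightarrow> nat \<Rightarrow> real) \<Rightarrow> real" where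
  "frob n D = (\<Sum>i\<in>{1..n}. \<Sum>j\<in>{1..n}. (D i j)\<^sup>2)"

definition op_bound :: "nat \<Rightarrow> real \<Rightarrow> (nat \<Rightarrow> nat \<Rightarrow> real) \<Rightarrow> bool" where
  "op_bound n \<tau> D \<longleftrightarrow> (\<forall>x y. \<bar>bilin n D x y\<bar> \<le> \<tau> * (sqrt (sqnorm n x) * sqrt (sqnorm n y)))"

lemma sqnorm_nonneg [simp]: "sqnorm n x \<ge> 0"
  by (simp add: sqnorm_def sum_nonneg)

lemma frob_nonneg [simp]: "frob n D \<ge> 0"
  by (simp add: frob_def sum_nonneg)

lemma bilin_le_frob: "\<bar>bilin n D x y\<bar> \<le> sqrt (frob n D) * (sqrt (sqnorm n x) * sqrt (sqnorm n y))"
proof -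
  let ?I = "{1..n} \<times> {1..n}"
  have "(bilin n D x y)\<^sup>2 = (\<Sum>z\<in>?I. D (fst z) (snd z) * (x (fst z) * y (snd z)))\<^sup>2"
    by (simp add: bilin_def sum.cartesian_product case_prod_beta mult.assoc)
  also have "\<dots> \<le> (\<Sum>z\<in>?I. (D (fst z) (snd z))\<^sup>2) * (\<Sum>z\<in>?I. (x (fst z) * y (snd z))\<^sup>2)"
    by (rule Cauchy_Schwarz_ineq_sum)
  also have "(\<Sum>z\<in>?I. (D (fst z) (snd z))\<^sup>2) = frob n D"
    by (simp add: frob_def sum.cartesian_product case_prod_beta)
  also have "(\<Sum>z\<in>?I. (x (fst z) * y (snd z))\<^sup>2) = sqnorm n x * sqnorm n y"
    by (simp add: sqnorm_def sum_product sum.cartesian_product case_prod_beta power_mult_distrib)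
  finally have "sqrt ((bilin n D x y)\<^sup>2) \<le> sqrt (frob n D * (sqnorm n x * sqnorm n y))"
    by (rule real_sqrt_le_mono)
  then show ?thesis by (simp add: real_sqrt_mult)
qed

lemma bilin_diff: "bilin n (\<lambda>i j. D i j - E i j) x y = bilin n D x y - bilin n E x y"
  by (simp add: bilin_def sum_subtractf left_diff_distrib)

lemma bilin_diff_left: "bilin n D (\<lambda>i. x i - x' i) y = bilin n D x y - bilin n D x' y"
  by (simp add: bilin_def sum_subtractf algebra_simps)

lemma bilin_diff_right: "bilin n D x (\<lambda>i. y i - y' i) = bilin n D x y - bilin n D x y'"
  by (simp add: bilin_def sum_subtractf algebra_simps)

lemma bilin_scale: "bilin n D (\<lambda>i. a * x i) (\<lambda>i. b * y i) = a * b * bilin n D x y"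
  by (simp add: bilin_def sum_distrib_left mult_ac)

lemma sqnorm_scale: "sqnorm n (\<lambda>i. a * x i) = a\<^sup>2 * sqnorm n x"
  by (simp add: sqnorm_def sum_distrib_left power_mult_distrib)

lemma bilin_average:
  "bilin n (\<lambda>i j. (\<Sum>A\<in>S. D A i j) / real (card S)) x y = (\<Sum>A\<in>S. bilin n (D A) x y) / real (card S)"
proof -
  have "(\<Sum>A\<in>S. bilin n (D A) x y) = (\<Sum>i\<in>{1..n}. \<Sum>j\<in>{1..n}. \<Sum>A\<in>S. D A i j * x i * y j)"
    unfolding bilin_def by (subst sum.swap) (intro sum.cong refl, subst sum.swap, rule refl)
  then show ?thesis by (simp add: bilin_def sum_distrib_right sum_divide_distrib)
qed

lemma frob_rank_one:
  "frob n (\<lambda>i j. D i j - c * x i * y j)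
    = frob n D - 2 * c * bilin n D x y + c\<^sup>2 * (sqnorm n x * sqnorm n y)"
proof -
  have "(D i j - c * x i * y j)\<^sup>2 = (D i j)\<^sup>2 - 2 * c * (D i j * x i * y j) + c\<^sup>2 * ((x i)\<^sup>2 * (y j)\<^sup>2)" for i j
    by (simp add: power2_eq_square algebra_simps)
  then show ?thesis
    unfolding frob_def bilin_def sqnorm_def sum_product
    by (simp add: sum.distrib sum_subtractf sum_distrib_left)
qed

definition grid_vec :: "nat \<Rightarrow> (nat \<Rightarrow> int) \<Rightarrow> nat \<Rightarrow> real" where
  "grid_vec n f i = real_of_int (f i) / real n"

text \<open>A code lists the rank one matrices that a greedy procedure with at most \<open>k\<close> steps subtracts
  from \<open>D\<close>, stopping early once the residue is small in operator norm. All conditions are convex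
  in \<open>D\<close>.\<close>

fun admits :: "nat \<Rightarrow> real \<Rightarrow> nat \<Rightarrow> (nat \<Rightarrow> nat \<Rightarrow> real) \<Rightarrow> ((nat \<Rightarrow> int) \<times> (nat \<Rightarrow> int) \<times> int) list \<Rightarrow> bool" where
  "admits n \<tau> 0 D l \<longleftrightarrow> l = []"
| "admits n \<tau> (Suc k) D [] \<longleftrightarrow> op_bound n \<tau> D"
| "admits n \<tau> (Suc k) D ((f, g, c) # l) \<longleftrightarrow>
     sqnorm n (grid_vec n f) \<le> 1 \<and> sqnorm n (grid_vec n g) \<le> 1 \<and>
     \<bar>bilin n D (grid_vec n f) (grid_vec n g) - real_of_int c\<bar> \<le> 1 \<and> \<tau> / 2 \<le> \<bar>real_of_int c\<bar> \<and>
     admits n \<tau> k (\<lambda>i j. D i j - real_of_int c * grid_vec n f i * grid_vec n g j) l"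

text \<open>Unit vectors have coordinates in \<open>[-1, 1]\<close>, so their grid numerators are at
  most \<open>n\<close> in absolute value. For \<open>frob n D \<le> n\<^sup>2\<close> the form is
  bounded by \<open>n\<close> on vectors of norm at most 1, so the coefficient has the same
  range.\<close>

definition code_letters :: "nat \<Rightarrow> ((nat \<Rightarrow> int) \<times> (nat \<Rightarrow> int) \<times> int) set" where
  "code_letters n = ({1..n} \<rightarrow>\<^sub>E {- int n..int n}) \<times> ({1..n} \<rightarrow>\<^sub>E {- int n..int n}) \<times> {- int n..int n}"

definition codes :: "nat \<Rightarrow> nat \<Rightarrow> ((nat \<Rightarrow> int) \<times> (nat \<Rightarrow> int) \<times> int) list set" where
  "codes n k = {l. set l \<subseteq> code_letters n \<and> length l \<le> k}"

lemma finite_code_letters: "finite (code_letters n)"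
  unfolding code_letters_def by (intro finite_cartesian_product finite_PiE) auto

lemma finite_codes: "finite (codes n k)"
  unfolding codes_def using finite_code_letters by (rule finite_lists_length_le)

lemma card_code_letters: "card (code_letters n) = (2 * n + 1) ^ (2 * n + 1)"
proof -
  have "card {- int n..int n} = 2 * n + 1" by simp
  then have "card ({1..n} \<rightarrow>\<^sub>E {- int n..int n}) = (2 * n + 1) ^ n"
    by (simp only: card_PiE finite_atLeastAtMost prod_constant card_atLeastAtMost diff_Suc_1)
  then have "card (code_letters n) = (2 * n + 1) ^ n * ((2 * n + 1) ^ n * (2 * n + 1))"
    unfolding code_letters_def card_cartesian_product \<open>card {- int n..int n} = 2 * n + 1\<close> by simp
  also have "\<dots> = (2 * n + 1) ^ (n + (n + 1))" by (simp only: power_add power_one_right)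
  also have "n + (n + 1) = 2 * n + 1" by simp
  finally show ?thesis .
qed

lemma card_codes_le: "card (codes n k) \<le> ((2 * n + 1) ^ (2 * n + 1) + 1) ^ k"
proof -
  have "(\<Sum>i\<le>k. b ^ i) \<le> (b + 1) ^ k" for b :: nat
  proof (induction k)
    case (Suc k)
    have "(\<Sum>i\<le>Suc k. b ^ i) = (\<Sum>i\<le>k. b ^ i) + b * b ^ k" by simp
    also have "\<dots> \<le> (b + 1) ^ k + b * (b + 1) ^ k"
      by (intro add_mono Suc.IH mult_left_mono power_mono) auto
    finally show ?case by simp
  qed simp
  then show ?thesis
    unfolding codes_def using finite_code_letters by (simp add: card_lists_length_le card_code_letters)
qed

text \<open>With an exact coefficient the drop would be at least \<open>c\<^sup>2\<close>. The error
  of at most 1 in \<open>c\<close> costs \<open>2 * \<bar>c\<bar>\<close>, and this is at most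
  \<open>c\<^sup>2 / 2\<close> because \<open>\<bar>c\<bar> \<ge> 4\<close>.\<close>

lemma frob_rank_one_drop:
  assumes "sqnorm n x \<le> 1" "sqnorm n y \<le> 1" "\<bar>bilin n D x y - c\<bar> \<le> 1" "\<bar>c\<bar> \<ge> 4"
  shows "frob n (\<lambda>i j. D i j - c * x i * y j) \<le> frob n D - c\<^sup>2 / 2"
proof -
  have "sqnorm n x * sqnorm n y \<le> 1" using assms by (intro mult_le_one) auto
  then have 1: "c\<^sup>2 * (sqnorm n x * sqnorm n y) \<le> c\<^sup>2" by (simp add: mult_left_le)
  have "\<bar>c * (c - bilin n D x y)\<bar> \<le> \<bar>c\<bar> * 1"
    unfolding abs_mult using assms by (intro mult_left_mono) auto
  then have "c\<^sup>2 - c * bilin n D x y \<le> \<bar>c\<bar>" by (simp add: power2_eq_square algebra_simps abs_le_iff)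
  moreover have "4 * \<bar>c\<bar> \<le> c\<^sup>2"
    using mult_right_mono[OF assms(4), of "\<bar>c\<bar>"] by (simp add: power2_eq_square abs_mult_self_eq)
  ultimately show ?thesis unfolding frob_rank_one using 1 by linarith
qed

text \<open>Every letter lowers \<open>frob\<close> by at least
  \<open>c\<^sup>2 / 2 \<ge> \<tau>\<^sup>2 / 8\<close>, and the final residue still has
  \<open>frob \<ge> 0\<close>. The bound \<open>\<tau> \<ge> 8\<close> ensures
  \<open>\<bar>c\<bar> \<ge> 4\<close>.\<close>

lemma admits_frob_ge:
  "admits n \<tau> k D l \<Longrightarrow> \<tau> \<ge> 8 \<Longrightarrow> length l = k \<Longrightarrow> frob n D \<ge> real k * (\<tau>\<^sup>2 / 8)"
proof (induction n \<tau> k D l rule: admits.induct)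
  case (3 n \<tau> k D f g c l)
  let ?D = "\<lambda>i j. D i j - real_of_int c * grid_vec n f i * grid_vec n g j"
  have c: "\<tau> / 2 \<le> \<bar>real_of_int c\<bar>" using 3 by simp
  have "frob n ?D \<le> frob n D - (real_of_int c)\<^sup>2 / 2"
    using 3 c by (intro frob_rank_one_drop) auto
  moreover have "real k * (\<tau>\<^sup>2 / 8) \<le> frob n ?D" using 3 by simp
  moreover have "(\<tau> / 2)\<^sup>2 \<le> \<bar>real_of_int c\<bar>\<^sup>2" using c 3 by (intro power_mono) auto
  ultimately show ?case by (simp add: power2_eq_square algebra_simps)
qed auto

text \<open>For a fixed code the residues are affine in the matrix, and the conditions on them bound
  absolute values of affine functions. The triangle inequality therefore carries them over to the
  average.\<close>

lemma admits_average:
  assumes "finite S" "S \<noteq> {}"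
  shows "(\<And>A. A \<in> S \<Longrightarrow> admits n \<tau> k (D A) l)
    \<Longrightarrow> admits n \<tau> k (\<lambda>i j. (\<Sum>A\<in>S. D A i j) / real (card S)) l"
proof (induction k arbitrary: D l)
  case 0
  then show ?case using assms by auto
next
  case (Suc k)
  have cS: "real (card S) > 0" using assms by (simp add: card_gt_0_iff)
  show ?case
  proof (cases l)
    case Nil
    have "op_bound n \<tau> (\<lambda>i j. (\<Sum>A\<in>S. D A i j) / real (card S))"
      unfolding op_bound_def
    proof (intro allI)
      fix x y
      let ?B = "\<tau> * (sqrt (sqnorm n x) * sqrt (sqnorm n y))"
      have "\<bar>\<Sum>A\<in>S. bilin n (D A) x y\<bar> \<le> (\<Sum>A\<in>S. \<bar>bilin n (D A) x y\<bar>)" by (rule sum_abs)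
      also have "\<dots> \<le> (\<Sum>A\<in>S. ?B)"
        using Suc.prems Nil by (intro sum_mono) (auto simp: op_bound_def)
      finally have "\<bar>\<Sum>A\<in>S. bilin n (D A) x y\<bar> \<le> real (card S) * ?B" by simp
      then show "\<bar>bilin n (\<lambda>i j. (\<Sum>A\<in>S. D A i j) / real (card S)) x y\<bar> \<le> ?B"
        unfolding bilin_average using cS by (simp add: abs_divide divide_le_eq mult.commute)
    qed
    then show ?thesis using Nil by simp
  next
    case (Cons a l')
    obtain f g c where a: "a = (f, g, c)" by (cases a)
    let ?x = "grid_vec n f" and ?y = "grid_vec n g"
    obtain A where A: "A \<in> S" using assms by auto
    have 1: "sqnorm n ?x \<le> 1" "sqnorm n ?y \<le> 1" "\<tau> / 2 \<le> \<bar>real_of_int c\<bar>"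
      using Suc.prems[OF A] Cons a by auto
    have "\<bar>\<Sum>A\<in>S. (bilin n (D A) ?x ?y - real_of_int c)\<bar> \<le> (\<Sum>A\<in>S. \<bar>bilin n (D A) ?x ?y - real_of_int c\<bar>)"
      by (rule sum_abs)
    also have "\<dots> \<le> (\<Sum>A\<in>S. 1)" using Suc.prems Cons a by (intro sum_mono) auto
    finally have "\<bar>(\<Sum>A\<in>S. bilin n (D A) ?x ?y) - real (card S) * real_of_int c\<bar> \<le> real (card S)"
      by (simp add: sum_subtractf)
    moreover have "(\<Sum>A\<in>S. bilin n (D A) ?x ?y) / real (card S) - real_of_int c
      = ((\<Sum>A\<in>S. bilin n (D A) ?x ?y) - real (card S) * real_of_int c) / real (card S)"
      using cS by (simp add: field_simps)
    ultimately have 2: "\<bar>bilin n (\<lambda>i j. (\<Sum>A\<in>S. D A i j) / real (card S)) ?x ?y - real_of_int c\<bar> \<le> 1"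
      unfolding bilin_average using cS by (simp add: abs_divide)
    have "admits n \<tau> k (\<lambda>i j. (\<Sum>A\<in>S. D A i j - real_of_int c * ?x i * ?y j) / real (card S)) l'"
      using Suc.prems Cons a by (intro Suc.IH) auto
    moreover have "(\<lambda>i j. (\<Sum>A\<in>S. D A i j - real_of_int c * ?x i * ?y j) / real (card S))
      = (\<lambda>i j. (\<Sum>A\<in>S. D A i j) / real (card S) - real_of_int c * ?x i * ?y j)"
      using cS by (simp add: sum_subtractf field_simps)
    ultimately show ?thesis using 1 2 Cons a by simp
  qed
qed

text \<open>Both matrices are reduced by the same rank one matrices, which cancel in the difference.
  A code of length below \<open>k\<close> ends with a residue bounded by \<open>\<tau>\<close> for
  either matrix.\<close>

lemma admits_close:
  "admits n \<tau> k D l \<Longrightarrow> admits n \<tau> k E l \<Longrightarrow> length l \<noteq> k \<Longrightarrow> op_bound n (2 * \<tau>) (\<lambda>i j. D i j - E i j)"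
proof (induction n \<tau> k D l arbitrary: E rule: admits.induct)
  case (2 n \<tau> k D)
  show ?case unfolding op_bound_def
  proof (intro allI)
    fix x y
    have "\<bar>bilin n D x y\<bar> \<le> \<tau> * (sqrt (sqnorm n x) * sqrt (sqnorm n y))"
      "\<bar>bilin n E x y\<bar> \<le> \<tau> * (sqrt (sqnorm n x) * sqrt (sqnorm n y))"
      using 2 by (simp_all add: op_bound_def)
    then show "\<bar>bilin n (\<lambda>i j. D i j - E i j) x y\<bar> \<le> 2 * \<tau> * (sqrt (sqnorm n x) * sqrt (sqnorm n y))"
      unfolding bilin_diff by (simp add: mult.assoc)
  qed
next
  case (3 n \<tau> k D f g c l)
  let ?R = "\<lambda>D i j. D i j - real_of_int c * grid_vec n f i * grid_vec n g j"
  have "op_bound n (2 * \<tau>) (\<lambda>i j. ?R D i j - ?R E i j)"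
    using 3 by (intro 3) auto
  then show ?case by simp
qed auto

section \<open>Rounding and the existence of codes\<close>

definition round_to_zero :: "nat \<Rightarrow> (nat \<Rightarrow> real) \<Rightarrow> nat \<Rightarrow> int" where
  "round_to_zero n x = restrict (\<lambda>i. if x i \<ge> 0 then \<lfloor>real n * x i\<rfloor> else \<lceil>real n * x i\<rceil>) {1..n}"

text \<open>Rounding towards zero instead of to the nearest grid point keeps the norm at most 1.
  Each of the \<open>n\<close> coordinates moves by at most \<open>1 / n\<close>, which gives the
  squared distance \<open>1 / n\<close>.\<close>

lemma round_to_zero:
  assumes n: "n \<ge> 1" and x: "sqnorm n x = 1"
  shows "round_to_zero n x \<in> {1..n} \<rightarrow>\<^sub>E {- int n..int n}"
    and "sqnorm n (grid_vec n (round_to_zero n x)) \<le> 1"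
    and "sqnorm n (\<lambda>i. x i - grid_vec n (round_to_zero n x) i) \<le> 1 / real n"
proof -
  let ?f = "round_to_zero n x"
  have bd: "\<bar>x i\<bar> \<le> 1" if "i \<in> {1..n}" for i
  proof -
    have "(x i)\<^sup>2 \<le> sqnorm n x" unfolding sqnorm_def using that by (intro member_le_sum) auto
    then show ?thesis using x by (simp add: abs_square_le_1)
  qed
  have f: "\<bar>real_of_int (?f i)\<bar> \<le> \<bar>real n * x i\<bar> \<and> \<bar>real n * x i - real_of_int (?f i)\<bar> \<le> 1"
    if "i \<in> {1..n}" for i
  proof (cases "x i \<ge> 0")
    case True
    then have "?f i = \<lfloor>real n * x i\<rfloor>" "real n * x i \<ge> 0" using that by (auto simp: round_to_zero_def)
    then show ?thesis by (simp add: abs_if) linarith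
  next
    case False
    then have "?f i = \<lceil>real n * x i\<rceil>" "real n * x i \<le> 0"
      using that by (auto simp: round_to_zero_def mult_nonneg_nonpos)
    moreover from this have "\<lceil>real n * x i\<rceil> \<le> 0" by (simp add: ceiling_le_zero)
    ultimately have "real_of_int (?f i) \<le> 0" "real n * x i \<le> real_of_int (?f i)"
      "real_of_int (?f i) \<le> real n * x i + 1"
      using of_int_ceiling_le_add_one[of "real n * x i"] by auto
    then show ?thesis by linarith
  qed
  have le: "\<bar>grid_vec n ?f i\<bar> \<le> \<bar>x i\<bar>" "\<bar>x i - grid_vec n ?f i\<bar> \<le> 1 / real n" if "i \<in> {1..n}" for i
  proof -
    show "\<bar>grid_vec n ?f i\<bar> \<le> \<bar>x i\<bar>"
      using f[OF that] n by (simp add: grid_vec_def abs_divide abs_mult divide_le_eq mult.commute)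
    have "x i - grid_vec n ?f i = (real n * x i - real_of_int (?f i)) / real n"
      using n by (simp add: grid_vec_def field_simps)
    then show "\<bar>x i - grid_vec n ?f i\<bar> \<le> 1 / real n"
      using f[OF that] n by (simp add: abs_divide divide_right_mono)
  qed
  show "?f \<in> {1..n} \<rightarrow>\<^sub>E {- int n..int n}"
  proof (rule PiE_I)
    fix i assume i: "i \<in> {1..n}"
    have "\<bar>real_of_int (?f i)\<bar> \<le> real n * \<bar>x i\<bar>" using f[OF i] by (simp add: abs_mult)
    also have "\<dots> \<le> real n * 1" using bd[OF i] by (intro mult_left_mono) auto
    finally show "?f i \<in> {- int n..int n}" by auto
  qed (auto simp: round_to_zero_def)
  have "sqnorm n (grid_vec n ?f) \<le> sqnorm n x"
    unfolding sqnorm_def using le by (intro sum_mono) (simp add: abs_le_square_iff)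
  then show "sqnorm n (grid_vec n ?f) \<le> 1" using x by simp
  have "sqnorm n (\<lambda>i. x i - grid_vec n ?f i) \<le> (\<Sum>i\<in>{1..n}. (1 / real n)\<^sup>2)"
    unfolding sqnorm_def using le(2) by (intro sum_mono) (metis abs_ge_zero power2_abs power_mono)
  also have "\<dots> = 1 / real n" using n by (simp add: power2_eq_square)
  finally show "sqnorm n (\<lambda>i. x i - grid_vec n ?f i) \<le> 1 / real n" .
qed

text \<open>A violating pair is normalised and rounded. The form has norm at most \<open>n\<close>
  and each vector moves by at most \<open>1 / sqrt n\<close>, so the value changes by at most
  \<open>2 * sqrt n\<close> in total. The lower bound on \<open>\<tau>\<close> keeps it at least
  \<open>\<tau> / 2 + 1\<close>, and rounding the value down loses at most 1.\<close>

lemma not_op_bound_grid: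
  assumes n: "n \<ge> 1" and \<tau>: "\<tau> \<ge> 4 * sqrt (real n) + 2" and fr: "frob n D \<le> (real n)\<^sup>2"
    and nop: "\<not> op_bound n \<tau> D"
  obtains f g c where "(f, g, c) \<in> code_letters n"
    "sqnorm n (grid_vec n f) \<le> 1" "sqnorm n (grid_vec n g) \<le> 1"
    "\<bar>bilin n D (grid_vec n f) (grid_vec n g) - real_of_int c\<bar> \<le> 1" "\<tau> / 2 \<le> \<bar>real_of_int c\<bar>"
proof -
  have sf: "sqrt (frob n D) \<le> real n" using fr n by (simp add: real_le_lsqrt)
  have B: "\<bar>bilin n D x y\<bar> \<le> real n * (sqrt (sqnorm n x) * sqrt (sqnorm n y))" for x y
    using bilin_le_frob[of n D x y] mult_right_mono[OF sf, of "sqrt (sqnorm n x) * sqrt (sqnorm n y)"]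
    by simp
  from nop obtain x y where xy: "\<bar>bilin n D x y\<bar> > \<tau> * (sqrt (sqnorm n x) * sqrt (sqnorm n y))"
    by (auto simp: op_bound_def not_le)
  have "sqrt (sqnorm n x) * sqrt (sqnorm n y) \<noteq> 0"
  proof
    assume "sqrt (sqnorm n x) * sqrt (sqnorm n y) = 0"
    then show False using xy B[of x y] by (metis mult_zero_right not_less)
  qed
  then have pos: "sqnorm n x > 0" "sqnorm n y > 0"
    using sqnorm_nonneg[of n x] sqnorm_nonneg[of n y] by (auto simp: less_le)
  define u where "u i = (1 / sqrt (sqnorm n x)) * x i" for i
  define v where "v i = (1 / sqrt (sqnorm n y)) * y i" for i
  have u1: "sqnorm n u = 1" and v1: "sqnorm n v = 1"
    unfolding u_def v_def sqnorm_scale using pos by (simp_all add: power_divide)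
  have "bilin n D u v = 1 / sqrt (sqnorm n x) * (1 / sqrt (sqnorm n y)) * bilin n D x y"
    unfolding u_def v_def by (rule bilin_scale)
  then have "\<bar>bilin n D u v\<bar> = \<bar>bilin n D x y\<bar> / (sqrt (sqnorm n x) * sqrt (sqnorm n y))"
    using pos by (simp add: abs_mult abs_divide)
  then have uv: "\<bar>bilin n D u v\<bar> > \<tau>" using xy pos by (simp add: less_divide_eq)
  define f where "f = round_to_zero n u"
  define g where "g = round_to_zero n v"
  note f = round_to_zero[OF n u1, folded f_def] and g = round_to_zero[OF n v1, folded g_def]
  have sn: "real n * sqrt (1 / real n) = sqrt (real n)"
    using n by (simp add: real_sqrt_divide real_div_sqrt)
  have "\<bar>bilin n D (\<lambda>i. u i - grid_vec n f i) v\<bar> \<le> real n * (sqrt (1 / real n) * 1)"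
    using f(3) by (intro order.trans[OF B] mult_left_mono mult_mono) (auto simp: v1)
  then have 1: "\<bar>bilin n D u v - bilin n D (grid_vec n f) v\<bar> \<le> sqrt (real n)"
    unfolding bilin_diff_left using sn by simp
  have "\<bar>bilin n D (grid_vec n f) (\<lambda>i. v i - grid_vec n g i)\<bar> \<le> real n * (1 * sqrt (1 / real n))"
    using f(2) g(3) by (intro order.trans[OF B] mult_left_mono mult_mono) auto
  then have 2: "\<bar>bilin n D (grid_vec n f) v - bilin n D (grid_vec n f) (grid_vec n g)\<bar> \<le> sqrt (real n)"
    unfolding bilin_diff_right using sn by simp
  let ?b = "bilin n D (grid_vec n f) (grid_vec n g)"
  have 3: "\<bar>?b\<bar> \<ge> \<tau> / 2 + 1" using 1 2 uv \<tau> by linarith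
  have 4: "\<bar>?b\<bar> \<le> real n"
  proof -
    have "\<bar>?b\<bar> \<le> real n * (1 * 1)"
      using f(2) g(2) by (intro order.trans[OF B] mult_left_mono mult_mono) auto
    then show ?thesis by simp
  qed
  show thesis
  proof (rule that[of f g "\<lfloor>?b\<rfloor>"])
    have "\<lfloor>?b\<rfloor> \<in> {- int n..int n}" using 4 by (auto simp: le_floor_iff floor_le_iff abs_le_iff)
    then show "(f, g, \<lfloor>?b\<rfloor>) \<in> code_letters n" using f(1) g(1) by (simp add: code_letters_def)
    show "\<bar>?b - real_of_int \<lfloor>?b\<rfloor>\<bar> \<le> 1" by linarith
    then show "\<tau> / 2 \<le> \<bar>real_of_int \<lfloor>?b\<rfloor>\<bar>" using 3 by linarith
  qed (use f g in auto)
qed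

text \<open>The procedure can be iterated because no step increases \<open>frob\<close>, so its
  bound is inherited by the residue.\<close>

lemma exists_code:
  assumes n: "n \<ge> 1" and \<tau>: "\<tau> \<ge> 4 * sqrt (real n) + 2" "\<tau> \<ge> 8"
  shows "frob n D \<le> (real n)\<^sup>2 \<Longrightarrow> \<exists>l\<in>codes n k. admits n \<tau> k D l"
proof (induction k arbitrary: D)
  case 0
  then show ?case by (simp add: codes_def)
next
  case (Suc k)
  show ?case
  proof (cases "op_bound n \<tau> D")
    case True
    then show ?thesis by (intro bexI[of _ "[]"]) (auto simp: codes_def)
  next
    case False
    then obtain f g c where fgc: "(f, g, c) \<in> code_letters n"
      "sqnorm n (grid_vec n f) \<le> 1" "sqnorm n (grid_vec n g) \<le> 1"
      "\<bar>bilin n D (grid_vec n f) (grid_vec n g) - real_of_int c\<bar> \<le> 1" "\<tau> / 2 \<le> \<bar>real_of_int c\<bar>"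
      using not_op_bound_grid[OF n \<tau>(1) Suc.prems] by metis
    have "frob n (\<lambda>i j. D i j - real_of_int c * grid_vec n f i * grid_vec n g j)
        \<le> frob n D - (real_of_int c)\<^sup>2 / 2"
      using fgc \<tau> by (intro frob_rank_one_drop) auto
    also have "\<dots> \<le> (real n)\<^sup>2" using Suc.prems by (smt (verit) zero_le_power2 divide_nonneg_pos)
    finally obtain l where "l \<in> codes n k"
      "admits n \<tau> k (\<lambda>i j. D i j - real_of_int c * grid_vec n f i * grid_vec n g j) l"
      using Suc.IH by blast
    then show ?thesis using fgc by (intro bexI[of _ "(f, g, c) # l"]) (auto simp: codes_def)
  qed
qed

section \<open>The counting lemma\<close>

lemma space_unit_interval [simp]: "space unit_interval = {0..1}"
  by (simp add: unit_interval_def space_restrict_space)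

lemma prob_space_unit_interval: "prob_space unit_interval"
  by (rule prob_spaceI) (simp add: unit_interval_def emeasure_restrict_space)

interpretation ui: prob_space unit_interval
  by (rule prob_space_unit_interval)

lemma measure_unit_interval [simp]: "measure unit_interval {0..1} = 1"
  using ui.prob_space by simp

interpretation ui_prod: product_sigma_finite "\<lambda>_. unit_interval"
  by standard

lemma prob_space_cube: "prob_space (PiM V (\<lambda>_. unit_interval))"
  by (intro prob_space_PiM prob_space_unit_interval)

lemma space_cube_iff: "x \<in> space (PiM V (\<lambda>_. unit_interval)) \<longleftrightarrow> x \<in> V \<rightarrow>\<^sub>E {0..1}"
  by (simp add: space_PiM)

lemma graphon_bounds:
  assumes "graphon W" "x \<in> {0..1}" "y \<in> {0..1}"
  shows "0 \<le> W x y" "W x y \<le> 1" "W x y = W y x"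
  using assms by (auto simp: graphon_def)

lemma graphon_measurable [measurable_dest]:
  "graphon W \<Longrightarrow> (\<lambda>(x, y). W x y) \<in> borel_measurable (unit_interval \<Otimes>\<^sub>M unit_interval)"
  by (simp add: graphon_def)

text \<open>The orientation picked by \<open>SOME\<close> depends on \<open>e\<close> alone, so one
  pair \<open>u\<close>, \<open>v\<close> serves all kernels and all points simultaneously.\<close>

lemma edge_weight_choice:
  assumes "e \<in> pairs V"
  obtains u v where "e = {u, v}" "u \<in> V" "v \<in> V" "u \<noteq> v" "\<And>W x. edge_weight W x e = W (x u) (x v)"
proof -
  obtain a b where ab: "e = {a, b}" using assms by (auto simp: pairs_def card_2_iff)
  obtain u v where uv: "(SOME (u, v). e = {u, v}) = (u, v)" by (cases "SOME (u, v). e = {u, v}")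
  have "case (SOME (u, v). e = {u, v}) of (u, v) \<Rightarrow> e = {u, v}"
    by (rule someI[of "\<lambda>(u, v). e = {u, v}" "(a, b)"]) (simp add: ab)
  then have e: "e = {u, v}" by (simp add: uv)
  then show ?thesis using assms that[of u v] uv
    by (auto simp: edge_weight_def doubleton_in_pairs)
qed

lemma edge_weight_cong:
  assumes "e \<in> pairs V" "\<And>i. i \<in> e \<Longrightarrow> x i = y i"
  shows "edge_weight W x e = edge_weight W y e"
  using assms(1) by (rule edge_weight_choice) (use assms(2) in auto)

lemma edge_weight_bounds:
  assumes "graphon W" "e \<in> pairs V" "x \<in> space (PiM V (\<lambda>_. unit_interval))"
  shows "0 \<le> edge_weight W x e" "edge_weight W x e \<le> 1"
proof -
  obtain u v where uv: "u \<in> V" "v \<in> V" "edge_weight W x e = W (x u) (x v)"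
    using assms(2) by (rule edge_weight_choice) blast
  have "x u \<in> {0..1}" "x v \<in> {0..1}" using assms(3) uv unfolding space_cube_iff by (auto elim: PiE_mem)
  then show "0 \<le> edge_weight W x e" "edge_weight W x e \<le> 1"
    using graphon_bounds[OF assms(1)] uv by auto
qed

lemma edge_weight_measurable:
  assumes "graphon W" "e \<in> pairs V"
  shows "(\<lambda>x. edge_weight W x e) \<in> borel_measurable (PiM V (\<lambda>_. unit_interval))"
proof -
  obtain u v where uv: "u \<in> V" "v \<in> V" "\<And>x. edge_weight W x e = W (x u) (x v)"
    using assms(2) by (rule edge_weight_choice) blast
  have "(\<lambda>x. (x u, x v)) \<in> measurable (PiM V (\<lambda>_. unit_interval)) (unit_interval \<Otimes>\<^sub>M unit_interval)"
    using uv by (intro measurable_Pair measurable_component_singleton) auto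
  from measurable_compose[OF this graphon_measurable[OF assms(1)]]
  show ?thesis by (simp add: uv(3))
qed

lemma prod_edge_weight_bounds:
  assumes "\<And>e. e \<in> E \<Longrightarrow> graphon (w e)" "E \<subseteq> pairs V" "x \<in> space (PiM V (\<lambda>_. unit_interval))"
  shows "0 \<le> (\<Prod>e\<in>E. edge_weight (w e) x e)" "(\<Prod>e\<in>E. edge_weight (w e) x e) \<le> 1"
  using assms edge_weight_bounds[of _ _ V x] by (auto intro!: prod_nonneg prod_le_1 simp: subset_iff)

lemma abs_prod_edge_weight_le_1:
  assumes "\<And>e. e \<in> E \<Longrightarrow> graphon (w e)" "E \<subseteq> pairs V" "x \<in> space (PiM V (\<lambda>_. unit_interval))"
  shows "\<bar>\<Prod>e\<in>E. edge_weight (w e) x e\<bar> \<le> 1"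
  using prod_edge_weight_bounds[OF assms] by simp

lemma prod_edge_weight_measurable:
  assumes "\<And>e. e \<in> E \<Longrightarrow> graphon (w e)" "E \<subseteq> pairs V"
  shows "(\<lambda>x. \<Prod>e\<in>E. edge_weight (w e) x e) \<in> borel_measurable (PiM V (\<lambda>_. unit_interval))"
  using assms by (intro borel_measurable_prod edge_weight_measurable) auto

text \<open>Each edge carries its own kernel, so that kernels can be exchanged one edge at a time.
  The vertex set stays \<open>V\<close> when edges are deleted; a coordinate without edges
  integrates to 1.\<close>

definition mixed_hom :: "'a set \<Rightarrow> 'a set set \<Rightarrow> ('a set \<Rightarrow> real \<Rightarrow> real \<Rightarrow> real) \<Rightarrow> real" where
  "mixed_hom V E w = (LINT x|(PiM V (\<lambda>_. unit_interval)). (\<Prod>e\<in>E. edge_weight (w e) x e))"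

lemma hom_density_eq_mixed_hom: "hom_density K W = mixed_hom (verts K) (edges K) (\<lambda>_. W)"
  by (simp add: hom_density_def mixed_hom_def)

lemma mixed_hom_cong: "(\<And>e. e \<in> E \<Longrightarrow> w e = w' e) \<Longrightarrow> mixed_hom V E w = mixed_hom V E w'"
  unfolding mixed_hom_def by (intro Bochner_Integration.integral_cong refl prod.cong) auto

lemma integrable_prod_edge_weight:
  assumes "\<And>e. e \<in> E \<Longrightarrow> graphon (w e)" "E \<subseteq> pairs V"
  shows "integrable (PiM V (\<lambda>_. unit_interval)) (\<lambda>x. \<Prod>e\<in>E. edge_weight (w e) x e)"
proof -
  interpret prob_space "PiM V (\<lambda>_. unit_interval)" by (rule prob_space_cube)
  show ?thesis
    using assms prod_edge_weight_bounds[OF assms]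
    by (intro integrable_const_bound[where B = 1] prod_edge_weight_measurable AE_I2) auto
qed

lemma cube_insert_integral:
  fixes F :: "('i \<Rightarrow> real) \<Rightarrow> real"
  assumes "finite I" "i \<notin> I"
    and F: "F \<in> borel_measurable (PiM (insert i I) (\<lambda>_. unit_interval))"
    and bd: "\<And>x. x \<in> space (PiM (insert i I) (\<lambda>_. unit_interval)) \<Longrightarrow> \<bar>F x\<bar> \<le> B"
  shows "(\<lambda>x. LINT y|unit_interval. F (x(i := y))) \<in> borel_measurable (PiM I (\<lambda>_. unit_interval))"
    and "\<And>x. x \<in> space (PiM I (\<lambda>_. unit_interval)) \<Longrightarrow> \<bar>LINT y|unit_interval. F (x(i := y))\<bar> \<le> B"
    and "(LINT x|(PiM (insert i I) (\<lambda>_. unit_interval)). F x)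
      = (LINT x|(PiM I (\<lambda>_. unit_interval)). LINT y|unit_interval. F (x(i := y)))"
proof -
  interpret P: prob_space "PiM (insert i I) (\<lambda>_. unit_interval)" by (rule prob_space_cube)
  have "(\<lambda>(x, y). F (x(i := y))) \<in> borel_measurable (PiM I (\<lambda>_. unit_interval) \<Otimes>\<^sub>M unit_interval)"
    using measurable_compose[OF measurable_add_dim F] by (simp add: case_prod_beta' split_beta')
  then show "(\<lambda>x. LINT y|unit_interval. F (x(i := y))) \<in> borel_measurable (PiM I (\<lambda>_. unit_interval))"
    by (rule ui.borel_measurable_lebesgue_integral)
  have "integrable (PiM (insert i I) (\<lambda>_. unit_interval)) F"
    using F bd by (intro P.integrable_const_bound[where B = B] AE_I2) auto
  then show "(LINT x|(PiM (insert i I) (\<lambda>_. unit_interval)). F x)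
      = (LINT x|(PiM I (\<lambda>_. unit_interval)). LINT y|unit_interval. F (x(i := y)))"
    using assms by (intro ui_prod.product_integral_insert) auto
  fix x assume x: "x \<in> space (PiM I (\<lambda>_. unit_interval))"
  have b: "\<bar>F (x(i := y))\<bar> \<le> B" if "y \<in> {0..1}" for y
    using x that by (intro bd) (auto simp: space_cube_iff intro!: PiE_fun_upd)
  have "\<bar>F (x(i := 0))\<bar> \<le> B" by (rule b) simp
  then have "B \<ge> 0" by linarith
  have "\<bar>LINT y|unit_interval. F (x(i := y))\<bar> \<le> (LINT y|unit_interval. \<bar>F (x(i := y))\<bar>)"
    by (rule integral_abs_bound)
  also have "\<dots> \<le> (LINT y|unit_interval. B)"
    using b \<open>B \<ge> 0\<close> by (intro integral_mono') auto
  finally show "\<bar>LINT y|unit_interval. F (x(i := y))\<bar> \<le> B" by (simp)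
qed

lemma cube_split_two:
  fixes F :: "('i \<Rightarrow> real) \<Rightarrow> real"
  assumes "finite V" "u \<in> V" "v \<in> V" "u \<noteq> v"
    and F: "F \<in> borel_measurable (PiM V (\<lambda>_. unit_interval))"
    and bd: "\<And>x. x \<in> space (PiM V (\<lambda>_. unit_interval)) \<Longrightarrow> \<bar>F x\<bar> \<le> B"
  defines "H \<equiv> (\<lambda>z. LINT b|unit_interval. LINT a|unit_interval. F (z(v := b, u := a)))"
  shows "integrable (PiM (V - {u, v}) (\<lambda>_. unit_interval)) H"
    and "(LINT x|(PiM V (\<lambda>_. unit_interval)). F x) = (LINT z|(PiM (V - {u, v}) (\<lambda>_. unit_interval)). H z)"
proof -
  interpret P: prob_space "PiM (V - {u, v}) (\<lambda>_. unit_interval)" by (rule prob_space_cube)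
  let ?G = "\<lambda>x. LINT a|unit_interval. F (x(u := a))"
  have V: "insert u (insert v (V - {u, v})) = V" using assms by auto
  have f1: "finite (insert v (V - {u, v}))" "u \<notin> insert v (V - {u, v})" using assms by auto
  have f2: "finite (V - {u, v})" "v \<notin> V - {u, v}" using assms by auto
  have F': "F \<in> borel_measurable (PiM (insert u (insert v (V - {u, v}))) (\<lambda>_. unit_interval))"
    unfolding V by (rule F)
  have bd': "\<bar>F x\<bar> \<le> B" if "x \<in> space (PiM (insert u (insert v (V - {u, v}))) (\<lambda>_. unit_interval))" for x
    using that unfolding V by (rule bd)
  note s1 = cube_insert_integral[where F = F and B = B, OF f1 F' bd']
  note s2 = cube_insert_integral[where F = ?G and B = B, OF f2 s1(1,2)]
  show "integrable (PiM (V - {u, v}) (\<lambda>_. unit_interval)) H"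
    unfolding H_def using s2(1,2) by (intro P.integrable_const_bound[where B = B] AE_I2) auto
  show "(LINT x|(PiM V (\<lambda>_. unit_interval)). F x) = (LINT z|(PiM (V - {u, v}) (\<lambda>_. unit_interval)). H z)"
    using s2(3) s1(3) unfolding V H_def by simp
qed

text \<open>For kernels \<open>D\<close> this is implied by the operator norm bound \<open>\<tau>\<close>: for \<open>f, g\<close> with values in
  \<open>[0,1]\<close>, \<open>\<parallel>f\<parallel>\<^sub>2 \<parallel>g\<parallel>\<^sub>2 \<le> sqrt (\<integral>f \<integral>g)\<close>, and then AM-GM with a free weight \<open>s\<close>.\<close>

definition form_bound :: "real \<Rightarrow> (real \<Rightarrow> real \<Rightarrow> real) \<Rightarrow> bool" where
  "form_bound \<tau> D \<longleftrightarrow> (\<forall>f g s. f \<in> borel_measurable unit_interval \<longrightarrow> g \<in> borel_measurable unit_interval \<longrightarrow>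
     (\<forall>x\<in>{0..1}. 0 \<le> f x \<and> f x \<le> 1) \<longrightarrow> (\<forall>x\<in>{0..1}. 0 \<le> g x \<and> g x \<le> 1) \<longrightarrow> s > 0 \<longrightarrow>
     \<bar>LINT b|unit_interval. LINT a|unit_interval. D a b * f a * g b\<bar>
       \<le> \<tau> / 2 * (s * (LINT x|unit_interval. f x) + (LINT x|unit_interval. g x) / s))"

text \<open>Given the other coordinates \<open>z\<close>, the product over the remaining edges factors as
  \<open>f(x\<^sub>u) g(x\<^sub>v) R(z)\<close>.\<close>

lemma mixed_hom_edge_bound:
  fixes V :: "'a set"
  assumes V: "finite V" and E: "E \<subseteq> pairs V" and uv: "{u, v} \<in> E"
    and w: "\<And>e. e \<in> E \<Longrightarrow> graphon (w e)" and W: "graphon W" "graphon U"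
    and D: "form_bound \<tau> (\<lambda>x y. W x y - U x y)" and s: "s > 0"
  shows "\<bar>LINT x|(PiM V (\<lambda>_. unit_interval)).
      (W (x u) (x v) - U (x u) (x v)) * (\<Prod>e\<in>E - {{u, v}}. edge_weight (w e) x e)\<bar>
    \<le> \<tau> / 2 * (s * mixed_hom V {e \<in> E. v \<notin> e} w + mixed_hom V {e \<in> E. u \<notin> e} w / s)"
proof -
  define V' where "V' = V - {u, v}"
  have "{u, v} \<in> pairs V" using uv E by blast
  then have uvV: "u \<in> V" "v \<in> V" "u \<noteq> v" unfolding doubleton_in_pairs by auto
  have fE: "finite E" using V E finite_pairs finite_subset by blast
  define Eu where "Eu = {e \<in> E. u \<in> e \<and> v \<notin> e}"
  define Ev where "Ev = {e \<in> E. v \<in> e \<and> u \<notin> e}"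
  define E0 where "E0 = {e \<in> E. u \<notin> e \<and> v \<notin> e}"
  have fin: "finite Eu" "finite Ev" "finite E0" using fE by (auto simp: Eu_def Ev_def E0_def)
  have split: "E - {{u, v}} = Eu \<union> Ev \<union> E0"
  proof -
    have "e = {u, v}" if "e \<in> E" "u \<in> e" "v \<in> e" for e
    proof -
      have "e \<in> pairs V" using that E by auto
      then show ?thesis using that uvV by (auto elim!: pairsE[of e V u])
    qed
    then show ?thesis using uvV by (auto simp: Eu_def Ev_def E0_def)
  qed
  define f where "f z a = (\<Prod>e\<in>Eu. edge_weight (w e) (z(u := a)) e)" for z a
  define g where "g z b = (\<Prod>e\<in>Ev. edge_weight (w e) (z(v := b)) e)" for z b
  define R where "R z = (\<Prod>e\<in>E0. edge_weight (w e) z e)" for z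
  \<comment> \<open>Edges in \<open>Eu\<close> avoid \<open>v\<close>, those in \<open>Ev\<close>
    avoid \<open>u\<close>, and those in \<open>E0\<close> avoid both, so each partial product
    ignores the coordinates outside its edges.\<close>
  have cu: "(\<Prod>e\<in>Eu. edge_weight (w e) (z(v := b, u := a)) e) = f z a" for z a b
    unfolding f_def using E by (intro prod.cong refl edge_weight_cong[of _ V]) (auto simp: Eu_def)
  have cv: "(\<Prod>e\<in>Ev. edge_weight (w e) (z(v := b, u := a)) e) = g z b" for z a b
    unfolding g_def using E by (intro prod.cong refl edge_weight_cong[of _ V]) (auto simp: Ev_def)
  have c0: "(\<Prod>e\<in>E0. edge_weight (w e) (z(v := b, u := a)) e) = R z" for z a b
    unfolding R_def using E by (intro prod.cong refl edge_weight_cong[of _ V]) (auto simp: E0_def)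
  have prod_uv: "(\<Prod>e\<in>E - {{u, v}}. edge_weight (w e) (z(v := b, u := a)) e) = f z a * g z b * R z" for z a b
  proof -
    have "(\<Prod>e\<in>E - {{u, v}}. edge_weight (w e) (z(v := b, u := a)) e)
        = (\<Prod>e\<in>Eu. edge_weight (w e) (z(v := b, u := a)) e)
          * (\<Prod>e\<in>Ev. edge_weight (w e) (z(v := b, u := a)) e)
          * (\<Prod>e\<in>E0. edge_weight (w e) (z(v := b, u := a)) e)"
      unfolding split using fin
      by (subst prod.union_disjoint, simp, simp, force simp: Eu_def Ev_def E0_def)
         (subst prod.union_disjoint, auto simp: Eu_def Ev_def E0_def)
    then show ?thesis by (simp only: cu cv c0)
  qed
  \<comment> \<open>Deleting all edges at \<open>v\<close> leaves the factors \<open>f\<close> and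
    \<open>R\<close>. Weighted by \<open>R z\<close> and integrated over \<open>z\<close>, the
    integrals of \<open>f\<close> and \<open>g\<close> in \<open>form_bound\<close> thus become
    densities of the two smaller graphs.\<close>
  have prod_u: "(\<Prod>e\<in>{e \<in> E. v \<notin> e}. edge_weight (w e) (z(v := b, u := a)) e) = f z a * R z" for z a b
  proof -
    have "{e \<in> E. v \<notin> e} = Eu \<union> E0" by (auto simp: Eu_def E0_def)
    then have "(\<Prod>e\<in>{e \<in> E. v \<notin> e}. edge_weight (w e) (z(v := b, u := a)) e)
        = (\<Prod>e\<in>Eu. edge_weight (w e) (z(v := b, u := a)) e)
          * (\<Prod>e\<in>E0. edge_weight (w e) (z(v := b, u := a)) e)"
      using fin by (simp only:) (subst prod.union_disjoint, auto simp: Eu_def E0_def)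
    then show ?thesis by (simp only: cu c0)
  qed
  have prod_v: "(\<Prod>e\<in>{e \<in> E. u \<notin> e}. edge_weight (w e) (z(v := b, u := a)) e) = g z b * R z" for z a b
  proof -
    have "{e \<in> E. u \<notin> e} = Ev \<union> E0" by (auto simp: Ev_def E0_def)
    then have "(\<Prod>e\<in>{e \<in> E. u \<notin> e}. edge_weight (w e) (z(v := b, u := a)) e)
        = (\<Prod>e\<in>Ev. edge_weight (w e) (z(v := b, u := a)) e)
          * (\<Prod>e\<in>E0. edge_weight (w e) (z(v := b, u := a)) e)"
      using fin by (simp only:) (subst prod.union_disjoint, auto simp: Ev_def E0_def)
    then show ?thesis by (simp only: cv c0)
  qed
  have sub: "E - {{u, v}} \<subseteq> pairs V" "{e \<in> E. v \<notin> e} \<subseteq> pairs V" "{e \<in> E. u \<notin> e} \<subseteq> pairs V"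
    "Eu \<subseteq> pairs (insert u V')" "Ev \<subseteq> pairs (insert v V')" "E0 \<subseteq> pairs V'"
    using E by (auto simp: Eu_def Ev_def E0_def V'_def pairs_def)
  define F where "F x = (W (x u) (x v) - U (x u) (x v)) * (\<Prod>e\<in>E - {{u, v}}. edge_weight (w e) x e)" for x
  define F1 where "F1 x = (\<Prod>e\<in>{e \<in> E. v \<notin> e}. edge_weight (w e) x e)" for x
  define F2 where "F2 x = (\<Prod>e\<in>{e \<in> E. u \<notin> e}. edge_weight (w e) x e)" for x
  have pr: "(\<lambda>x. (x u, x v)) \<in> measurable (PiM V (\<lambda>_. unit_interval)) (unit_interval \<Otimes>\<^sub>M unit_interval)"
    using uvV by (intro measurable_Pair measurable_component_singleton) auto
  have "(\<lambda>x. W (x u) (x v)) \<in> borel_measurable (PiM V (\<lambda>_. unit_interval))"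
    "(\<lambda>x. U (x u) (x v)) \<in> borel_measurable (PiM V (\<lambda>_. unit_interval))"
    using measurable_compose[OF pr graphon_measurable[OF W(1)]]
      measurable_compose[OF pr graphon_measurable[OF W(2)]] by simp_all
  then have mF: "F \<in> borel_measurable (PiM V (\<lambda>_. unit_interval))"
    unfolding F_def using w sub by (intro borel_measurable_times borel_measurable_diff prod_edge_weight_measurable) auto
  have mF1: "F1 \<in> borel_measurable (PiM V (\<lambda>_. unit_interval))"
    unfolding F1_def using w sub by (intro prod_edge_weight_measurable) auto
  have mF2: "F2 \<in> borel_measurable (PiM V (\<lambda>_. unit_interval))"
    unfolding F2_def using w sub by (intro prod_edge_weight_measurable) auto
  have bF: "\<bar>F x\<bar> \<le> 1" if "x \<in> space (PiM V (\<lambda>_. unit_interval))" for x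
  proof -
    have "x u \<in> {0..1}" "x v \<in> {0..1}" using that uvV unfolding space_cube_iff by (auto elim: PiE_mem)
    then have "0 \<le> W (x u) (x v)" "W (x u) (x v) \<le> 1" "0 \<le> U (x u) (x v)" "U (x u) (x v) \<le> 1"
      using W by (blast intro: graphon_bounds)+
    then have "\<bar>W (x u) (x v) - U (x u) (x v)\<bar> \<le> 1" by linarith
    moreover have "\<bar>\<Prod>e\<in>E - {{u, v}}. edge_weight (w e) x e\<bar> \<le> 1"
      using w sub that by (intro abs_prod_edge_weight_le_1) auto
    ultimately show ?thesis unfolding F_def abs_mult by (intro mult_le_one) auto
  qed
  have bF1: "\<bar>F1 x\<bar> \<le> 1" if "x \<in> space (PiM V (\<lambda>_. unit_interval))" for x
    unfolding F1_def using w sub that by (intro abs_prod_edge_weight_le_1) auto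
  have bF2: "\<bar>F2 x\<bar> \<le> 1" if "x \<in> space (PiM V (\<lambda>_. unit_interval))" for x
    unfolding F2_def using w sub that by (intro abs_prod_edge_weight_le_1) auto
  note sF = cube_split_two[OF V uvV mF bF] and sF1 = cube_split_two[OF V uvV mF1 bF1]
    and sF2 = cube_split_two[OF V uvV mF2 bF2]
  let ?H = "\<lambda>F z. LINT b|unit_interval. LINT a|unit_interval. F (z(v := b, u := a))"
  have H1: "?H F1 z = R z * (LINT a|unit_interval. f z a)" for z
    by (simp add: F1_def prod_u)
  have H2: "?H F2 z = R z * (LINT b|unit_interval. g z b)" for z
    by (simp add: F2_def prod_v)
  have H: "?H F z = R z * (LINT b|unit_interval. LINT a|unit_interval. (W a b - U a b) * f z a * g z b)" for z
  proof -
    have "F (z(v := b, u := a)) = R z * ((W a b - U a b) * f z a * g z b)" for a b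
      using uvV by (simp add: F_def prod_uv)
    then show ?thesis by simp
  qed
  have main: "\<bar>?H F z\<bar> \<le> \<tau> / 2 * (s * ?H F1 z + ?H F2 z / s)"
    if z: "z \<in> space (PiM V' (\<lambda>_. unit_interval))" for z
  proof -
    have upd: "z(i := a) \<in> space (PiM (insert i V') (\<lambda>_. unit_interval))" if "a \<in> {0..1}" for a i
      using z that by (auto simp: space_cube_iff intro!: PiE_fun_upd)
    have mu: "(\<lambda>a. z(i := a)) \<in> measurable unit_interval (PiM (insert i V') (\<lambda>_. unit_interval))" for i
      using measurable_compose[OF measurable_Pair1'[OF z] measurable_add_dim] by simp
    have "f z \<in> borel_measurable unit_interval"
      unfolding f_def using w sub
      by (intro measurable_compose[OF mu] prod_edge_weight_measurable) (auto simp: Eu_def)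
    moreover have "g z \<in> borel_measurable unit_interval"
      unfolding g_def using w sub
      by (intro measurable_compose[OF mu] prod_edge_weight_measurable) (auto simp: Ev_def)
    moreover have "\<forall>a\<in>{0..1}. 0 \<le> f z a \<and> f z a \<le> 1"
      unfolding f_def using w sub upd
      by (intro ballI conjI prod_edge_weight_bounds[of _ _ "insert u V'"]) (auto simp: Eu_def)
    moreover have "\<forall>a\<in>{0..1}. 0 \<le> g z a \<and> g z a \<le> 1"
      unfolding g_def using w sub upd
      by (intro ballI conjI prod_edge_weight_bounds[of _ _ "insert v V'"]) (auto simp: Ev_def)
    ultimately have "\<bar>LINT b|unit_interval. LINT a|unit_interval. (W a b - U a b) * f z a * g z b\<bar>
       \<le> \<tau> / 2 * (s * (LINT x|unit_interval. f z x) + (LINT x|unit_interval. g z x) / s)"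
      using D s unfolding form_bound_def by blast
    moreover have "R z \<ge> 0"
      unfolding R_def using w sub z by (intro prod_edge_weight_bounds[of _ _ V']) (auto simp: E0_def)
    ultimately have "R z * \<bar>LINT b|unit_interval. LINT a|unit_interval. (W a b - U a b) * f z a * g z b\<bar>
       \<le> R z * (\<tau> / 2 * (s * (LINT x|unit_interval. f z x) + (LINT x|unit_interval. g z x) / s))"
      by (rule mult_left_mono)
    then show ?thesis unfolding H H1 H2 abs_mult using \<open>R z \<ge> 0\<close> by (simp add: algebra_simps)
  qed
  have h1: "(LINT z|(PiM V' (\<lambda>_. unit_interval)). ?H F1 z) = mixed_hom V {e \<in> E. v \<notin> e} w"
    using sF1(2) unfolding V'_def mixed_hom_def F1_def by (rule sym)
  have h2: "(LINT z|(PiM V' (\<lambda>_. unit_interval)). ?H F2 z) = mixed_hom V {e \<in> E. u \<notin> e} w"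
    using sF2(2) unfolding V'_def mixed_hom_def F2_def by (rule sym)
  have "\<bar>LINT x|(PiM V (\<lambda>_. unit_interval)). F x\<bar> = \<bar>LINT z|(PiM V' (\<lambda>_. unit_interval)). ?H F z\<bar>"
    unfolding V'_def by (simp only: sF(2))
  also have "\<dots> \<le> (LINT z|(PiM V' (\<lambda>_. unit_interval)). \<bar>?H F z\<bar>)"
    by (rule integral_abs_bound)
  also have "\<dots> \<le> (LINT z|(PiM V' (\<lambda>_. unit_interval)). \<tau> / 2 * (s * ?H F1 z + ?H F2 z / s))"
  proof (rule integral_mono')
    show "integrable (PiM V' (\<lambda>_. unit_interval)) (\<lambda>z. \<tau> / 2 * (s * ?H F1 z + ?H F2 z / s))"
      using sF1(1) sF2(1) unfolding V'_def by (intro integrable_mult_right integrable_add integrable_divide_zero) auto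
    fix z assume z: "z \<in> space (PiM V' (\<lambda>_. unit_interval))"
    show "\<bar>?H F z\<bar> \<le> \<tau> / 2 * (s * ?H F1 z + ?H F2 z / s)" by (rule main[OF z])
    then show "0 \<le> \<tau> / 2 * (s * ?H F1 z + ?H F2 z / s)" by linarith
  qed
  also have "\<dots> = \<tau> / 2 * (s * (LINT z|(PiM V' (\<lambda>_. unit_interval)). ?H F1 z)
      + (LINT z|(PiM V' (\<lambda>_. unit_interval)). ?H F2 z) / s)"
    using sF1(1) sF2(1) unfolding V'_def by simp
  finally show ?thesis unfolding h1 h2 F_def .
qed

text \<open>With \<open>Suc m\<close> edges there are at most \<open>Suc m\<close> exchanges. Each
  costs \<open>L + counting_const L m\<close>, the bound for mixed densities of graphs with at most
  \<open>m\<close> edges: \<open>L\<close> for the pure density and the rest for its change.\<close>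

primrec counting_const :: "real \<Rightarrow> nat \<Rightarrow> real" where
  "counting_const L 0 = 0"
| "counting_const L (Suc m) = real (Suc m) * (L + counting_const L m)"

lemma counting_const_nonneg: "L \<ge> 0 \<Longrightarrow> counting_const L m \<ge> 0"
  by (induction m) auto

lemma counting_const_mono: "L \<ge> 0 \<Longrightarrow> m \<le> k \<Longrightarrow> counting_const L m \<le> counting_const L k"
proof (rule lift_Suc_mono_le)
  fix m assume L: "L \<ge> 0"
  have "1 * (L + counting_const L m) \<le> real (Suc m) * (L + counting_const L m)"
    using L counting_const_nonneg[of L m] by (intro mult_right_mono) auto
  then show "counting_const L m \<le> counting_const L (Suc m)" using L by simp
qed

lemma edeg_split:
  assumes "finite E"
  shows "card E = card {e \<in> E. v \<notin> e} + edeg E v"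
proof -
  have "E = {e \<in> E. v \<notin> e} \<union> {e \<in> E. v \<in> e}" by auto
  then have "card E = card ({e \<in> E. v \<notin> e} \<union> {e \<in> E. v \<in> e})" by simp
  also have "\<dots> = card {e \<in> E. v \<notin> e} + card {e \<in> E. v \<in> e}"
    using assms by (intro card_Un_disjoint) auto
  finally show ?thesis by (simp add: edeg_def)
qed

text \<open>Telescoping over the edges in \<open>C\<close>; deleting the edges at an endpoint of the edge
  being changed gives a graph to which the induction hypothesis applies.\<close>

lemma mixed_hom_close:
  fixes V :: "'a set" and \<Delta> :: real
  assumes V: "finite V" and E0: "E0 \<subseteq> pairs V" and W: "graphon W" "graphon U"
    and D: "form_bound (\<delta> * p powr \<Delta>) (\<lambda>x y. W x y - U x y)"
    and p: "0 < p" "p \<le> 1" and \<delta>: "0 \<le> \<delta>" "\<delta> \<le> 1" and L: "L \<ge> 0"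
    and deg: "\<And>u v. {u, v} \<in> E0 \<Longrightarrow> real (edeg E0 u) + real (edeg E0 v) \<le> 2 * \<Delta>"
    and base: "\<And>E. E \<subset> E0 \<Longrightarrow> mixed_hom V E (\<lambda>_. U) \<le> L * p ^ card E"
  shows "E \<subseteq> E0 \<Longrightarrow> C \<subseteq> E \<Longrightarrow> card E \<le> m \<Longrightarrow>
    \<bar>mixed_hom V E (\<lambda>e. if e \<in> C then W else U) - mixed_hom V E (\<lambda>_. U)\<bar>
      \<le> counting_const L m * \<delta> * p ^ card E"
proof (induction m arbitrary: E C)
  case 0
  have "finite E" using 0 E0 V finite_pairs finite_subset by metis
  then have "E = {}" using 0 by simp
  then show ?case by (simp add: mixed_hom_def)
next
  case (Suc m)
  let ?w = "\<lambda>C e. if e \<in> C then W else U"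
  let ?c = "L + counting_const L m"
  have fE0: "finite E0" using E0 V finite_pairs finite_subset by metis
  then have fE: "finite E" using Suc.prems finite_subset by blast
  have c: "?c \<ge> 0" using L counting_const_nonneg by (simp add: add_nonneg_nonneg)
  have gw: "graphon (?w C e)" for C e using W by simp
  \<comment> \<open>Since \<open>v\<close> lies on an edge of \<open>E\<close>, the remaining graph
    is a proper subgraph, as both the induction hypothesis and \<open>base\<close> require.\<close>
  have small: "mixed_hom V {e \<in> E. v \<notin> e} (?w C) \<le> ?c * p ^ card {e \<in> E. v \<notin> e}"
    if v: "e0 \<in> E" "v \<in> e0" for v e0 C
  proof -
    let ?E = "{e \<in> E. v \<notin> e}"
    have ss: "?E \<subset> E" using v by auto
    then have "card ?E < card E" using fE by (rule psubset_card_mono[rotated])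
    then have cm: "card ?E \<le> m" using Suc.prems by simp
    have "mixed_hom V ?E (?w C) = mixed_hom V ?E (?w (C \<inter> ?E))" by (rule mixed_hom_cong) auto
    moreover have "\<bar>mixed_hom V ?E (?w (C \<inter> ?E)) - mixed_hom V ?E (\<lambda>_. U)\<bar>
        \<le> counting_const L m * \<delta> * p ^ card ?E"
      using Suc.prems cm by (intro Suc.IH) auto
    moreover have "mixed_hom V ?E (\<lambda>_. U) \<le> L * p ^ card ?E"
      using ss Suc.prems by (intro base) auto
    moreover have "counting_const L m * \<delta> * p ^ card ?E \<le> counting_const L m * 1 * p ^ card ?E"
      using \<delta> p counting_const_nonneg[OF L] by (intro mult_right_mono mult_left_mono) auto
    ultimately show ?thesis by (simp add: algebra_simps)
  qed
  have step: "\<bar>mixed_hom V E (?w (insert e C)) - mixed_hom V E (?w C)\<bar> \<le> ?c * \<delta> * p ^ card E"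
    if e: "e \<in> E" "e \<notin> C" for e C
  proof -
    have "e \<in> pairs V" using e Suc.prems E0 by auto
    then obtain u v where uv: "e = {u, v}" "u \<in> V" "v \<in> V" "u \<noteq> v"
      "\<And>W x. edge_weight W x e = W (x u) (x v)"
      by (rule edge_weight_choice) blast
    have Esub: "E \<subseteq> pairs V" using Suc.prems E0 by auto
    let ?P = "\<lambda>C x. \<Prod>e\<in>E. edge_weight (?w C e) x e"
    let ?Q = "\<lambda>x. \<Prod>e'\<in>E - {{u, v}}. edge_weight (?w C e') x e'"
    have P1: "?P (insert e C) x = W (x u) (x v) * ?Q x" for x
    proof -
      have "?P (insert e C) x = edge_weight (?w (insert e C) e) x e
          * (\<Prod>e'\<in>E - {e}. edge_weight (?w (insert e C) e') x e')"
        using fE e by (intro prod.remove) auto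
      also have "(\<Prod>e'\<in>E - {e}. edge_weight (?w (insert e C) e') x e') = ?Q x"
        by (rule prod.cong) (auto simp: uv(1))
      finally show ?thesis by (simp add: uv(5))
    qed
    have P2: "?P C x = U (x u) (x v) * ?Q x" for x
    proof -
      have "?P C x = edge_weight (?w C e) x e * (\<Prod>e'\<in>E - {e}. edge_weight (?w C e') x e')"
        using fE e by (intro prod.remove) auto
      then show ?thesis using e by (simp add: uv(5)) (simp add: uv(1))
    qed
    have "mixed_hom V E (?w (insert e C)) - mixed_hom V E (?w C)
        = (LINT x|(PiM V (\<lambda>_. unit_interval)). ?P (insert e C) x - ?P C x)"
      unfolding mixed_hom_def using W Esub
      by (intro Bochner_Integration.integral_diff[symmetric] integrable_prod_edge_weight) auto
    also have "\<dots> = (LINT x|(PiM V (\<lambda>_. unit_interval)). (W (x u) (x v) - U (x u) (x v)) * ?Q x)"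
      unfolding P1 P2 by (simp add: left_diff_distrib)
    finally have eq: "mixed_hom V E (?w (insert e C)) - mixed_hom V E (?w C)
      = (LINT x|(PiM V (\<lambda>_. unit_interval)). (W (x u) (x v) - U (x u) (x v)) * ?Q x)" .
    define a where "a = real (edeg E u)"
    define b where "b = real (edeg E v)"
    define k where "k = real (card E)"
    \<comment> \<open>This weight balances the two terms: both become
      \<open>?c * p powr (k - (a + b) / 2)\<close>.\<close>
    define s where "s = p powr ((b - a) / 2)"
    have s: "s > 0" using p by (simp add: s_def)
    have ab: "a + b \<le> 2 * \<Delta>"
    proof -
      have mono: "edeg E x \<le> edeg E0 x" for x
        unfolding edeg_def using Suc.prems fE0 by (intro card_mono) auto
      have "real (edeg E0 u) + real (edeg E0 v) \<le> 2 * \<Delta>"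
        using e Suc.prems uv by (intro deg) auto
      then show ?thesis using mono[of u] mono[of v] by (simp add: a_def b_def)
    qed
    have cu: "p ^ card {e \<in> E. u \<notin> e} = p powr (k - a)"
      using edeg_split[OF fE, of u] p by (simp add: k_def a_def powr_realpow)
    have cv: "p ^ card {e \<in> E. v \<notin> e} = p powr (k - b)"
      using edeg_split[OF fE, of v] p by (simp add: k_def b_def powr_realpow)
    have "\<bar>mixed_hom V E (?w (insert e C)) - mixed_hom V E (?w C)\<bar>
      \<le> \<delta> * p powr \<Delta> / 2 * (s * mixed_hom V {e \<in> E. v \<notin> e} (?w C) + mixed_hom V {e \<in> E. u \<notin> e} (?w C) / s)"
      unfolding eq using V Esub e uv(1) W D s by (intro mixed_hom_edge_bound) auto
    also have "\<dots> \<le> \<delta> * p powr \<Delta> / 2 * (s * (?c * p powr (k - b)) + (?c * p powr (k - a)) / s)"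
    proof (intro mult_left_mono add_mono divide_right_mono)
      show "mixed_hom V {e \<in> E. v \<notin> e} (?w C) \<le> ?c * p powr (k - b)"
        unfolding cv[symmetric] using e uv by (intro small[of e]) auto
      show "mixed_hom V {e \<in> E. u \<notin> e} (?w C) \<le> ?c * p powr (k - a)"
        unfolding cu[symmetric] using e uv by (intro small[of e]) auto
    qed (use s \<delta> p in auto)
    also have "s * (?c * p powr (k - b)) = ?c * p powr (k - (a + b) / 2)"
      using p by (simp add: s_def powr_add[symmetric] field_simps)
    also have "(?c * p powr (k - a)) / s = ?c * p powr (k - (a + b) / 2)"
    proof -
      have "p powr (k - a) / s = p powr ((k - a) - (b - a) / 2)" unfolding s_def by (rule powr_diff[symmetric])
      also have "(k - a) - (b - a) / 2 = k - (a + b) / 2" by (simp add: field_simps)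
      finally show ?thesis by (simp add: times_divide_eq_right[symmetric] del: times_divide_eq_right)
    qed
    also have "\<delta> * p powr \<Delta> / 2 * (?c * p powr (k - (a + b) / 2) + ?c * p powr (k - (a + b) / 2))
      = ?c * \<delta> * (p powr \<Delta> * p powr (k - (a + b) / 2))"
      by (simp add: algebra_simps)
    also have "\<dots> = ?c * \<delta> * p powr (\<Delta> + (k - (a + b) / 2))" by (simp add: powr_add)
    \<comment> \<open>The exponent is at least \<open>k\<close> because
      \<open>a + b \<le> 2 * \<Delta>\<close>, and a larger exponent only helps since
      \<open>p \<le> 1\<close>.\<close>
    also have "\<dots> \<le> ?c * \<delta> * p powr k"
      using ab c \<delta> p by (intro mult_left_mono powr_mono') auto
    also have "p powr k = p ^ card E" using p by (simp add: k_def powr_realpow)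
    finally show ?thesis .
  qed
  have fC: "finite C" using Suc.prems fE finite_subset by blast
  from fC Suc.prems(2) have "\<bar>mixed_hom V E (?w C) - mixed_hom V E (\<lambda>_. U)\<bar> \<le> real (card C) * (?c * \<delta> * p ^ card E)"
  proof (induction C rule: finite_induct)
    case empty
    then show ?case by simp
  next
    case (insert e C)
    have "\<bar>mixed_hom V E (?w (insert e C)) - mixed_hom V E (?w C)\<bar> \<le> ?c * \<delta> * p ^ card E"
      using insert by (intro step) auto
    moreover have "\<bar>mixed_hom V E (?w C) - mixed_hom V E (\<lambda>_. U)\<bar> \<le> real (card C) * (?c * \<delta> * p ^ card E)"
      using insert by auto
    moreover have "real (card (insert e C)) * (?c * \<delta> * p ^ card E)
        = real (card C) * (?c * \<delta> * p ^ card E) + ?c * \<delta> * p ^ card E"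
      using insert by (simp add: algebra_simps)
    ultimately show ?case by linarith
  qed
  also have "\<dots> \<le> real (Suc m) * (?c * \<delta> * p ^ card E)"
  proof (intro mult_right_mono)
    have "card C \<le> card E" using Suc.prems fE by (intro card_mono) auto
    then show "real (card C) \<le> real (Suc m)" using Suc.prems by linarith
  qed (use c \<delta> p in auto)
  also have "\<dots> = counting_const L (Suc m) * \<delta> * p ^ card E" by simp
  finally show ?case .
qed

corollary mixed_hom_close_full:
  fixes V :: "'a set" and \<Delta> :: real
  assumes V: "finite V" and E: "E \<subseteq> pairs V" and W: "graphon W" "graphon U"
    and D: "form_bound (\<delta> * p powr \<Delta>) (\<lambda>x y. W x y - U x y)"
    and p: "0 < p" "p \<le> 1" and \<delta>: "0 \<le> \<delta>" "\<delta> \<le> 1" and L: "L \<ge> 0"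
    and deg: "\<And>u v. {u, v} \<in> E \<Longrightarrow> real (edeg E u) + real (edeg E v) \<le> 2 * \<Delta>"
    and base: "\<And>E'. E' \<subset> E \<Longrightarrow> mixed_hom V E' (\<lambda>_. U) \<le> L * p ^ card E'"
  shows "\<bar>mixed_hom V E (\<lambda>_. W) - mixed_hom V E (\<lambda>_. U)\<bar> \<le> counting_const L (card E) * \<delta> * p ^ card E"
proof -
  have "mixed_hom V E (\<lambda>_. W) = mixed_hom V E (\<lambda>e. if e \<in> E then W else U)"
    by (rule mixed_hom_cong) auto
  then show ?thesis using mixed_hom_close[OF assms, of E E "card E"] by simp
qed

section \<open>Kernels with small square integral\<close>

lemma graphon_const: "0 \<le> p \<Longrightarrow> p \<le> 1 \<Longrightarrow> graphon (\<lambda>_ _. p)"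
  by (simp add: graphon_def)

lemma mixed_hom_const: "mixed_hom V E (\<lambda>_ _ _. p) = p ^ card E"
proof -
  interpret prob_space "PiM V (\<lambda>_. unit_interval)" by (rule prob_space_cube)
  have "edge_weight (\<lambda>_ _. p) x e = p" for x :: "'a \<Rightarrow> real" and e
    by (simp add: edge_weight_def case_prod_beta)
  then show ?thesis unfolding mixed_hom_def using prob_space by simp
qed

interpretation ui_pair: pair_sigma_finite unit_interval unit_interval
  by standard

lemma prob_space_square: "prob_space (unit_interval \<Otimes>\<^sub>M unit_interval)"
  by (rule prob_space_pair) (rule prob_space_unit_interval)+

lemma space_square [simp]: "space (unit_interval \<Otimes>\<^sub>M unit_interval) = {0..1} \<times> {0..1}"
  by (simp add: space_pair_measure)

lemma weighted_amgm:
  fixes d t l :: real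
  assumes "l > 0" "0 \<le> t" "t \<le> 1"
  shows "\<bar>d * t\<bar> \<le> (l * d\<^sup>2 + t / l) / 2"
proof -
  have "t\<^sup>2 \<le> t" using assms by (simp add: power2_eq_square mult_left_le)
  then have 1: "t\<^sup>2 / l \<le> t / l" using assms by (intro divide_right_mono) auto
  have 2: "0 \<le> (l * \<bar>d\<bar> - t)\<^sup>2 / l" using assms by simp
  have "(l * e - t)\<^sup>2 / l = l * e\<^sup>2 - 2 * (e * t) + t\<^sup>2 / l" for e
    using assms by (simp add: power2_eq_square field_simps)
  from this[of "\<bar>d\<bar>"] have 3: "(l * \<bar>d\<bar> - t)\<^sup>2 / l = l * d\<^sup>2 - 2 * (\<bar>d\<bar> * t) + t\<^sup>2 / l" by simp
  have "\<bar>d * t\<bar> = \<bar>d\<bar> * t" using assms by (simp add: abs_mult)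
  then show ?thesis using 1 2 unfolding 3 by (simp add: field_simps)
qed

text \<open>Cauchy-Schwarz in the form of AM-GM with a free weight \<open>l\<close>, using that the
  square of \<open>f * g\<close> is at most \<open>f * g\<close>. The weight is optimised only after
  integration.\<close>

lemma form_bound_square_integral:
  assumes W: "graphon W" "graphon U" and \<tau>: "\<tau> > 0"
    and Q: "(LINT z|(unit_interval \<Otimes>\<^sub>M unit_interval). (W (fst z) (snd z) - U (fst z) (snd z))\<^sup>2) \<le> \<tau>\<^sup>2"
  shows "form_bound \<tau> (\<lambda>x y. W x y - U x y)"
  unfolding form_bound_def
proof (intro allI impI)
  fix f g :: "real \<Rightarrow> real" and s :: real
  assume m: "f \<in> borel_measurable unit_interval" "g \<in> borel_measurable unit_interval"
    and f01: "\<forall>x\<in>{0..1}. 0 \<le> f x \<and> f x \<le> 1" and g01: "\<forall>x\<in>{0..1}. 0 \<le> g x \<and> g x \<le> 1" and s: "s > 0"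
  interpret sq: prob_space "unit_interval \<Otimes>\<^sub>M unit_interval" by (rule prob_space_square)
  define D where "D z = W (fst z) (snd z) - U (fst z) (snd z)" for z
  have mD: "D \<in> borel_measurable (unit_interval \<Otimes>\<^sub>M unit_interval)"
    unfolding D_def using graphon_measurable[OF W(1)] graphon_measurable[OF W(2)]
    by (simp add: case_prod_beta')
  have mf: "(\<lambda>z. f (fst z)) \<in> borel_measurable (unit_interval \<Otimes>\<^sub>M unit_interval)"
    "(\<lambda>z. g (snd z)) \<in> borel_measurable (unit_interval \<Otimes>\<^sub>M unit_interval)"
    using m by (auto intro: measurable_compose[OF measurable_fst] measurable_compose[OF measurable_snd])
  have D1: "\<bar>D z\<bar> \<le> 1" if "z \<in> {0..1} \<times> {0..1}" for z
  proof -
    have "fst z \<in> {0..1}" "snd z \<in> {0..1}" using that by auto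
    then have "0 \<le> W (fst z) (snd z)" "W (fst z) (snd z) \<le> 1" "0 \<le> U (fst z) (snd z)" "U (fst z) (snd z) \<le> 1"
      using W by (blast intro: graphon_bounds)+
    then show ?thesis unfolding D_def by linarith
  qed
  have fg: "0 \<le> f (fst z) * g (snd z)" "f (fst z) * g (snd z) \<le> 1" if "z \<in> {0..1} \<times> {0..1}" for z
    using that f01 g01 by (auto intro!: mult_le_one)
  have iD: "integrable (unit_interval \<Otimes>\<^sub>M unit_interval) (\<lambda>z. (D z)\<^sup>2)"
    using mD D1 by (intro sq.integrable_const_bound[where B = 1] AE_I2) (auto simp: abs_square_le_1)
  have ifg: "integrable (unit_interval \<Otimes>\<^sub>M unit_interval) (\<lambda>z. f (fst z) * g (snd z))"
    using mf fg by (intro sq.integrable_const_bound[where B = 1] AE_I2 borel_measurable_times) auto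
  have iDfg: "integrable (unit_interval \<Otimes>\<^sub>M unit_interval) (\<lambda>z. D z * (f (fst z) * g (snd z)))"
  proof (intro sq.integrable_const_bound[where B = 1] AE_I2 borel_measurable_times mD mf)
    fix z assume "z \<in> space (unit_interval \<Otimes>\<^sub>M unit_interval)"
    then have z: "z \<in> {0..1} \<times> {0..1}" by simp
    show "norm (D z * (f (fst z) * g (snd z))) \<le> 1"
      unfolding real_norm_def abs_mult[of "D z"] using D1[OF z] fg[OF z] by (intro mult_le_one) auto
  qed
  define F where "F = (LINT x|unit_interval. f x)"
  define G where "G = (LINT x|unit_interval. g x)"
  have F0: "F \<ge> 0" unfolding F_def using f01 by (intro Bochner_Integration.integral_nonneg) auto
  have G0: "G \<ge> 0" unfolding G_def using g01 by (intro Bochner_Integration.integral_nonneg) auto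
  have FG: "(LINT z|(unit_interval \<Otimes>\<^sub>M unit_interval). f (fst z) * g (snd z)) = F * G"
    using ui_pair.integral_snd[of "\<lambda>x y. f x * g y"] ifg
    by (simp add: case_prod_beta' F_def G_def mult.commute)
  have eq: "(LINT b|unit_interval. LINT a|unit_interval. (W a b - U a b) * f a * g b)
      = (LINT z|(unit_interval \<Otimes>\<^sub>M unit_interval). D z * (f (fst z) * g (snd z)))"
    using ui_pair.integral_snd[of "\<lambda>a b. (W a b - U a b) * f a * g b"] iDfg
    by (simp add: case_prod_beta' D_def mult.assoc)
  define X where "X = (s * F + G / s) / 2"
  have X0: "X \<ge> 0" using F0 G0 s by (simp add: X_def)
  have FGX: "F * G \<le> X\<^sup>2"
  proof -
    have "X\<^sup>2 - F * G = ((s * F - G / s) / 2)\<^sup>2"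
      using s by (simp add: X_def power2_eq_square field_simps)
    then show ?thesis by (metis diff_ge_0_iff_ge zero_le_power2)
  qed
  have bound: "\<bar>LINT z|(unit_interval \<Otimes>\<^sub>M unit_interval). D z * (f (fst z) * g (snd z))\<bar> \<le> (l * \<tau>\<^sup>2 + X\<^sup>2 / l) / 2"
    if l: "l > 0" for l
  proof -
    have "\<bar>LINT z|(unit_interval \<Otimes>\<^sub>M unit_interval). D z * (f (fst z) * g (snd z))\<bar>
        \<le> (LINT z|(unit_interval \<Otimes>\<^sub>M unit_interval). \<bar>D z * (f (fst z) * g (snd z))\<bar>)"
      by (rule integral_abs_bound)
    also have "\<dots> \<le> (LINT z|(unit_interval \<Otimes>\<^sub>M unit_interval). (l * (D z)\<^sup>2 + (f (fst z) * g (snd z)) / l) / 2)"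
    proof (rule integral_mono')
      show "integrable (unit_interval \<Otimes>\<^sub>M unit_interval) (\<lambda>z. (l * (D z)\<^sup>2 + (f (fst z) * g (snd z)) / l) / 2)"
        using iD ifg by simp
      fix z assume "z \<in> space (unit_interval \<Otimes>\<^sub>M unit_interval)"
      then have z: "z \<in> {0..1} \<times> {0..1}" by simp
      let ?t = "f (fst z) * g (snd z)"
      show "\<bar>D z * ?t\<bar> \<le> (l * (D z)\<^sup>2 + ?t / l) / 2" by (rule weighted_amgm[OF l fg[OF z]])
      then show "0 \<le> (l * (D z)\<^sup>2 + ?t / l) / 2" by linarith
    qed
    also have "\<dots> = (l * (LINT z|(unit_interval \<Otimes>\<^sub>M unit_interval). (D z)\<^sup>2) + F * G / l) / 2"
      using iD ifg by (simp add: FG)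
    also have "\<dots> \<le> (l * \<tau>\<^sup>2 + X\<^sup>2 / l) / 2"
      using Q l FGX by (intro divide_right_mono add_mono mult_left_mono) (auto simp: D_def)
    finally show ?thesis .
  qed
  have "\<bar>LINT z|(unit_interval \<Otimes>\<^sub>M unit_interval). D z * (f (fst z) * g (snd z))\<bar> \<le> \<tau> * X"
  proof (cases "X = 0")
    case False
    then have "X > 0" using X0 by simp
    \<comment> \<open>The optimal weight, at which both summands equal
      \<open>\<tau> * X\<close>.\<close>
    then show ?thesis using bound[of "X / \<tau>"] \<tau> by (simp add: power2_eq_square mult.commute)
  next
    case True
    show ?thesis
    \<comment> \<open>For \<open>X = 0\<close> the optimum would be the forbidden weight 0, so
      \<open>l\<close> is taken arbitrarily small.\<close>
    proof (rule field_le_epsilon)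
      fix \<eta> :: real assume "\<eta> > 0"
      then show "\<bar>LINT z|(unit_interval \<Otimes>\<^sub>M unit_interval). D z * (f (fst z) * g (snd z))\<bar> \<le> \<tau> * X + \<eta>"
        using bound[of "2 * \<eta> / \<tau>\<^sup>2"] \<tau> True by (simp add: field_simps)
    qed
  qed
  then show "\<bar>LINT b|unit_interval. LINT a|unit_interval. (W a b - U a b) * f a * g b\<bar>
       \<le> \<tau> / 2 * (s * (LINT x|unit_interval. f x) + (LINT x|unit_interval. g x) / s)"
    unfolding eq X_def F_def G_def by simp
qed

section \<open>Step graphons\<close>

text \<open>Block \<open>i\<close> is \<open>[(i - 1) / n, i / n)\<close>, except that the last block also contains \<open>1\<close>.\<close>

definition block :: "nat \<Rightarrow> real \<Rightarrow> nat" where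
  "block n x = min (nat \<lfloor>real n * x\<rfloor> + 1) n"

definition block_ind :: "nat \<Rightarrow> nat \<Rightarrow> real \<Rightarrow> real" where
  "block_ind n i x = (if block n x = i then 1 else 0)"

definition step_graphon :: "nat \<Rightarrow> (nat \<Rightarrow> nat \<Rightarrow> real) \<Rightarrow> real \<Rightarrow> real \<Rightarrow> real" where
  "step_graphon n a x y = a (block n x) (block n y)"

lemma block_in: "n \<ge> 1 \<Longrightarrow> block n x \<in> {1..n}"
  by (auto simp: block_def)

lemma block_measurable [measurable]: "block n \<in> measurable unit_interval (count_space UNIV)"
proof -
  have "block n \<in> measurable borel (count_space UNIV)"
    unfolding block_def[abs_def] by measurable
  then have "block n \<in> measurable lborel (count_space UNIV)" by simp
  then show ?thesis unfolding unit_interval_def by (rule measurable_restrict_space1)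
qed

lemma block_ind_measurable [measurable]: "block_ind n i \<in> borel_measurable unit_interval"
  unfolding block_ind_def[abs_def] by measurable

lemma block_ind_bounds: "0 \<le> block_ind n i x" "block_ind n i x \<le> 1"
  by (auto simp: block_ind_def)

lemma sum_block_ind:
  assumes "n \<ge> 1"
  shows "(\<Sum>i\<in>{1..n}. h i * block_ind n i x) = h (block n x)"
proof -
  have "(\<Sum>i\<in>{1..n}. h i * block_ind n i x) = (\<Sum>i\<in>{1..n}. if block n x = i then h i else 0)"
    by (intro sum.cong) (auto simp: block_ind_def)
  then show ?thesis using block_in[OF assms, of x] by simp
qed

lemma integral_block_ind:
  assumes n: "n \<ge> 1" and i: "i \<in> {1..n}"
  shows "(LINT x|unit_interval. block_ind n i x) = 1 / real n"
proof -
  define l where "l = (real i - 1) / real n"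
  define u where "u = real i / real n"
  have lu: "0 \<le> l" "l \<le> u" "u \<le> 1" using n i by (auto simp: l_def u_def field_simps)
  have iff: "block n x = i \<longleftrightarrow> (if i = n then l \<le> x else l \<le> x \<and> x < u)" if x: "x \<in> {0..1}" for x
  proof -
    have nn: "real n * x \<ge> 0" using x by simp
    define k where "k = nat \<lfloor>real n * x\<rfloor>"
    have k: "real k \<le> real n * x" "real n * x < real k + 1"
      using nn by (auto simp: k_def)
    have 1: "l \<le> x \<longleftrightarrow> real i - 1 \<le> real n * x" using n by (simp add: l_def field_simps)
    have 2: "x < u \<longleftrightarrow> real n * x < real i" using n by (simp add: u_def field_simps)
    have 3: "real i - 1 \<le> real n * x \<longleftrightarrow> i \<le> k + 1" using k by linarith
    have 4: "real n * x < real i \<longleftrightarrow> k + 1 \<le> i" using k by linarith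
    show ?thesis unfolding 1 2 3 4 block_def k_def[symmetric] using i by auto
  qed
  define B where "B = {x \<in> {0..1}. block n x = i}"
  have Beq: "B = (if i = n then {l..1} else {l..<u})"
  proof -
    have "B = {x \<in> {0..1}. if i = n then l \<le> x else l \<le> x \<and> x < u}"
      unfolding B_def by (rule Collect_cong) (use iff in blast)
    then show ?thesis using lu by auto
  qed
  have "block n -` {i} \<inter> space unit_interval \<in> sets unit_interval" by (rule measurable_sets[OF block_measurable]) simp
  moreover have "block n -` {i} \<inter> space unit_interval = B" by (auto simp: B_def)
  ultimately have B: "B \<in> sets unit_interval" by simp
  have "(LINT x|unit_interval. block_ind n i x) = (LINT x|unit_interval. indicator B x)"
    by (intro Bochner_Integration.integral_cong) (auto simp: block_ind_def B_def)
  also have "\<dots> = measure unit_interval B"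
  proof -
    have "B \<inter> {0..1} = B" by (auto simp: B_def)
    then show ?thesis using B by simp
  qed
  also have "\<dots> = measure lborel B"
    unfolding unit_interval_def by (rule measure_restrict_space) (auto simp: B_def)
  also have "\<dots> = u - l" unfolding Beq using lu n by (auto simp: u_def)
  also have "\<dots> = 1 / real n" by (simp add: u_def l_def diff_divide_distrib)
  finally show ?thesis .
qed

lemma integrable_block_ind: "integrable unit_interval (block_ind n i)"
  using block_ind_bounds by (intro ui.integrable_const_bound[where B = 1] AE_I2) auto

lemma integral_block:
  assumes n: "n \<ge> 1"
  shows "(LINT x|unit_interval. h (block n x)) = (\<Sum>i\<in>{1..n}. h i) / real n"
proof -
  have "(LINT x|unit_interval. h (block n x)) = (LINT x|unit_interval. (\<Sum>i\<in>{1..n}. h i * block_ind n i x))"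
    by (simp only: sum_block_ind[OF n])
  also have "\<dots> = (\<Sum>i\<in>{1..n}. h i * (LINT x|unit_interval. block_ind n i x))"
    using integrable_block_ind by (subst Bochner_Integration.integral_sum) auto
  also have "\<dots> = (\<Sum>i\<in>{1..n}. h i * (1 / real n))"
    by (intro sum.cong refl) (simp only: integral_block_ind[OF n])
  finally show ?thesis by (simp add: sum_divide_distrib)
qed

lemma block_square_measurable:
  assumes n: "n \<ge> 1"
  shows "(\<lambda>z. h (block n (fst z)) (block n (snd z)) :: real) \<in> borel_measurable (unit_interval \<Otimes>\<^sub>M unit_interval)"
proof -
  have eq: "h (block n (fst z)) (block n (snd z))
      = (\<Sum>i\<in>{1..n}. (\<Sum>j\<in>{1..n}. h i j * block_ind n j (snd z)) * block_ind n i (fst z))" for z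
    by (simp only: sum_block_ind[OF n])
  show ?thesis unfolding eq by measurable
qed

lemma integral_block_square:
  fixes h :: "nat \<Rightarrow> nat \<Rightarrow> real"
  assumes n: "n \<ge> 1"
  shows "(LINT z|(unit_interval \<Otimes>\<^sub>M unit_interval). h (block n (fst z)) (block n (snd z)))
    = (\<Sum>i\<in>{1..n}. \<Sum>j\<in>{1..n}. h i j) / (real n)\<^sup>2"
proof -
  interpret sq: prob_space "unit_interval \<Otimes>\<^sub>M unit_interval" by (rule prob_space_square)
  define B where "B = (\<Sum>i\<in>{1..n}. \<Sum>j\<in>{1..n}. \<bar>h i j\<bar>)"
  have "\<bar>h i j\<bar> \<le> B" if "i \<in> {1..n}" "j \<in> {1..n}" for i j
  proof -
    have "\<bar>h i j\<bar> \<le> (\<Sum>j\<in>{1..n}. \<bar>h i j\<bar>)" using that by (intro member_le_sum) auto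
    also have "\<dots> \<le> B" unfolding B_def
      using that by (intro member_le_sum[where f = "\<lambda>i. \<Sum>j\<in>{1..n}. \<bar>h i j\<bar>"]) (auto intro: sum_nonneg)
    finally show ?thesis .
  qed
  then have "integrable (unit_interval \<Otimes>\<^sub>M unit_interval) (\<lambda>z. h (block n (fst z)) (block n (snd z)))"
    using block_in[OF n] block_square_measurable[OF n]
    by (intro sq.integrable_const_bound[where B = B] AE_I2) auto
  then have "(LINT z|(unit_interval \<Otimes>\<^sub>M unit_interval). h (block n (fst z)) (block n (snd z)))
      = (LINT x|unit_interval. LINT y|unit_interval. h (block n x) (block n y))"
    using ui_pair.integral_fst[of "\<lambda>x y. h (block n x) (block n y)"] by (simp add: case_prod_beta')
  also have "\<dots> = (LINT x|unit_interval. (\<Sum>j\<in>{1..n}. h (block n x) j) / real n)"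
    by (simp only: integral_block[OF n])
  also have "\<dots> = (\<Sum>i\<in>{1..n}. (\<Sum>j\<in>{1..n}. h i j) / real n) / real n"
    by (rule integral_block[OF n, of "\<lambda>i. (\<Sum>j\<in>{1..n}. h i j) / real n"])
  finally show ?thesis by (simp add: sum_divide_distrib[symmetric] power2_eq_square)
qed

lemma graphon_step:
  assumes n: "n \<ge> 1"
    and a: "\<And>i j. i \<in> {1..n} \<Longrightarrow> j \<in> {1..n} \<Longrightarrow> a i j = a j i \<and> 0 \<le> a i j \<and> a i j \<le> 1"
  shows "graphon (step_graphon n a)"
  unfolding graphon_def step_graphon_def
  using block_square_measurable[OF n, of a] a block_in[OF n] by (auto simp: case_prod_beta')

lemma regular_graphon_step:
  assumes n: "n \<ge> 1"
    and a: "\<And>i j. i \<in> {1..n} \<Longrightarrow> j \<in> {1..n} \<Longrightarrow> a i j = a j i \<and> 0 \<le> a i j \<and> a i j \<le> 1"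
    and row: "\<And>i. i \<in> {1..n} \<Longrightarrow> (\<Sum>j\<in>{1..n}. a i j) = p * real n"
  shows "regular_graphon p (step_graphon n a)"
  unfolding regular_graphon_def
proof (intro conjI ballI)
  show "graphon (step_graphon n a)" using n a by (rule graphon_step)
  fix x :: real
  show "(LINT y|unit_interval. step_graphon n a x y) = p"
    unfolding step_graphon_def integral_block[OF n] using row[OF block_in[OF n]] n by simp
qed

lemma graphon_entropy_step:
  assumes "n \<ge> 1"
  shows "graphon_entropy p (step_graphon n a) = (\<Sum>i\<in>{1..n}. \<Sum>j\<in>{1..n}. rel_entropy p (a i j)) / (real n)\<^sup>2"
  unfolding graphon_entropy_def step_graphon_def
  by (rule integral_block_square[OF assms, of "\<lambda>i j. rel_entropy p (a i j)"])

text \<open>Integrating \<open>f\<close> and \<open>g\<close> over the blocks turns the form into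
  \<open>bilin\<close> at the vectors \<open>c f\<close> and \<open>c g\<close>. Their squared norms
  are at most the integrals of \<open>f\<close> and \<open>g\<close> divided by \<open>n\<close>,
  hence the scale \<open>\<tau> / n\<close>.\<close>

lemma form_bound_step:
  assumes n: "n \<ge> 1" and op: "op_bound n \<tau> (\<lambda>i j. w i j - a i j)" and \<tau>: "\<tau> \<ge> 0"
  shows "form_bound (\<tau> / real n) (\<lambda>x y. step_graphon n w x y - step_graphon n a x y)"
  unfolding form_bound_def
proof (intro allI impI)
  fix f g :: "real \<Rightarrow> real" and s :: real
  assume m: "f \<in> borel_measurable unit_interval" "g \<in> borel_measurable unit_interval"
    and f01: "\<forall>x\<in>{0..1}. 0 \<le> f x \<and> f x \<le> 1" and g01: "\<forall>x\<in>{0..1}. 0 \<le> g x \<and> g x \<le> 1" and s: "s > 0"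
  define D where "D i j = w i j - a i j" for i j
  define c where "c f i = (LINT x|unit_interval. block_ind n i x * f x)" for f i
  have int: "integrable unit_interval h" "integrable unit_interval (\<lambda>x. block_ind n i x * h x)"
    if "h \<in> borel_measurable unit_interval" "\<forall>x\<in>{0..1}. 0 \<le> h x \<and> h x \<le> 1" for h i
    using that by (auto intro!: ui.integrable_const_bound[where B = 1] AE_I2 mult_le_one simp: block_ind_def)
  \<comment> \<open>As \<open>h \<le> 1\<close>, every coordinate is at most \<open>1 / n\<close>;
    the coordinates sum to the integral of \<open>h\<close>.\<close>
  have sq: "sqrt (sqnorm n (c h)) \<le> sqrt ((LINT x|unit_interval. h x) / real n)"
    if h: "h \<in> borel_measurable unit_interval" "\<forall>x\<in>{0..1}. 0 \<le> h x \<and> h x \<le> 1" for h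
  proof (rule real_sqrt_le_mono)
    have c0: "c h i \<ge> 0" for i
      unfolding c_def using h block_ind_bounds by (intro Bochner_Integration.integral_nonneg) auto
    have c1: "c h i \<le> 1 / real n" if "i \<in> {1..n}" for i
    proof -
      have "c h i \<le> (LINT x|unit_interval. block_ind n i x)"
        unfolding c_def using h int[OF h] integrable_block_ind block_ind_bounds
        by (intro integral_mono) (auto intro: mult_left_le)
      then show ?thesis by (simp only: integral_block_ind[OF n that])
    qed
    have "sqnorm n (c h) \<le> (\<Sum>i\<in>{1..n}. c h i * (1 / real n))"
      unfolding sqnorm_def power2_eq_square using c0 c1 by (intro sum_mono mult_left_mono) auto
    also have "\<dots> = (\<Sum>i\<in>{1..n}. c h i) / real n" by (simp add: sum_divide_distrib)
    also have "(\<Sum>i\<in>{1..n}. c h i) = (LINT x|unit_interval. (\<Sum>i\<in>{1..n}. block_ind n i x * h x))"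
      unfolding c_def using int[OF h] by (subst Bochner_Integration.integral_sum) auto
    also have "\<dots> = (LINT x|unit_interval. h x)"
    proof (intro Bochner_Integration.integral_cong refl)
      fix x :: real
      show "(\<Sum>i\<in>{1..n}. block_ind n i x * h x) = h x"
        using sum_block_ind[OF n, of "\<lambda>_. h x" x] by (simp add: mult.commute)
    qed
    finally show "sqnorm n (c h) \<le> (LINT x|unit_interval. h x) / real n" .
  qed
  have inner: "(LINT x|unit_interval. (step_graphon n w x y - step_graphon n a x y) * f x * g y)
      = (\<Sum>j\<in>{1..n}. (\<Sum>i\<in>{1..n}. D i j * c f i) * (block_ind n j y * g y))" for y
  proof -
    have "(step_graphon n w x y - step_graphon n a x y) * f x * g y
        = (\<Sum>i\<in>{1..n}. D i (block n y) * g y * (block_ind n i x * f x))" for x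
    proof -
      have "(\<Sum>i\<in>{1..n}. D i (block n y) * g y * (block_ind n i x * f x))
          = (\<Sum>i\<in>{1..n}. (D i (block n y) * g y * f x) * block_ind n i x)"
        by (simp add: mult_ac)
      also have "\<dots> = D (block n x) (block n y) * g y * f x" by (rule sum_block_ind[OF n])
      finally show ?thesis by (simp add: D_def step_graphon_def mult_ac)
    qed
    then have "(LINT x|unit_interval. (step_graphon n w x y - step_graphon n a x y) * f x * g y)
        = (LINT x|unit_interval. (\<Sum>i\<in>{1..n}. D i (block n y) * g y * (block_ind n i x * f x)))" by simp
    also have "\<dots> = (\<Sum>i\<in>{1..n}. D i (block n y) * g y * c f i)"
      using int[OF m(1) f01] unfolding c_def by (subst Bochner_Integration.integral_sum) auto
    also have "\<dots> = (\<Sum>i\<in>{1..n}. D i (block n y) * c f i) * g y"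
      by (simp add: sum_distrib_left sum_distrib_right mult_ac)
    also have "\<dots> = (\<Sum>j\<in>{1..n}. ((\<Sum>i\<in>{1..n}. D i j * c f i) * g y) * block_ind n j y)"
      by (rule sum_block_ind[OF n, symmetric])
    finally show ?thesis by (simp add: mult_ac)
  qed
  have "(LINT y|unit_interval. LINT x|unit_interval. (step_graphon n w x y - step_graphon n a x y) * f x * g y)
      = (\<Sum>j\<in>{1..n}. (\<Sum>i\<in>{1..n}. D i j * c f i) * c g j)"
    unfolding inner c_def[of g] using int[OF m(2) g01] by (subst Bochner_Integration.integral_sum) auto
  also have "\<dots> = bilin n D (c f) (c g)"
    unfolding bilin_def sum_distrib_right by (rule sum.swap)
  finally have eq: "(LINT y|unit_interval. LINT x|unit_interval. (step_graphon n w x y - step_graphon n a x y) * f x * g y)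
      = bilin n D (c f) (c g)" .
  define F where "F = (LINT x|unit_interval. f x)"
  define G where "G = (LINT x|unit_interval. g x)"
  have F0: "F \<ge> 0" unfolding F_def using f01 by (intro Bochner_Integration.integral_nonneg) auto
  have G0: "G \<ge> 0" unfolding G_def using g01 by (intro Bochner_Integration.integral_nonneg) auto
  have "\<bar>bilin n D (c f) (c g)\<bar> \<le> \<tau> * (sqrt (sqnorm n (c f)) * sqrt (sqnorm n (c g)))"
    using op unfolding op_bound_def D_def by blast
  also have "\<dots> \<le> \<tau> * (sqrt (F / real n) * sqrt (G / real n))"
    unfolding F_def G_def using \<tau> sq[OF m(1) f01] sq[OF m(2) g01] F0[unfolded F_def] n
    by (intro mult_left_mono mult_mono) auto
  also have "sqrt (F / real n) * sqrt (G / real n) = sqrt ((s * F) * (G / s)) / real n"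
    using s n by (simp add: real_sqrt_mult[symmetric] real_sqrt_divide)
  also have "\<tau> * (sqrt ((s * F) * (G / s)) / real n) \<le> \<tau> * (((s * F + G / s) / 2) / real n)"
    using \<tau> s F0 G0 by (intro mult_left_mono divide_right_mono arith_geo_mean_sqrt) auto
  finally show "\<bar>LINT y|unit_interval. LINT x|unit_interval. (step_graphon n w x y - step_graphon n a x y) * f x * g y\<bar>
       \<le> \<tau> / real n / 2 * (s * (LINT x|unit_interval. f x) + (LINT x|unit_interval. g x) / s)"
    unfolding eq F_def G_def by (simp add: mult_ac)
qed

definition adj :: "'b ugraph \<Rightarrow> 'b \<Rightarrow> 'b \<Rightarrow> real" where
  "adj G i j = of_bool ({i, j} \<in> edges G)"

text \<open>The product of edge weights is the sum of the indicators of boxes, one for each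
  homomorphism, and each box has volume \<open>1 / n ^ card (verts K)\<close>.\<close>

lemma mixed_hom_adj:
  fixes K :: "'a ugraph"
  assumes n: "n \<ge> 1" and K: "finite (verts K)" "edges K \<subseteq> pairs (verts K)" and G: "verts G = {1..n}"
  shows "mixed_hom (verts K) (edges K) (\<lambda>_. step_graphon n (adj G))
    = real (hom_count K G) / real n ^ card (verts K)"
proof -
  define V where "V = verts K"
  define H where "H = {\<phi> \<in> V \<rightarrow>\<^sub>E {1..n}. \<forall>e\<in>edges K. \<phi> ` e \<in> edges G}"
  have fV: "finite V" using K by (simp add: V_def)
  have fE: "finite (edges K)" using K finite_pairs finite_subset by blast
  have fH: "finite H" unfolding H_def using fV by (simp add: finite_PiE)
  have ind: "(\<Prod>v\<in>V. block_ind n (\<phi> v) (x v)) = (if \<phi> = restrict (\<lambda>v. block n (x v)) V then 1 else 0)"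
    if "\<phi> \<in> H" for \<phi> x
  proof (cases "\<forall>v\<in>V. block n (x v) = \<phi> v")
    case True
    then have "\<phi> = restrict (\<lambda>v. block n (x v)) V"
      using that by (auto simp: H_def PiE_def extensional_def fun_eq_iff)
    then show ?thesis using True by (simp add: block_ind_def)
  next
    case False
    then have "(\<Prod>v\<in>V. block_ind n (\<phi> v) (x v)) = 0"
      using fV by (subst prod_zero_iff) (auto simp: block_ind_def)
    moreover have "\<phi> \<noteq> restrict (\<lambda>v. block n (x v)) V" using False by auto
    ultimately show ?thesis by simp
  qed
  have eq: "(\<Prod>e\<in>edges K. edge_weight (step_graphon n (adj G)) x e)
      = (\<Sum>\<phi>\<in>H. \<Prod>v\<in>V. block_ind n (\<phi> v) (x v))" for x
  proof -
    let ?r = "restrict (\<lambda>v. block n (x v)) V"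
    have "edge_weight (step_graphon n (adj G)) x e = (if ?r ` e \<in> edges G then 1 else 0)" if "e \<in> edges K" for e
    proof -
      have "e \<in> pairs V" using that K by (auto simp: V_def)
      then obtain u v where uv: "e = {u, v}" "u \<in> V" "v \<in> V"
        "edge_weight (step_graphon n (adj G)) x e = step_graphon n (adj G) (x u) (x v)"
        by (rule edge_weight_choice) blast
      then have "?r ` e = {block n (x u), block n (x v)}" by auto
      then show ?thesis by (simp add: uv(4) step_graphon_def adj_def)
    qed
    then have "(\<Prod>e\<in>edges K. edge_weight (step_graphon n (adj G)) x e)
        = (\<Prod>e\<in>edges K. if ?r ` e \<in> edges G then 1 else 0)" by (rule prod.cong[OF refl])
    also have "\<dots> = (if \<forall>e\<in>edges K. ?r ` e \<in> edges G then 1 else 0)"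
      using fE by (auto intro: prod.neutral)
    also have "\<dots> = (if ?r \<in> H then 1 else 0)"
      using block_in[OF n] by (auto simp: H_def)
    also have "\<dots> = (\<Sum>\<phi>\<in>H. if \<phi> = ?r then 1 else 0)" using fH by simp
    also have "\<dots> = (\<Sum>\<phi>\<in>H. \<Prod>v\<in>V. block_ind n (\<phi> v) (x v))"
      by (intro sum.cong refl) (simp only: ind)
    finally show ?thesis .
  qed
  have "mixed_hom V (edges K) (\<lambda>_. step_graphon n (adj G))
      = (\<Sum>\<phi>\<in>H. LINT x|(PiM V (\<lambda>_. unit_interval)). (\<Prod>v\<in>V. block_ind n (\<phi> v) (x v)))"
    unfolding mixed_hom_def eq using fV integrable_block_ind
    by (intro Bochner_Integration.integral_sum ui_prod.product_integrable_prod) auto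
  also have "\<dots> = (\<Sum>\<phi>\<in>H. \<Prod>v\<in>V. LINT x|unit_interval. block_ind n (\<phi> v) x)"
    using fV integrable_block_ind by (intro sum.cong refl ui_prod.product_integral_prod) auto
  also have "\<dots> = (\<Sum>\<phi>\<in>H. \<Prod>v\<in>V. 1 / real n)"
    by (intro sum.cong prod.cong refl integral_block_ind[OF n]) (auto simp: H_def)
  also have "\<dots> = real (card H) / real n ^ card V" by (simp add: power_divide)
  also have "card H = hom_count K G" unfolding H_def hom_count_def V_def by (simp add: G)
  finally show ?thesis by (simp add: V_def)
qed

section \<open>The entropy of a class of graphs\<close>

lemma rel_entropy_bounds:
  assumes "0 < p" "p < 1" "0 \<le> x" "x \<le> 1"
  shows "0 \<le> rel_entropy p x" "rel_entropy p x \<le> - ln p - ln (1 - p)"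
proof -
  show "0 \<le> rel_entropy p x" using rel_entropy_ge_square[OF assms] by (rule order_trans[rotated]) simp
  have "y * ln y \<le> 0" if "0 \<le> y" "y \<le> 1" for y :: real
    using that by (cases "y = 0") (auto simp: mult_nonneg_nonpos)
  from this[of x] this[of "1 - x"] have "x * ln x \<le> 0" "(1 - x) * ln (1 - x) \<le> 0"
    using assms by auto
  moreover have "x * (- ln p) \<le> 1 * (- ln p)" "(1 - x) * (- ln (1 - p)) \<le> 1 * (- ln (1 - p))"
    using assms by (intro mult_right_mono; simp)+
  ultimately show "rel_entropy p x \<le> - ln p - ln (1 - p)"
    unfolding rel_entropy_eq[OF assms] binary_entropy_def by linarith
qed

lemma graphon_entropy_ge:
  assumes W: "graphon W" and p: "0 < p" "p < 1"
  shows "graphon_entropy p W \<ge> (LINT z|(unit_interval \<Otimes>\<^sub>M unit_interval). (W (fst z) (snd z) - p)\<^sup>2) / 4"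
proof -
  interpret sq: prob_space "unit_interval \<Otimes>\<^sub>M unit_interval" by (rule prob_space_square)
  have mW: "(\<lambda>z. W (fst z) (snd z)) \<in> borel_measurable (unit_interval \<Otimes>\<^sub>M unit_interval)"
    using graphon_measurable[OF W] by (simp add: case_prod_beta')
  have b: "0 \<le> W (fst z) (snd z)" "W (fst z) (snd z) \<le> 1" if "z \<in> space (unit_interval \<Otimes>\<^sub>M unit_interval)" for z
    using graphon_bounds[OF W, of "fst z" "snd z"] that by auto
  have "rel_entropy p \<in> borel_measurable borel" unfolding rel_entropy_def[abs_def] by measurable
  from measurable_compose[OF mW this]
  have mR: "(\<lambda>z. rel_entropy p (W (fst z) (snd z))) \<in> borel_measurable (unit_interval \<Otimes>\<^sub>M unit_interval)" .
  \<comment> \<open>Without integrability the integral would be 0 by default and the lower bound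
    could fail.\<close>
  have "integrable (unit_interval \<Otimes>\<^sub>M unit_interval) (\<lambda>z. rel_entropy p (W (fst z) (snd z)))"
  proof (rule sq.integrable_const_bound[where B = "- ln p - ln (1 - p)", OF AE_I2 mR])
    fix z assume "z \<in> space (unit_interval \<Otimes>\<^sub>M unit_interval)"
    from rel_entropy_bounds[OF p b[OF this]]
    show "norm (rel_entropy p (W (fst z) (snd z))) \<le> - ln p - ln (1 - p)" by simp
  qed
  moreover have "(W (fst z) (snd z) - p)\<^sup>2 / 4 \<le> rel_entropy p (W (fst z) (snd z))"
    if "z \<in> space (unit_interval \<Otimes>\<^sub>M unit_interval)" for z
    by (rule rel_entropy_ge_square[OF p b[OF that]])
  moreover have nn: "0 \<le> rel_entropy p (W (fst z) (snd z))"
    if "z \<in> space (unit_interval \<Otimes>\<^sub>M unit_interval)" for z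
    by (rule rel_entropy_bounds(1)[OF p b[OF that]])
  ultimately have "(LINT z|(unit_interval \<Otimes>\<^sub>M unit_interval). (W (fst z) (snd z) - p)\<^sup>2 / 4)
      \<le> graphon_entropy p W"
    unfolding graphon_entropy_def
    by (rule integral_mono')
  then show ?thesis by simp
qed

text \<open>By contradiction: smaller entropy puts \<open>W\<close> close to the constant
  \<open>p\<close> in mean square. The counting lemma with \<open>L = 1\<close>, the exact value for
  the constant graphon, then keeps the density below \<open>t * p ^ card (edges K)\<close>.\<close>

lemma graphon_entropy_lower_bound:
  fixes K :: "'a ugraph"
  assumes K: "finite (verts K)" "edges K \<subseteq> pairs (verts K)"
    and deg: "\<And>u v. {u, v} \<in> edges K \<Longrightarrow> real (edeg (edges K) u) + real (edeg (edges K) v) \<le> 2 * \<Delta>"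
    and p: "0 < p" "p < 1" and W: "graphon W" and hom: "hom_density K W \<ge> t * p ^ card (edges K)"
    and \<delta>: "0 < \<delta>" "\<delta> \<le> 1" "counting_const 1 (card (edges K)) * \<delta> < t - 1"
  shows "graphon_entropy p W \<ge> \<delta>\<^sup>2 * p powr (2 * \<Delta>) / 4"
proof (rule ccontr)
  assume "\<not> ?thesis"
  then have "(LINT z|(unit_interval \<Otimes>\<^sub>M unit_interval). (W (fst z) (snd z) - p)\<^sup>2) \<le> \<delta>\<^sup>2 * p powr (2 * \<Delta>)"
    using graphon_entropy_ge[OF W p] by simp
  also have "\<delta>\<^sup>2 * p powr (2 * \<Delta>) = (\<delta> * p powr \<Delta>)\<^sup>2"
    using p by (simp add: power_mult_distrib power2_eq_square powr_add[symmetric])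
  finally have "form_bound (\<delta> * p powr \<Delta>) (\<lambda>x y. W x y - (\<lambda>_ _. p) x y)"
    using W p \<delta> by (intro form_bound_square_integral graphon_const) auto
  then have "\<bar>mixed_hom (verts K) (edges K) (\<lambda>_. W) - mixed_hom (verts K) (edges K) (\<lambda>_ _ _. p)\<bar>
      \<le> counting_const 1 (card (edges K)) * \<delta> * p ^ card (edges K)"
    using K W p \<delta> deg by (intro mixed_hom_close_full[where U = "\<lambda>_ _. p" and \<Delta> = \<Delta>]) (auto simp: graphon_const mixed_hom_const)
  then have "hom_density K W \<le> (1 + counting_const 1 (card (edges K)) * \<delta>) * p ^ card (edges K)"
    unfolding mixed_hom_const hom_density_eq_mixed_hom by (simp add: algebra_simps abs_le_iff)
  also have "\<dots> < t * p ^ card (edges K)" using \<delta> p by (intro mult_strict_right_mono) auto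
  finally show False using hom by simp
qed

text \<open>\<open>W'\<close> is at least \<open>W / 2\<close>, used on \<open>F\<close>, and at
  least \<open>p / 2\<close>, used on the other edges.\<close>

lemma mixed_hom_midpoint_ge:
  assumes V: "finite V" "E \<subseteq> pairs V" and F: "F \<subseteq> E" and W: "graphon W"
    and W': "\<And>x y. W' x y = (W x y + p) / 2" "graphon W'" and p: "0 < p" "p < 1"
  shows "mixed_hom V E (\<lambda>_. W') \<ge> p ^ (card E - card F) / 2 ^ card E * mixed_hom V F (\<lambda>_. W)"
proof -
  have fE: "finite E" using V finite_pairs finite_subset by blast
  then have fF: "finite F" using F finite_subset by blast
  have ew: "edge_weight W' x e = (edge_weight W x e + p) / 2" for x :: "'a \<Rightarrow> real" and e
    by (simp add: edge_weight_def W'(1) case_prod_beta)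
  have cEF: "card (E - F) = card E - card F" "card E = card F + (card E - card F)"
    using fF F fE by (auto simp: card_Diff_subset card_mono)
  have "p ^ (card E - card F) / 2 ^ card E * mixed_hom V F (\<lambda>_. W)
      = (LINT x|(PiM V (\<lambda>_. unit_interval)). p ^ (card E - card F) / 2 ^ card E * (\<Prod>e\<in>F. edge_weight W x e))"
    by (simp add: mixed_hom_def)
  also have "\<dots> \<le> mixed_hom V E (\<lambda>_. W')" unfolding mixed_hom_def
  proof (rule integral_mono')
    show "integrable (PiM V (\<lambda>_. unit_interval)) (\<lambda>x. \<Prod>e\<in>E. edge_weight W' x e)"
      using V W' by (intro integrable_prod_edge_weight) auto
    fix x assume x: "x \<in> space (PiM V (\<lambda>_. unit_interval))"
    have b: "0 \<le> edge_weight W x e" if "e \<in> E" for e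
      using that V W x by (intro edge_weight_bounds[of W e V x]) auto
    have "p ^ (card E - card F) / 2 ^ card E * (\<Prod>e\<in>F. edge_weight W x e)
        = (\<Prod>e\<in>F. edge_weight W x e / 2) * (\<Prod>e\<in>E - F. p / 2)"
      by (subst cEF(2)) (simp add: prod_dividef cEF(1) power_divide power_add)
    also have "\<dots> \<le> (\<Prod>e\<in>F. edge_weight W' x e) * (\<Prod>e\<in>E - F. edge_weight W' x e)"
      unfolding ew using b F p by (intro mult_mono prod_mono prod_nonneg) (auto intro!: prod_nonneg simp: add_nonneg_nonneg subset_iff)
    also have "\<dots> = (\<Prod>e\<in>E. edge_weight W' x e)"
      using fE F by (subst prod.subset_diff[of F E]) (auto simp: mult.commute)
    finally show "p ^ (card E - card F) / 2 ^ card E * (\<Prod>e\<in>F. edge_weight W x e) \<le> (\<Prod>e\<in>E. edge_weight W' x e)" .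
    show "0 \<le> (\<Prod>e\<in>E. edge_weight W' x e)" using V W' x by (intro prod_edge_weight_bounds(1)[of _ _ V]) auto
  qed
  finally show ?thesis .
qed

section \<open>Averages of adjacency matrices\<close>

definition average_adj :: "nat ugraph set \<Rightarrow> nat \<Rightarrow> nat \<Rightarrow> real" where
  "average_adj S i j = (\<Sum>G\<in>S. adj G i j) / real (card S)"

lemma adj_sym: "adj G i j = adj G j i"
  by (simp add: adj_def insert_commute)

lemma adj_bounds: "0 \<le> adj G i j" "adj G i j \<le> 1"
  by (auto simp: adj_def)

lemma regular_graphsD:
  assumes "G \<in> regular_graphs n d"
  shows "verts G = {1..n}" "edges G \<subseteq> pairs {1..n}" "\<And>i. i \<in> {1..n} \<Longrightarrow> edeg (edges G) i = d"
  using assms by (auto simp: regular_graphs_def simple_graph_def pairs_def edeg_def deg_def)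

lemma adj_regular:
  assumes "G \<in> regular_graphs n d"
  shows "adj G i i = 0" "i \<in> {1..n} \<Longrightarrow> (\<Sum>j\<in>{1..n}. adj G i j) = real d"
proof -
  note G = regular_graphsD[OF assms]
  have loop: "{i, i} \<notin> edges G" for i
  proof
    assume "{i, i} \<in> edges G"
    then have "{i, i} \<in> pairs {1..n}" using G(2) by blast
    then show False unfolding doubleton_in_pairs by simp
  qed
  then show "adj G i i = 0" by (simp add: adj_def)
  assume i: "i \<in> {1..n}"
  have "(\<Sum>j\<in>{1..n}. adj G i j) = real (card {j \<in> {1..n}. {i, j} \<in> edges G})"
    by (simp add: adj_def of_bool_def sum.inter_filter[symmetric])
  also have "{j \<in> {1..n}. {i, j} \<in> edges G} = {j \<in> {1..n} - {i}. {i, j} \<in> edges G}"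
    using loop[of i] by auto
  also have "card \<dots> = d"
    using edeg_eq_card_neighbours[OF G(2), of i] G(3)[OF i] by simp
  finally show "(\<Sum>j\<in>{1..n}. adj G i j) = real d" .
qed

lemma average_adj:
  assumes S: "finite S" "S \<noteq> {}" "S \<subseteq> regular_graphs n d"
  shows "average_adj S i j = average_adj S j i" "0 \<le> average_adj S i j" "average_adj S i j \<le> 1"
    "average_adj S i i = 0" "i \<in> {1..n} \<Longrightarrow> (\<Sum>j\<in>{1..n}. average_adj S i j) = real d"
proof -
  have cS: "real (card S) > 0" using S by (simp add: card_gt_0_iff)
  show "average_adj S i j = average_adj S j i" unfolding average_adj_def by (simp add: adj_sym)
  show "0 \<le> average_adj S i j" unfolding average_adj_def using adj_bounds by (intro divide_nonneg_nonneg sum_nonneg) auto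
  have "(\<Sum>G\<in>S. adj G i j) \<le> (\<Sum>G\<in>S. 1)" by (intro sum_mono adj_bounds(2))
  then show "average_adj S i j \<le> 1" unfolding average_adj_def using cS by simp
  have "(\<Sum>G\<in>S. adj G i i) = 0" using adj_regular(1) S(3) by (intro sum.neutral) blast
  then show "average_adj S i i = 0" by (simp add: average_adj_def)
  assume i: "i \<in> {1..n}"
  have "(\<Sum>j\<in>{1..n}. average_adj S i j) = (\<Sum>G\<in>S. \<Sum>j\<in>{1..n}. adj G i j) / real (card S)"
    unfolding average_adj_def sum_divide_distrib[symmetric] by (subst sum.swap) (rule refl)
  also have "(\<Sum>G\<in>S. \<Sum>j\<in>{1..n}. adj G i j) = (\<Sum>G\<in>S. real d)"
    using adj_regular(2)[OF _ i] S(3) by (intro sum.cong) auto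
  finally show "(\<Sum>j\<in>{1..n}. average_adj S i j) = real d" using cS by simp
qed

lemma sum_ordered_pairs:
  fixes f :: "'v set \<Rightarrow> real"
  assumes "finite V"
  shows "(\<Sum>i\<in>V. \<Sum>j\<in>V - {i}. f {i, j}) = 2 * (\<Sum>e\<in>pairs V. f e)"
proof -
  have "(\<Sum>j\<in>V - {i}. f {i, j}) = (\<Sum>e\<in>{e \<in> pairs V. i \<in> e}. f e)" if i: "i \<in> V" for i
  proof -
    have "{e \<in> pairs V. i \<in> e} = (\<lambda>j. {i, j}) ` (V - {i})"
      using i by (auto simp: doubleton_in_pairs elim: pairsE[of _ V i])
    moreover have "inj_on (\<lambda>j. {i, j}) (V - {i})" by (auto simp: inj_on_def doubleton_eq_iff)
    ultimately show ?thesis by (simp add: sum.reindex)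
  qed
  then have "(\<Sum>i\<in>V. \<Sum>j\<in>V - {i}. f {i, j}) = (\<Sum>i\<in>V. \<Sum>e\<in>pairs V. if i \<in> e then f e else 0)"
    using assms by (simp add: sum.inter_filter finite_pairs)
  also have "\<dots> = (\<Sum>e\<in>pairs V. \<Sum>i\<in>V. if i \<in> e then f e else 0)" by (rule sum.swap)
  also have "\<dots> = (\<Sum>e\<in>pairs V. 2 * f e)"
  proof (rule sum.cong[OF refl])
    fix e assume "e \<in> pairs V"
    then have "{i \<in> V. i \<in> e} = e" "card e = 2" by (auto simp: pairs_def)
    then show "(\<Sum>i\<in>V. if i \<in> e then f e else 0) = 2 * f e"
      using assms by (simp add: sum.inter_filter[symmetric])
  qed
  finally show ?thesis by (simp add: sum_distrib_left)
qed

text \<open>The entry \<open>w i j\<close> is the marginal probability of the edge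
  \<open>{i, j}\<close>, so \<open>ln (card S)\<close> is at most the sum of
  \<open>binary_entropy (w i j)\<close> over pairs. Since the entries of \<open>w\<close> sum to
  \<open>n\<^sup>2 * p\<close>, this sum and the relative entropy are complementary. The diagonal
  may be included because \<open>binary_entropy 0 = 0\<close>.\<close>

lemma ln_card_le_entropy:
  assumes n: "n \<ge> 1" and p: "p = real d / real n" "0 < p" "p < 1"
    and S: "finite S" "S \<noteq> {}" "S \<subseteq> regular_graphs n d"
  shows "ln (real (card S))
    \<le> (real n)\<^sup>2 / 2 * binary_entropy p - (real n)\<^sup>2 / 2 * graphon_entropy p (step_graphon n (average_adj S))"
proof -
  let ?w = "average_adj S"
  note w = average_adj[OF S]
  have inj: "inj_on edges S"
  proof (rule inj_onI)
    fix G H assume "G \<in> S" "H \<in> S" "edges G = edges H"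
    moreover have "verts G = verts H" using calculation S(3) regular_graphsD(1) by (metis subsetD)
    ultimately show "G = H" by simp
  qed
  have cE: "card (edges ` S) = card S" using inj by (rule card_image)
  define q where "q e = real (card {A \<in> edges ` S. e \<in> A}) / real (card (edges ` S))" for e
  have q: "q {i, j} = ?w i j" for i j
  proof -
    have "{A \<in> edges ` S. {i, j} \<in> A} = edges ` {G \<in> S. {i, j} \<in> edges G}" by auto
    moreover have "inj_on edges {G \<in> S. {i, j} \<in> edges G}" using inj by (rule inj_on_subset) auto
    ultimately have "card {A \<in> edges ` S. {i, j} \<in> A} = card {G \<in> S. {i, j} \<in> edges G}"
      by (simp add: card_image)
    moreover have "(\<Sum>G\<in>S. adj G i j) = real (card {G \<in> S. {i, j} \<in> edges G})"
      using S(1) by (simp add: adj_def of_bool_def sum.inter_filter[symmetric])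
    ultimately show ?thesis by (simp add: q_def average_adj_def cE)
  qed
  have "edges ` S \<subseteq> Pow (pairs {1..n})" using S(3) by (blast dest: regular_graphsD(2))
  then have "ln (real (card (edges ` S))) \<le> (\<Sum>e\<in>pairs {1..n}. binary_entropy (q e))"
    unfolding q_def using S by (intro ln_card_le_sum_binary_entropy) (auto simp: finite_pairs)
  also have "\<dots> = (\<Sum>i\<in>{1..n}. \<Sum>j\<in>{1..n} - {i}. binary_entropy (q {i, j})) / 2"
    by (subst sum_ordered_pairs) auto
  also have "(\<Sum>i\<in>{1..n}. \<Sum>j\<in>{1..n} - {i}. binary_entropy (q {i, j})) = (\<Sum>i\<in>{1..n}. \<Sum>j\<in>{1..n}. binary_entropy (?w i j))"
  proof (rule sum.cong[OF refl])
    fix i assume i: "i \<in> {1..n}"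
    have "(\<Sum>j\<in>{1..n}. binary_entropy (?w i j)) = binary_entropy (?w i i) + (\<Sum>j\<in>{1..n} - {i}. binary_entropy (?w i j))"
      using i by (intro sum.remove) auto
    moreover have "binary_entropy (?w i i) = 0" by (simp add: w(4) binary_entropy_def)
    ultimately show "(\<Sum>j\<in>{1..n} - {i}. binary_entropy (q {i, j})) = (\<Sum>j\<in>{1..n}. binary_entropy (?w i j))"
      by (simp add: q)
  qed
  finally have 1: "ln (real (card S)) \<le> (\<Sum>i\<in>{1..n}. \<Sum>j\<in>{1..n}. binary_entropy (?w i j)) / 2"
    by (simp add: cE)
  have tot: "(\<Sum>i\<in>{1..n}. \<Sum>j\<in>{1..n}. ?w i j) = (real n)\<^sup>2 * p"
  proof -
    have "(\<Sum>i\<in>{1..n}. \<Sum>j\<in>{1..n}. ?w i j) = (\<Sum>i\<in>{1..n}. real d)"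
      by (intro sum.cong refl w(5))
    then show ?thesis using n by (simp add: p(1) power2_eq_square)
  qed
  have "(\<Sum>i\<in>{1..n}. \<Sum>j\<in>{1..n}. rel_entropy p (?w i j))
      = (\<Sum>i\<in>{1..n}. \<Sum>j\<in>{1..n}. - binary_entropy (?w i j) + ?w i j * (ln (1 - p) - ln p) - ln (1 - p))"
    using w(2,3) p by (intro sum.cong refl) (simp add: rel_entropy_eq algebra_simps)
  also have "\<dots> = - (\<Sum>i\<in>{1..n}. \<Sum>j\<in>{1..n}. binary_entropy (?w i j))
      + (\<Sum>i\<in>{1..n}. \<Sum>j\<in>{1..n}. ?w i j) * (ln (1 - p) - ln p) - (real n)\<^sup>2 * ln (1 - p)"
    by (simp add: sum.distrib sum_subtractf sum_negf sum_distrib_right[symmetric] power2_eq_square mult.assoc)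
  also have "\<dots> = (real n)\<^sup>2 * binary_entropy p - (\<Sum>i\<in>{1..n}. \<Sum>j\<in>{1..n}. binary_entropy (?w i j))"
    unfolding tot by (simp add: binary_entropy_def algebra_simps)
  finally have 2: "(real n)\<^sup>2 * graphon_entropy p (step_graphon n ?w)
      = (real n)\<^sup>2 * binary_entropy p - (\<Sum>i\<in>{1..n}. \<Sum>j\<in>{1..n}. binary_entropy (?w i j))"
    unfolding graphon_entropy_step[OF n] using n by simp
  show ?thesis using 1 2 by linarith
qed

lemma edeg_mono: "finite E \<Longrightarrow> F \<subseteq> E \<Longrightarrow> edeg F v \<le> edeg E v"
  unfolding edeg_def by (intro card_mono) auto

text \<open>All graphs in \<open>S\<close> share a code. Either the code is long, and the average is far from constant
  in \<open>L\<^sup>2\<close>, or the average is close to every member in operator norm. In the second case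
  counts are transferred for a minimal subgraph \<open>F\<close> with too many homomorphisms (or for \<open>K\<close> itself if
  there is none), and averaging with the constant \<open>p\<close> turns many copies of \<open>F\<close> into many copies of
  \<open>K\<close> at half the entropy.\<close>

lemma entropy_average_ge:
  fixes K :: "'a ugraph" and S :: "nat ugraph set"
  assumes n: "n \<ge> 1" and p: "p = real d / real n" "0 < p" "p < 1"
    and K: "finite (verts K)" "edges K \<subseteq> pairs (verts K)"
    and deg: "\<And>u v. {u, v} \<in> edges K \<Longrightarrow> real (edeg (edges K) u) + real (edeg (edges K) v) \<le> 2 * \<Delta>"
    and t: "t > 0" and L: "L = 2 ^ card (edges K) * t + 1" and c: "c = counting_const L (card (edges K))"
    and \<delta>: "0 \<le> \<delta>" "\<delta> \<le> 1" "c * \<delta> \<le> 1"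
    and \<tau>: "\<tau> = \<delta> * real n * p powr \<Delta> / 2" "\<tau> \<ge> 8"
    and S: "finite S" "S \<noteq> {}" "S \<subseteq> regular_graphs n d"
    and code: "\<And>G. G \<in> S \<Longrightarrow> admits n \<tau> k (\<lambda>i j. adj G i j - p) l"
    and hom: "\<And>G. G \<in> S \<Longrightarrow> real (hom_count K G) \<ge> (t + c * \<delta>) * p ^ card (edges K) * real n ^ card (verts K)"
    and \<Phi>: "\<Phi> \<le> real k * \<tau>\<^sup>2 / 64"
      "\<And>W. regular_graphon p W \<Longrightarrow> hom_density K W \<ge> t * p ^ card (edges K) \<Longrightarrow> \<Phi> \<le> (real n)\<^sup>2 / 2 * graphon_entropy p W"
  shows "\<Phi> \<le> (real n)\<^sup>2 / 2 * graphon_entropy p (step_graphon n (average_adj S))"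
proof -
  let ?w = "average_adj S" and ?V = "verts K" and ?E = "edges K"
  note w = average_adj[OF S]
  have cS: "real (card S) > 0" using S by (simp add: card_gt_0_iff)
  have fE: "finite ?E" using K finite_pairs finite_subset by blast
  have dp: "real d = p * real n" using n p by simp
  have gw: "regular_graphon p (step_graphon n ?w)"
    using n w dp by (intro regular_graphon_step) auto
  then have gw': "graphon (step_graphon n ?w)" by (simp add: regular_graphon_def)
  have L1: "L \<ge> 1" using t by (simp add: L)
  have c0: "c \<ge> 0" unfolding c using L1 by (intro counting_const_nonneg) auto
  have "admits n \<tau> k (\<lambda>i j. (\<Sum>G\<in>S. adj G i j - p) / real (card S)) l"
    using S code by (intro admits_average) auto
  moreover have "(\<lambda>i j. (\<Sum>G\<in>S. adj G i j - p) / real (card S)) = (\<lambda>i j. ?w i j - p)"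
    using cS by (simp add: average_adj_def sum_subtractf diff_divide_distrib)
  ultimately have adm: "admits n \<tau> k (\<lambda>i j. ?w i j - p) l" by simp
  show ?thesis
  \<comment> \<open>A full code records \<open>k\<close> drops of \<open>frob\<close>. A shorter one
    must end in the clause of \<open>admits\<close> that bounds the residue in operator
    norm.\<close>
  proof (cases "length l = k")
    case True
    \<comment> \<open>The 64 is the product of 8 from the drops of \<open>frob\<close>, 4 from
      Pinsker's inequality and 2 from the factor \<open>n\<^sup>2 / 2\<close>.\<close>
    have "\<Phi> \<le> (real k * (\<tau>\<^sup>2 / 8)) / 8" using \<Phi>(1) by simp
    also have "\<dots> \<le> frob n (\<lambda>i j. ?w i j - p) / 8"
      using admits_frob_ge[OF adm \<tau>(2) True] by simp
    also have "\<dots> = (\<Sum>i\<in>{1..n}. \<Sum>j\<in>{1..n}. (?w i j - p)\<^sup>2 / 4) / 2"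
      by (simp add: frob_def sum_divide_distrib)
    also have "\<dots> \<le> (\<Sum>i\<in>{1..n}. \<Sum>j\<in>{1..n}. rel_entropy p (?w i j)) / 2"
      using p w by (intro divide_right_mono sum_mono rel_entropy_ge_square) auto
    also have "\<dots> = (real n)\<^sup>2 / 2 * graphon_entropy p (step_graphon n ?w)"
      unfolding graphon_entropy_step[OF n] using n by simp
    finally show ?thesis .
  next
    case False
    obtain G where G: "G \<in> S" using S by auto
    then have GR: "G \<in> regular_graphs n d" using S by auto
    let ?A = "step_graphon n (adj G)"
    have gA: "graphon ?A" using n adj_sym adj_bounds by (intro graphon_step) auto
    have "op_bound n (2 * \<tau>) (\<lambda>i j. (?w i j - p) - (adj G i j - p))"
      using adm code[OF G] False by (rule admits_close)
    then have "op_bound n (2 * \<tau>) (\<lambda>i j. ?w i j - adj G i j)" by simp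
    then have "form_bound (2 * \<tau> / real n) (\<lambda>x y. step_graphon n ?w x y - ?A x y)"
      using n \<tau>(2) by (intro form_bound_step) auto
    then have fb: "form_bound (\<delta> * p powr \<Delta>) (\<lambda>x y. step_graphon n ?w x y - ?A x y)"
      using n by (simp add: \<tau>(1))
    have close: "mixed_hom ?V F (\<lambda>_. step_graphon n ?w) \<ge> mixed_hom ?V F (\<lambda>_. ?A) - c * \<delta> * p ^ card F"
      if F: "F \<subseteq> ?E" and base: "\<And>F'. F' \<subset> F \<Longrightarrow> mixed_hom ?V F' (\<lambda>_. ?A) \<le> L * p ^ card F'" for F
    proof -
      have "\<bar>mixed_hom ?V F (\<lambda>_. step_graphon n ?w) - mixed_hom ?V F (\<lambda>_. ?A)\<bar>
          \<le> counting_const L (card F) * \<delta> * p ^ card F"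
      proof (rule mixed_hom_close_full[OF K(1) _ gw' gA fb])
        show "F \<subseteq> pairs ?V" using F K by auto
        fix u v assume "{u, v} \<in> F"
        then show "real (edeg F u) + real (edeg F v) \<le> 2 * \<Delta>"
          using deg[of u v] F edeg_mono[OF fE F, of u] edeg_mono[OF fE F, of v] by force
      qed (use p \<delta> L1 base in auto)
      also have "\<dots> \<le> c * \<delta> * p ^ card F"
        unfolding c using L1 F fE \<delta> p
        by (intro mult_right_mono counting_const_mono card_mono) auto
      finally show ?thesis by linarith
    qed
    show ?thesis
    proof (cases "\<exists>F. F \<subset> ?E \<and> mixed_hom ?V F (\<lambda>_. ?A) > L * p ^ card F")
      case False
      have "mixed_hom ?V ?E (\<lambda>_. ?A) = real (hom_count K G) / real n ^ card ?V"
        using n K regular_graphsD(1)[OF GR] by (rule mixed_hom_adj)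
      also have "\<dots> \<ge> (t + c * \<delta>) * p ^ card ?E"
        using hom[OF G] n by (simp add: le_divide_eq)
      finally have "mixed_hom ?V ?E (\<lambda>_. ?A) \<ge> (t + c * \<delta>) * p ^ card ?E" .
      moreover have "mixed_hom ?V ?E (\<lambda>_. step_graphon n ?w) \<ge> mixed_hom ?V ?E (\<lambda>_. ?A) - c * \<delta> * p ^ card ?E"
        using False by (intro close) (auto simp: not_less)
      ultimately have "hom_density K (step_graphon n ?w) \<ge> t * p ^ card ?E"
        unfolding hom_density_eq_mixed_hom by (simp add: algebra_simps)
      then show ?thesis by (rule \<Phi>(2)[OF gw])
    next
      case True
      define P where "P F \<longleftrightarrow> F \<subset> ?E \<and> mixed_hom ?V F (\<lambda>_. ?A) > L * p ^ card F" for F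
      from True have "\<exists>F. P F" by (simp add: P_def)
      \<comment> \<open>Minimality supplies the hypothesis of the counting lemma on proper
        subgraphs, which puts no upper bound on the density of \<open>F\<close> itself.\<close>
      then obtain F where F: "P F" and min: "\<And>F'. P F' \<Longrightarrow> card F \<le> card F'"
        by (metis ex_has_least_nat[of P _ card])
      have FE: "F \<subseteq> ?E" using F by (auto simp: P_def)
      have "mixed_hom ?V F (\<lambda>_. step_graphon n ?w) \<ge> mixed_hom ?V F (\<lambda>_. ?A) - c * \<delta> * p ^ card F"
      proof (rule close[OF FE])
        fix F' assume F': "F' \<subset> F"
        have "card F' < card F" using F' FE fE by (meson finite_subset psubset_card_mono)
        then have "\<not> P F'" using min by force
        then show "mixed_hom ?V F' (\<lambda>_. ?A) \<le> L * p ^ card F'"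
          using F' FE by (auto simp: P_def not_less)
      qed
      moreover have "mixed_hom ?V F (\<lambda>_. ?A) > L * p ^ card F" using F by (simp add: P_def)
      moreover have "c * \<delta> * p ^ card F \<le> 1 * p ^ card F" using \<delta> p by (intro mult_right_mono) auto
      \<comment> \<open>This explains \<open>L\<close>: its summand 1 absorbs the counting error,
        and \<open>2 ^ card ?E\<close> is what the midpoint loses.\<close>
      ultimately have big: "mixed_hom ?V F (\<lambda>_. step_graphon n ?w) \<ge> 2 ^ card ?E * t * p ^ card F"
        by (simp add: L algebra_simps)
      define w' where "w' i j = (?w i j + p) / 2" for i j
      have rw': "regular_graphon p (step_graphon n w')"
      proof (rule regular_graphon_step[OF n])
        fix i j assume "i \<in> {1..n}" "j \<in> {1..n}"
        show "w' i j = w' j i \<and> 0 \<le> w' i j \<and> w' i j \<le> 1"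
          unfolding w'_def using w(1)[of i j] w(2,3)[of i j] p by auto
      next
        fix i assume i: "i \<in> {1..n}"
        show "(\<Sum>j\<in>{1..n}. w' i j) = p * real n"
          unfolding w'_def sum_divide_distrib[symmetric] sum.distrib w(5)[OF i] dp by simp
      qed
      then have gw'': "graphon (step_graphon n w')" by (simp add: regular_graphon_def)
      have cF: "card F \<le> card ?E" using FE fE by (rule card_mono[rotated])
      have "t * p ^ card ?E = p ^ (card ?E - card F) / 2 ^ card ?E * (2 ^ card ?E * t * p ^ card F)"
        using cF by (simp add: power_add[symmetric])
      also have "\<dots> \<le> p ^ (card ?E - card F) / 2 ^ card ?E * mixed_hom ?V F (\<lambda>_. step_graphon n ?w)"
        using big p by (intro mult_left_mono) auto
      also have "\<dots> \<le> mixed_hom ?V ?E (\<lambda>_. step_graphon n w')"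
        by (rule mixed_hom_midpoint_ge[OF K FE gw' _ gw'' p(2,3)]) (simp add: step_graphon_def w'_def)
      finally have "hom_density K (step_graphon n w') \<ge> t * p ^ card ?E"
        by (simp add: hom_density_eq_mixed_hom)
      then have "\<Phi> \<le> (real n)\<^sup>2 / 2 * graphon_entropy p (step_graphon n w')" by (rule \<Phi>(2)[OF rw'])
      also have "\<dots> = (\<Sum>i\<in>{1..n}. \<Sum>j\<in>{1..n}. rel_entropy p (w' i j)) / 2"
        unfolding graphon_entropy_step[OF n] using n by simp
      also have "\<dots> \<le> (\<Sum>i\<in>{1..n}. \<Sum>j\<in>{1..n}. rel_entropy p (?w i j)) / 2"
      proof (intro divide_right_mono sum_mono)
        fix i j
        have "rel_entropy p (w' i j) \<le> rel_entropy p (?w i j) / 2"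
          unfolding w'_def using p w by (intro rel_entropy_midpoint) auto
        moreover have "rel_entropy p (?w i j) \<ge> 0" using p w by (intro rel_entropy_bounds) auto
        ultimately show "rel_entropy p (w' i j) \<le> rel_entropy p (?w i j)" by linarith
      qed simp
      also have "\<dots> = (real n)\<^sup>2 / 2 * graphon_entropy p (step_graphon n ?w)"
        unfolding graphon_entropy_step[OF n] using n by simp
      finally show ?thesis .
    qed
  qed
qed

section \<open>The union bound over codes\<close>

lemma ln_code_bound:
  assumes "n \<ge> 4"
  shows "ln (real ((2 * n + 1) ^ (2 * n + 1) + 1)) \<le> 8 * (real n * ln (real n))"
proof -
  have l: "ln (real n) \<ge> 0" using assms by simp
  have "(2 * n + 1) ^ (2 * n + 1) + 1 \<le> (2 * n + 1) ^ (2 * n + 2)"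
  proof -
    have "1 \<le> (2 * n + 1) ^ (2 * n + 1)" by (rule one_le_power) simp
    then have "(2 * n + 1) ^ (2 * n + 1) + 1 \<le> 2 * (2 * n + 1) ^ (2 * n + 1)" by linarith
    also have "\<dots> \<le> (2 * n + 1) * (2 * n + 1) ^ (2 * n + 1)" using assms by (intro mult_right_mono) auto
    finally show ?thesis by simp
  qed
  then have "real ((2 * n + 1) ^ (2 * n + 1) + 1) \<le> real ((2 * n + 1) ^ (2 * n + 2))" by (rule of_nat_mono)
  then have "ln (real ((2 * n + 1) ^ (2 * n + 1) + 1)) \<le> ln (real ((2 * n + 1) ^ (2 * n + 2)))"
    by (subst ln_le_cancel_iff) (auto simp del: of_nat_add of_nat_power)
  also have "\<dots> = real (2 * n + 2) * ln (real (2 * n + 1))" by (simp only: of_nat_power ln_realpow)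
  also have "ln (real (2 * n + 1)) \<le> ln (real n ^ 2)"
  proof -
    have "2 * n + 1 \<le> 4 * n" using assms by simp
    also have "\<dots> \<le> n * n" using assms by (intro mult_right_mono) auto
    finally have "real (2 * n + 1) \<le> real (n * n)" by (rule of_nat_mono)
    then show ?thesis using assms by (subst ln_le_cancel_iff) (auto simp: power2_eq_square)
  qed
  also have "ln (real n ^ 2) = 2 * ln (real n)" using assms by (simp add: ln_realpow)
  finally have "ln (real ((2 * n + 1) ^ (2 * n + 1) + 1)) \<le> real (2 * n + 2) * (2 * ln (real n))"
    by (simp add: mult_left_mono)
  also have "\<dots> \<le> real (4 * n) * (2 * ln (real n))"
    using assms l by (intro mult_right_mono of_nat_mono) auto
  finally show ?thesis by simp
qed

text \<open>For each code, at most \<open>exp (h - \<Phi>)\<close> graphs of the event admit it. The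
  number of codes contributes \<open>8 * k\<close>, and the lower bound for the number of regular
  graphs contributes 6, in units of \<open>n ln n\<close>.\<close>

lemma prob_upper_tail_le:
  fixes K :: "'a ugraph"
  assumes n: "n \<ge> 4" and d: "0 < d" "2 * d \<le> n" "even (d * n)" and p: "p = real d / real n"
    and K: "finite (verts K)" "edges K \<subseteq> pairs (verts K)"
    and deg: "\<And>u v. {u, v} \<in> edges K \<Longrightarrow> real (edeg (edges K) u) + real (edeg (edges K) v) \<le> 2 * \<Delta>"
    and t: "t > 0" and L: "L = 2 ^ card (edges K) * t + 1" and c: "c = counting_const L (card (edges K))"
    and \<delta>: "0 \<le> \<delta>" "\<delta> \<le> 1" "c * \<delta> \<le> 1"
    and \<tau>: "\<tau> = \<delta> * real n * p powr \<Delta> / 2" "\<tau> \<ge> 8" "\<tau> \<ge> 4 * sqrt (real n) + 2"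
    and \<Phi>: "\<Phi> \<le> real k * \<tau>\<^sup>2 / 64"
      "\<And>W. regular_graphon p W \<Longrightarrow> hom_density K W \<ge> t * p ^ card (edges K) \<Longrightarrow> \<Phi> \<le> (real n)\<^sup>2 / 2 * graphon_entropy p W"
  defines "Ev \<equiv> {G. real (hom_count K G) \<ge> (t + c * \<delta>) * p ^ card (edges K) * real n ^ card (verts K)}"
  shows "measure_pmf.prob (random_regular_graph n d) Ev
    \<le> exp (- \<Phi> + (8 * real k + 6) * (real n * ln (real n)))"
proof -
  define R where "R = regular_graphs n d"
  have "2 * real d \<le> real n" using d by (metis of_nat_le_iff of_nat_mult of_nat_numeral)
  then have p01: "0 < p" "p < 1" using n d by (auto simp: p field_simps)
  note cR = ln_card_regular_graphs_ge[OF n d p, folded R_def]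
  have fR: "finite R" unfolding R_def by (rule finite_regular_graphs)
  have Rpos: "real (card R) > 0" using cR(1) fR by (simp add: card_gt_0_iff)
  define h where "h = (real n)\<^sup>2 / 2 * binary_entropy p"
  define Sl where "Sl l = {G \<in> R \<inter> Ev. admits n \<tau> k (\<lambda>i j. adj G i j - p) l}" for l
  have Sl: "real (card (Sl l)) \<le> exp (h - \<Phi>)" for l
  proof (cases "Sl l = {}")
    case False
    have S: "finite (Sl l)" "Sl l \<subseteq> regular_graphs n d" using fR by (auto simp: Sl_def R_def)
    have "\<Phi> \<le> (real n)\<^sup>2 / 2 * graphon_entropy p (step_graphon n (average_adj (Sl l)))"
    proof (rule entropy_average_ge[OF _ p p01 K deg t L c \<delta> \<tau>(1,2) S(1) False S(2) _ _ \<Phi>])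
      show "admits n \<tau> k (\<lambda>i j. adj G i j - p) l" if "G \<in> Sl l" for G
        using that by (simp add: Sl_def)
      show "(t + c * \<delta>) * p ^ card (edges K) * real n ^ card (verts K) \<le> real (hom_count K G)" if "G \<in> Sl l" for G
        using that by (simp add: Sl_def Ev_def)
    qed (use n in auto)
    moreover have "ln (real (card (Sl l)))
        \<le> h - (real n)\<^sup>2 / 2 * graphon_entropy p (step_graphon n (average_adj (Sl l)))"
      unfolding h_def using n p p01 S False by (intro ln_card_le_entropy) auto
    ultimately have "ln (real (card (Sl l))) \<le> h - \<Phi>" by linarith
    moreover have "real (card (Sl l)) > 0" using S False by (simp add: card_gt_0_iff)
    ultimately show ?thesis by (metis exp_le_cancel_iff exp_ln)
  qed simp
  have cover: "R \<inter> Ev \<subseteq> (\<Union>l\<in>codes n k. Sl l)"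
  proof
    fix G assume G: "G \<in> R \<inter> Ev"
    have "frob n (\<lambda>i j. adj G i j - p) \<le> (\<Sum>i\<in>{1..n}. \<Sum>j\<in>{1..n}. 1)"
      unfolding frob_def
    proof (intro sum_mono)
      fix i j
      have "\<bar>adj G i j - p\<bar> \<le> 1" using adj_bounds[of G i j] p01 by linarith
      then show "(adj G i j - p)\<^sup>2 \<le> 1" by (simp add: abs_square_le_1)
    qed
    also have "\<dots> = (real n)\<^sup>2" by (simp add: power2_eq_square)
    finally have "frob n (\<lambda>i j. adj G i j - p) \<le> (real n)\<^sup>2" .
    then obtain l where "l \<in> codes n k" "admits n \<tau> k (\<lambda>i j. adj G i j - p) l"
      using exists_code[OF _ \<tau>(3,2)] n by fastforce
    then show "G \<in> (\<Union>l\<in>codes n k. Sl l)" using G by (auto simp: Sl_def)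
  qed
  have "card (R \<inter> Ev) \<le> card (\<Union>l\<in>codes n k. Sl l)"
    using cover fR finite_codes by (intro card_mono) (auto simp: Sl_def)
  also have "\<dots> \<le> (\<Sum>l\<in>codes n k. card (Sl l))" using finite_codes by (rule card_UN_le)
  finally have "real (card (R \<inter> Ev)) \<le> real (\<Sum>l\<in>codes n k. card (Sl l))" by (rule of_nat_mono)
  also have "\<dots> = (\<Sum>l\<in>codes n k. real (card (Sl l)))" by simp
  also have "\<dots> \<le> (\<Sum>l\<in>codes n k. exp (h - \<Phi>))" using Sl by (intro sum_mono) auto
  also have "\<dots> = real (card (codes n k)) * exp (h - \<Phi>)" by simp
  also have "\<dots> \<le> exp (8 * real k * (real n * ln (real n))) * exp (h - \<Phi>)"
  proof (rule mult_right_mono)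
    let ?N = "(2 * n + 1) ^ (2 * n + 1) + 1"
    have "real (card (codes n k)) \<le> real (?N ^ k)" by (rule of_nat_mono) (rule card_codes_le)
    also have "\<dots> = exp (real k * ln (real ?N))"
    proof -
      have "0 < ?N" by simp
      then have "0 < real ?N" by (simp only: of_nat_0_less_iff)
      then show ?thesis by (simp only: of_nat_power exp_of_nat_mult exp_ln)
    qed
    also have "\<dots> \<le> exp (real k * (8 * (real n * ln (real n))))"
      using ln_code_bound[OF n] by (simp only: exp_le_cancel_iff) (intro mult_left_mono, auto)
    finally show "real (card (codes n k)) \<le> exp (8 * real k * (real n * ln (real n)))" by (simp add: mult_ac)
  qed simp
  finally have num: "real (card (R \<inter> Ev)) \<le> exp (8 * real k * (real n * ln (real n)) + (h - \<Phi>))"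
    by (simp only: exp_add)
  have "real (card R) = exp (ln (real (card R)))" using Rpos by simp
  also have "\<dots> \<ge> exp (h - 6 * (real n * ln (real n)))" using cR(2) by (simp add: h_def)
  finally have den: "real (card R) \<ge> exp (h - 6 * (real n * ln (real n)))" .
  have "measure_pmf.prob (random_regular_graph n d) Ev = real (card (R \<inter> Ev)) / real (card R)"
    unfolding random_regular_graph_def R_def[symmetric] using cR(1) fR by (simp add: measure_pmf_of_set)
  also have "\<dots> \<le> exp (8 * real k * (real n * ln (real n)) + (h - \<Phi>)) / exp (h - 6 * (real n * ln (real n)))"
    using num den Rpos by (intro frac_le) auto
  also have "\<dots> = exp (- \<Phi> + (8 * real k + 6) * (real n * ln (real n)))"
    unfolding exp_diff[symmetric] by (simp add: algebra_simps)
  finally show ?thesis .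
qed

lemma neg_log_ge:
  assumes "q \<ge> 0" "q \<le> exp (- a)"
  shows "neg_log q \<ge> ereal a"
proof (cases "q = 0")
  case False
  then have "q > 0" using assms by simp
  moreover from this have "ln q \<le> ln (exp (- a))" using assms by (subst ln_le_cancel_iff) auto
  ultimately show ?thesis by (simp add: neg_log_def)
qed (simp add: neg_log_def)

section \<open>The upper tail\<close>

lemma edges_in_pairs: "simple_graph K \<Longrightarrow> edges K \<subseteq> pairs (verts K)"
  by (auto simp: simple_graph_def pairs_def)

lemma Delta_star_ge:
  assumes K: "simple_graph K" and e: "{u, v} \<in> edges K"
  shows "real (edeg (edges K) u) + real (edeg (edges K) v) \<le> 2 * Delta_star K"
proof -
  let ?M = "{deg K v + deg K w | v w. {v, w} \<in> edges K}"
  have "?M \<subseteq> (\<lambda>(v, w). deg K v + deg K w) ` (verts K \<times> verts K)"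
  proof clarify
    fix v w assume "{v, w} \<in> edges K"
    then have "{v, w} \<in> pairs (verts K)" using edges_in_pairs[OF K] by blast
    then have "(v, w) \<in> verts K \<times> verts K" unfolding doubleton_in_pairs by simp
    then show "deg K v + deg K w \<in> (\<lambda>(v, w). deg K v + deg K w) ` (verts K \<times> verts K)"
      by (rule rev_image_eqI) simp
  qed
  moreover have "finite (verts K)" using K by (simp add: simple_graph_def)
  ultimately have "finite ?M" by (meson finite_SigmaI finite_imageI finite_subset)
  then have "deg K u + deg K v \<le> Max ?M" using e by (intro Max_ge) auto
  then have "real (deg K u) + real (deg K v) \<le> real (Max ?M)" by linarith
  then show ?thesis by (simp add: Delta_star_def edeg_def deg_def)
qed

text \<open>A cycle supplies an edge. Positivity is what allows the growth condition on
  \<open>p\<close> to be raised to the power \<open>2 * Delta_star K\<close>.\<close>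

lemma Delta_star_pos:
  assumes K: "simple_graph K" "\<not> forest K"
  shows "Delta_star K > 0"
proof -
  obtain vs where vs: "is_cycle K vs" using K by (auto simp: forest_def)
  then have "0 < length vs" by (auto simp: is_cycle_def)
  then obtain u v where uv: "{u, v} \<in> edges K" using vs unfolding is_cycle_def by blast
  have "finite (edges K)"
    using K edges_in_pairs[OF K(1)] finite_pairs finite_subset by (auto simp: simple_graph_def)
  then have "edeg (edges K) u > 0" using uv by (auto simp: edeg_def card_gt_0_iff)
  then show ?thesis using Delta_star_ge[OF K(1) uv] by linarith
qed

lemma Phi_le:
  assumes "p = real d / real n" "regular_graphon p W" "hom_density K W \<ge> t * p ^ card (edges K)"
  shows "Phi n d K t \<le> ereal (real n ^ 2 / 2 * graphon_entropy p W)"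
proof -
  have "(INF W\<in>{W. regular_graphon p W \<and> hom_density K W \<ge> t * p ^ card (edges K)}. ereal (graphon_entropy p W))
      \<le> ereal (graphon_entropy p W)"
    using assms by (intro INF_lower) auto
  then have "ereal (real n ^ 2 / 2) * (INF W\<in>{W. regular_graphon p W \<and> hom_density K W \<ge> t * p ^ card (edges K)}. ereal (graphon_entropy p W))
      \<le> ereal (real n ^ 2 / 2) * ereal (graphon_entropy p W)"
    by (rule ereal_mult_left_mono) simp
  then show ?thesis using assms(1) by (simp add: Phi_def Let_def)
qed

lemma Phi_ge:
  assumes "p = real d / real n"
    and "\<And>W. regular_graphon p W \<Longrightarrow> hom_density K W \<ge> t * p ^ card (edges K) \<Longrightarrow> b \<le> graphon_entropy p W"
  shows "ereal (real n ^ 2 / 2 * b) \<le> Phi n d K t"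
proof -
  have "ereal b \<le> (INF W\<in>{W. regular_graphon p W \<and> hom_density K W \<ge> t * p ^ card (edges K)}. ereal (graphon_entropy p W))"
    using assms by (intro INF_greatest) auto
  then have "ereal (real n ^ 2 / 2) * ereal b
      \<le> ereal (real n ^ 2 / 2) * (INF W\<in>{W. regular_graphon p W \<and> hom_density K W \<ge> t * p ^ card (edges K)}. ereal (graphon_entropy p W))"
    by (rule ereal_mult_left_mono) simp
  then show ?thesis using assms(1) by (simp add: Phi_def Let_def)
qed

text \<open>The number \<open>k\<close> of greedy steps is chosen so that \<open>k \<tau>\<^sup>2\<close> is comparable to \<open>\<Phi>\<close>; the number of
  codes is then \<open>exp(o(\<Phi>))\<close> because \<open>\<Phi>\<close> has order at least \<open>n\<^sup>2 p\<^bsup>2\<Delta>\<^esup>\<close>.\<close>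

lemma neg_log_prob_ge:
  fixes K :: "'a ugraph"
  assumes n: "n \<ge> 4" and d: "0 < d" "2 * d \<le> n" "even (d * n)" and p: "p = real d / real n"
    and K: "simple_graph K" and t: "t > 1"
    and c: "c = counting_const (2 ^ card (edges K) * t + 1) (card (edges K))"
    and \<rho>: "\<rho> = ln (real n) / (real n * p powr (2 * Delta_star K))"
    and \<delta>: "\<delta> = \<rho> powr (1 / 4)" "c * \<delta> \<le> 1"
    and \<rho>small: "sqrt \<rho> \<le> 1 / 256"
    and \<delta>0: "0 < \<delta>0" "\<delta>0 \<le> 1" "counting_const 1 (card (edges K)) * \<delta>0 < t - 1"
  shows "neg_log (measure_pmf.prob (random_regular_graph n d)
      {G. real (hom_count K G) \<ge> (t + c * \<delta>) * p ^ card (edges K) * real n ^ card (verts K)})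
    \<ge> ereal (1 - (2048 * sqrt \<rho> + 112 / \<delta>0\<^sup>2 * \<rho>)) * Phi n d K t"
proof -
  let ?Ev = "{G. real (hom_count K G) \<ge> (t + c * \<delta>) * p ^ card (edges K) * real n ^ card (verts K)}"
  let ?\<Delta> = "Delta_star K"
  have V: "finite (verts K)" using K by (simp add: simple_graph_def)
  note E = edges_in_pairs[OF K]
  note deg = Delta_star_ge[OF K]
  have "2 * real d \<le> real n" using d by (metis of_nat_le_iff of_nat_mult of_nat_numeral)
  then have p01: "0 < p" "p < 1" using n d by (auto simp: p field_simps)
  have ln1: "ln (real n) \<ge> 1"
  proof -
    have "exp 1 \<le> (4::real)" using exp_le by simp
    also have "\<dots> \<le> real n" using n by simp
    finally show ?thesis using n by (subst ln_ge_iff) auto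
  qed
  have \<rho>pos: "\<rho> > 0" unfolding \<rho> using n p01 ln1 by (intro divide_pos_pos) auto
  have c0: "c \<ge> 0" unfolding c using t by (intro counting_const_nonneg) auto
  have \<rho>1: "\<rho> \<le> 1"
  proof -
    have "sqrt \<rho> \<le> 1" using \<rho>small by linarith
    then show ?thesis by simp
  qed
  have \<delta>pos: "0 < \<delta>" "\<delta> \<le> 1" using \<rho>pos \<rho>1 by (auto simp: \<delta> powr_le1)
  have \<delta>2: "\<delta>\<^sup>2 = sqrt \<rho>"
    using \<rho>pos by (simp add: \<delta> power2_eq_square powr_add[symmetric] powr_half_sqrt)
  \<comment> \<open>The step graphon of a single graph in the event is admissible. So
    \<open>Phi\<close> is infinite only if the event is empty, and then \<open>neg_log\<close> is
    infinite as well.\<close>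
  have hom_nonempty: "Phi n d K t < \<infinity>" if "G \<in> regular_graphs n d \<inter> ?Ev" for G
  proof -
    have G: "G \<in> regular_graphs n d" "real (hom_count K G) \<ge> (t + c * \<delta>) * p ^ card (edges K) * real n ^ card (verts K)"
      using that by auto
    have "regular_graphon p (step_graphon n (adj G))"
      using n adj_regular(2)[OF G(1)] adj_sym adj_bounds p by (intro regular_graphon_step) auto
    moreover have "t * p ^ card (edges K) \<le> hom_density K (step_graphon n (adj G))"
    proof -
      have "t * p ^ card (edges K) \<le> (t + c * \<delta>) * p ^ card (edges K)"
        using c0 \<delta>pos p01 by (intro mult_right_mono) auto
      also have "\<dots> \<le> real (hom_count K G) / real n ^ card (verts K)" using G(2) n by (simp add: le_divide_eq)
      also have "\<dots> = hom_density K (step_graphon n (adj G))"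
        unfolding hom_density_eq_mixed_hom using n V E regular_graphsD(1)[OF G(1)]
        by (intro mixed_hom_adj[symmetric]) auto
      finally show ?thesis .
    qed
    ultimately have "Phi n d K t \<le> ereal (real n ^ 2 / 2 * graphon_entropy p (step_graphon n (adj G)))"
      by (rule Phi_le[OF p])
    then show ?thesis by (auto intro: le_less_trans)
  qed
  show ?thesis
  proof (cases "regular_graphs n d \<inter> ?Ev = {}")
    case True
    have "measure_pmf.prob (random_regular_graph n d) ?Ev = 0"
      unfolding random_regular_graph_def
      using ln_card_regular_graphs_ge(1)[OF n d p] finite_regular_graphs True by (simp add: measure_pmf_of_set)
    then show ?thesis by (simp add: neg_log_def)
  next
    case False
    then have fin: "Phi n d K t < \<infinity>" using hom_nonempty by blast
    define b where "b = \<delta>0\<^sup>2 * p powr (2 * ?\<Delta>) / 4"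
    define X where "X = (real n)\<^sup>2 * p powr (2 * ?\<Delta>)"
    have Xpos: "X > 0" using n p01 by (simp add: X_def)
    have lower: "ereal (real n ^ 2 / 2 * b) \<le> Phi n d K t"
      unfolding b_def
      using V E deg p01 \<delta>0 by (intro Phi_ge[OF p] graphon_entropy_lower_bound[where t = t]) (auto simp: regular_graphon_def)
    then obtain \<Phi> where \<Phi>: "Phi n d K t = ereal \<Phi>" using fin by (cases "Phi n d K t") auto
    have \<Phi>X: "\<delta>0\<^sup>2 * X \<le> 8 * \<Phi>" using lower unfolding \<Phi> by (simp add: b_def X_def mult_ac)
    then have \<Phi>pos: "\<Phi> > 0" using Xpos \<delta>0 by (smt (verit) mult_pos_pos zero_less_power)
    define \<tau> where "\<tau> = \<delta> * real n * p powr ?\<Delta> / 2"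
    have \<tau>2: "\<tau>\<^sup>2 = sqrt \<rho> * X / 4"
      unfolding \<tau>_def X_def \<delta>2[symmetric] by (simp add: power_mult_distrib power_divide power2_eq_square powr_add[symmetric])
    have nln: "real n * ln (real n) = \<rho> * X"
      using n p01 by (simp add: \<rho> X_def power2_eq_square)
    \<comment> \<open>By the two identities above, \<open>\<tau>\<^sup>2\<close> equals
      \<open>n ln n / (4 * sqrt \<rho>)\<close>. The assumption
      \<open>sqrt \<rho> \<le> 1 / 256\<close> makes this at least \<open>64 * n\<close>.\<close>
    have \<tau>big: "\<tau> \<ge> 8 * sqrt (real n)"
    proof -
      have "64 * real n \<le> \<tau>\<^sup>2"
      proof -
        have "real n \<le> \<rho> * X" unfolding nln[symmetric] using ln1 n by simp
        also have "\<dots> = sqrt \<rho> * (sqrt \<rho> * X)" using \<rho>pos by simp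
        also have "\<dots> \<le> 1 / 256 * (sqrt \<rho> * X)" using \<rho>small \<rho>pos Xpos by (intro mult_right_mono) auto
        finally show ?thesis by (simp add: \<tau>2)
      qed
      then have "sqrt (64 * real n) \<le> \<tau>" using \<delta>pos by (intro real_le_lsqrt) (auto simp: \<tau>_def)
      then show ?thesis by (simp add: real_sqrt_mult)
    qed
    have "sqrt (real n) \<ge> 1" using n by simp
    with \<tau>big have \<tau>8: "\<tau> \<ge> 8" "\<tau> \<ge> 4 * sqrt (real n) + 2" by linarith+
    define k where "k = nat \<lceil>64 * \<Phi> / \<tau>\<^sup>2\<rceil>"
    have \<tau>pos: "\<tau>\<^sup>2 > 0" unfolding \<tau>2 using \<rho>pos Xpos by simp
    have k: "64 * \<Phi> / \<tau>\<^sup>2 \<le> real k" "real k \<le> 64 * \<Phi> / \<tau>\<^sup>2 + 1"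
    proof -
      have "64 * \<Phi> / \<tau>\<^sup>2 \<ge> 0" using \<Phi>pos by simp
      then show "64 * \<Phi> / \<tau>\<^sup>2 \<le> real k" "real k \<le> 64 * \<Phi> / \<tau>\<^sup>2 + 1"
        unfolding k_def by linarith+
    qed
    have "measure_pmf.prob (random_regular_graph n d) ?Ev
        \<le> exp (- \<Phi> + (8 * real k + 6) * (real n * ln (real n)))"
    proof (rule prob_upper_tail_le[OF n d p V E deg _ refl c _ \<delta>pos(2) \<delta>(2) \<tau>_def])
      show "\<Phi> \<le> real k * \<tau>\<^sup>2 / 64" using k(1) \<tau>pos by (simp add: divide_le_eq)
      show "\<Phi> \<le> (real n)\<^sup>2 / 2 * graphon_entropy p W"
        if "regular_graphon p W" "t * p ^ card (edges K) \<le> hom_density K W" for W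
        using Phi_le[OF p that] by (simp add: \<Phi>)
    qed (use t \<delta>pos \<tau>8 in auto)
    then have 1: "neg_log (measure_pmf.prob (random_regular_graph n d) ?Ev)
        \<ge> ereal (\<Phi> - (8 * real k + 6) * (real n * ln (real n)))"
      by (intro neg_log_ge) auto
    \<comment> \<open>Origin of the constants: \<open>512 = 8 * 64\<close> is multiplied by 4 from
      \<open>\<tau>\<^sup>2 = sqrt \<rho> * X / 4\<close>, which gives 2048. The rest
      \<open>14 = 8 + 6\<close>, with 8 for rounding \<open>k\<close> up, is multiplied by 8 from
      \<open>\<delta>0\<^sup>2 * X \<le> 8 * \<Phi>\<close>, which gives 112.\<close>
    have "(8 * real k + 6) * (real n * ln (real n)) \<le> (8 * (64 * \<Phi> / \<tau>\<^sup>2 + 1) + 6) * (\<rho> * X)"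
      unfolding nln using k \<rho>pos Xpos by (intro mult_right_mono) auto
    also have "\<dots> = 512 * \<Phi> * (\<rho> * X) / \<tau>\<^sup>2 + 14 * \<rho> * X" by (simp add: algebra_simps)
    also have "512 * \<Phi> * (\<rho> * X) / \<tau>\<^sup>2 = 2048 * sqrt \<rho> * \<Phi>"
    proof -
      have "\<rho> = sqrt \<rho> * sqrt \<rho>" using \<rho>pos by simp
      then have eq: "512 * \<Phi> * (\<rho> * X) = 2048 * sqrt \<rho> * \<Phi> * \<tau>\<^sup>2" unfolding \<tau>2
        by (simp add: field_simps)
      show ?thesis unfolding eq using \<tau>pos by simp
    qed
    also have "14 * \<rho> * X \<le> 112 / \<delta>0\<^sup>2 * \<rho> * \<Phi>"
    proof -
      have "X \<le> 8 / \<delta>0\<^sup>2 * \<Phi>" using \<Phi>X \<delta>0 by (simp add: field_simps)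
      then have "14 * \<rho> * X \<le> 14 * \<rho> * (8 / \<delta>0\<^sup>2 * \<Phi>)" using \<rho>pos by (intro mult_left_mono) auto
      then show ?thesis by (simp add: mult_ac)
    qed
    finally have "(1 - (2048 * sqrt \<rho> + 112 / \<delta>0\<^sup>2 * \<rho>)) * \<Phi> \<le> \<Phi> - (8 * real k + 6) * (real n * ln (real n))"
      by (simp add: algebra_simps)
    then have "ereal ((1 - (2048 * sqrt \<rho> + 112 / \<delta>0\<^sup>2 * \<rho>)) * \<Phi>)
        \<le> neg_log (measure_pmf.prob (random_regular_graph n d) ?Ev)"
      using 1 by (meson ereal_less_eq(3) order_trans)
    then show ?thesis by (simp add: \<Phi>)
  qed
qed

theorem theorem2p18:
  fixes K :: "'a ugraph" and t :: real and d :: "nat \<Rightarrow> nat" and p :: "nat \<Rightarrow> real"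
  assumes "simple_graph K" and "no_isolated_verts K" and "\<not> forest K"
    and "t > 1"
    and "\<And>n. n \<ge> 1 \<Longrightarrow> d n > 0"
    and "\<And>n. n \<ge> 1 \<Longrightarrow> even (d n * n)"
    and "\<And>n. p n = real (d n) / real n"
    and "(\<lambda>n. (ln (real n) / real n) powr (1 / (2 * Delta_star K))) \<in> o(p)"
    and "p \<in> o(\<lambda>_. 1)"
  shows "\<exists>\<epsilon> \<delta> :: nat \<Rightarrow> real. \<epsilon> \<in> o(\<lambda>_. 1) \<and> \<delta> \<in> o(\<lambda>_. 1) \<and>
     (\<forall>\<^sub>F n in sequentially.
        neg_log (measure_pmf.prob (random_regular_graph n (d n))
          {G. real (hom_count K G) \<ge> (t + \<epsilon> n) * p n ^ card (edges K) * real n ^ card (verts K)})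
        \<ge> ereal (1 - \<delta> n) * Phi n (d n) K t)"
proof -
  let ?\<Delta> = "Delta_star K"
  have \<Delta>: "?\<Delta> > 0" using assms(1,3) by (rule Delta_star_pos)
  define c where "c = counting_const (2 ^ card (edges K) * t + 1) (card (edges K))"
  define c1 where "c1 = counting_const 1 (card (edges K))"
  have c1: "c1 \<ge> 0" unfolding c1_def by (intro counting_const_nonneg) simp
  \<comment> \<open>The denominator keeps \<open>c1 * \<delta>0\<close> strictly below
    \<open>t - 1\<close>, also when \<open>c1 = 0\<close>.\<close>
  define \<delta>0 where "\<delta>0 = min 1 ((t - 1) / (2 * (c1 + 1)))"
  have \<delta>0: "0 < \<delta>0" "\<delta>0 \<le> 1" "c1 * \<delta>0 < t - 1"
  proof -
    show "0 < \<delta>0" "\<delta>0 \<le> 1" using assms(4) c1 by (auto simp: \<delta>0_def)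
    have "c1 * \<delta>0 \<le> c1 * ((t - 1) / (2 * (c1 + 1)))" using c1 by (intro mult_left_mono) (auto simp: \<delta>0_def)
    also have "\<dots> = (t - 1) * (c1 / (2 * (c1 + 1)))" by simp
    also have "\<dots> < (t - 1) * 1" using c1 assms(4) by (intro mult_strict_left_mono) auto
    finally show "c1 * \<delta>0 < t - 1" by simp
  qed
  \<comment> \<open>The ratio of \<open>n ln n\<close> to
    \<open>n\<^sup>2 * p powr (2 * Delta_star K)\<close>. It is the ratio in the growth condition
    raised to the power \<open>2 * Delta_star K\<close>, so it tends to 0.\<close>
  define \<rho> where "\<rho> n = ln (real n) / (real n * p n powr (2 * ?\<Delta>))" for n
  have ppos: "p n > 0" if "n \<ge> 1" for n using assms(5)[OF that] that by (simp add: assms(7))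
  have "(\<lambda>n. (ln (real n) / real n) powr (1 / (2 * ?\<Delta>)) / p n) \<longlonglongrightarrow> 0"
    using assms(8) by (rule smalloD_tendsto)
  then have "(\<lambda>n. ((ln (real n) / real n) powr (1 / (2 * ?\<Delta>)) / p n) powr (2 * ?\<Delta>)) \<longlonglongrightarrow> 0"
  proof (rule tendsto_zero_powrI[where b = "2 * ?\<Delta>"])
    show "\<forall>\<^sub>F n in sequentially. 0 \<le> (ln (real n) / real n) powr (1 / (2 * ?\<Delta>)) / p n"
      using eventually_ge_at_top[of 1] by eventually_elim (use ppos in \<open>auto simp: less_imp_le\<close>)
  qed (use \<Delta> in auto)
  moreover have "\<forall>\<^sub>F n in sequentially. ((ln (real n) / real n) powr (1 / (2 * ?\<Delta>)) / p n) powr (2 * ?\<Delta>) = \<rho> n"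
    using eventually_ge_at_top[of 2]
  proof eventually_elim
    case (elim n)
    then have "p n > 0" "ln (real n) / real n > 0" using ppos by auto
    moreover have "(x powr (1 / (2 * ?\<Delta>)) / y) powr (2 * ?\<Delta>) = x / y powr (2 * ?\<Delta>)"
      if "x > 0" "y > 0" for x y :: real
      using that \<Delta> by (simp add: powr_divide powr_powr)
    ultimately show ?case by (simp only: \<rho>_def divide_divide_eq_left)
  qed
  ultimately have \<rho>0: "\<rho> \<longlonglongrightarrow> 0" by (rule Lim_transform_eventually)
  have sq0: "(\<lambda>n. sqrt (\<rho> n)) \<longlonglongrightarrow> 0" using tendsto_real_sqrt[OF \<rho>0] by simp
  have \<rho>nn: "\<forall>\<^sub>F n in sequentially. 0 \<le> \<rho> n"
    using eventually_ge_at_top[of 1] by eventually_elim (auto simp: \<rho>_def)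
  have \<delta>lim: "(\<lambda>n. \<rho> n powr (1 / 4)) \<longlonglongrightarrow> 0"
    by (rule tendsto_zero_powrI[OF \<rho>0 tendsto_const \<rho>nn]) simp
  have \<epsilon>lim: "(\<lambda>n. c * \<rho> n powr (1 / 4)) \<longlonglongrightarrow> 0" using tendsto_mult_left[OF \<delta>lim, of c] by simp
  have \<delta>'lim: "(\<lambda>n. 2048 * sqrt (\<rho> n) + 112 / \<delta>0\<^sup>2 * \<rho> n) \<longlonglongrightarrow> 0"
    using tendsto_add[OF tendsto_mult_left[OF sq0, of 2048] tendsto_mult_left[OF \<rho>0, of "112 / \<delta>0\<^sup>2"]] by simp
  have p0: "p \<longlonglongrightarrow> 0" using smalloD_tendsto[OF assms(9)] by simp
  \<comment> \<open>This yields \<open>2 * d n \<le> n\<close>, under which regular graphs exist and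
    their number is bounded below.\<close>
  have "\<forall>\<^sub>F n in sequentially. p n < 1 / 2" by (rule order_tendstoD(2)[OF p0]) simp
  moreover have "\<forall>\<^sub>F n in sequentially. sqrt (\<rho> n) < 1 / 256" by (rule order_tendstoD(2)[OF sq0]) simp
  moreover have "\<forall>\<^sub>F n in sequentially. c * \<rho> n powr (1 / 4) < 1" by (rule order_tendstoD(2)[OF \<epsilon>lim]) simp
  ultimately have "\<forall>\<^sub>F n in sequentially.
        neg_log (measure_pmf.prob (random_regular_graph n (d n))
          {G. real (hom_count K G) \<ge> (t + c * \<rho> n powr (1 / 4)) * p n ^ card (edges K) * real n ^ card (verts K)})
        \<ge> ereal (1 - (2048 * sqrt (\<rho> n) + 112 / \<delta>0\<^sup>2 * \<rho> n)) * Phi n (d n) K t"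
    using eventually_ge_at_top[of 4]
  proof eventually_elim
    case (elim n)
    have "2 * real (d n) \<le> real n" using elim by (simp add: assms(7) field_simps)
    then have d2: "2 * d n \<le> n" by linarith
    show ?case
      using elim d2 assms(5)[of n] assms(6)[of n] assms(1,4) \<delta>0
      by (intro neg_log_prob_ge) (auto simp: assms(7) c_def c1_def \<rho>_def)
  qed
  moreover have "(\<lambda>n. c * \<rho> n powr (1 / 4)) \<in> o(\<lambda>_. 1)" using \<epsilon>lim by (intro smalloI_tendsto) auto
  moreover have "(\<lambda>n. 2048 * sqrt (\<rho> n) + 112 / \<delta>0\<^sup>2 * \<rho> n) \<in> o(\<lambda>_. 1)"
    using \<delta>'lim by (intro smalloI_tendsto) auto
  ultimately show ?thesis by blast
qed

end
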